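(* Let $m>0$, let $I=\mathbb R$ or $I=\mathbb R_+$, let $\mathcal H\in\mathrm{AC}_{\rm loc}(I)$ be positive definite with $\mathcal HJ\mathcal H=J$, and let $\Theta\in\mathcal G(\mathcal H;I)$ satisfy $P_{m,\Theta}\in L^2(I)$. (a) Multiplication $U_\Theta f=\Theta f$ is unitary from the unweighted space $L^2(I;\mathbb C^{2n})$ onto $$L^2_{\mathcal H}(I)=\Big\{y:\int_I y(t)^*\mathcal H(t)y(t)\,dt<\infty\Big\}.$$ (b) If $I=\mathbb R$, the operator $$\mathcal A^{(\Theta)}_{m,\mathcal H}:=U_\Theta(D_m+P_{m,\Theta})U_\Theta^{-1},\qquad \operatorname{Dom}\mathcal A^{(\Theta)}_{m,\mathcal H}=U_\Theta H^1(\mathbb R;\mathbb C^{2n}),$$ is self-adjoint in $L^2_{\mathcal H}(\mathbb R)$ and acts almost everywhere as $y\mapsto\mathcal H^{-1}(-iJy'+mBy)$. (c) If $I=\mathbb R_+$, a maximal $J$-isotropic boundary condition $y(0)\in\Lambda$ is transported under $y=U_\Theta f$ to $$f(0)\in L_\Theta:=\Theta(0)^{-1}\Lambda,$$ and the corresponding domain is $U_\Theta\{f\in H^1(\mathbb R_+;\mathbb C^{2n}):f(0)\in L_\Theta\}$. (d) If $\Theta_0,\Theta_1\in\mathcal G(\mathcal H;I)$ are two gauges with $P_{m,\Theta_j}\in L^2(I)$ for $j=0,1$, then the transported full-line operators (when $I=\mathbb R$), and the transported half-line operators with the same canonical boundary space $\Lambda$ (when $I=\mathbb R_+$), coincide.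 In particular, both the realization and its domain are gauge independent.
   Context: Fix $n\ge1$ and $J,B\in\mathbb C^{2n\times2n}$ with $J=J^*$, $B=B^*$, $J^2=B^2=I$, $JB=-BJ$. $\mathbb R_+=[0,\infty)$ with regular endpoint $0$. A matrix $\Theta$ is $J$-unitary if $\Theta^*J\Theta=J$. $\mathcal G(\mathcal H;I)$ is the set of locally absolutely continuous $J$-unitary matrix functions $\Theta:I\to\mathbb C^{2n\times2n}$ with $\mathcal H=\Theta^{-*}\Theta^{-1}$ (gauges). For such $\Theta$, $P_{m,\Theta}=-i\Theta^*J\Theta'+m(\Theta^*B\Theta-B)$, which is Hermitian a.e. $D_m=-iJ\frac d{dt}+mB$ on $H^1(\mathbb R;\mathbb C^{2n})$. $L^2_{\mathcal H}(I)$ carries the inner product $\int_I y^*\mathcal Hz\,dt$. A subspace $\Lambda\subset\mathbb C^{2n}$ is maximal $J$-isotropic if $u^*Jv=0$ for all $u,v\in\Lambda$ and $\dim\Lambda=n$. The transported half-line operator for $\Theta$ and $\Lambda$ is $U_\Theta\big(-iJ\frac d{dt}+mB+P_{m,\Theta}\big)U_\Theta^{-1}$ on the domain displayed in (c). *)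

theory Defs
  imports "HOL-Analysis.Analysis"
begin

section \<open>Complex matrices\<close>

definition cadj :: "complex^'k^'l \<Rightarrow> complex^'l^'k" where
  "cadj A = (\<chi> i j. cnj (A $ j $ i))"

definition cdot :: "complex^'k \<Rightarrow> complex^'k \<Rightarrow> complex" where
  "cdot u v = (\<Sum>i\<in>UNIV. cnj (u $ i) * v $ i)"

definition pos_def :: "complex^'k^'k \<Rightarrow> bool" where
  "pos_def A \<longleftrightarrow> cadj A = A \<and> (\<forall>u. u \<noteq> 0 \<longrightarrow> 0 < Re (cdot u (A *v u)))"

definition J_unitary :: "complex^'k^'k \<Rightarrow> complex^'k^'k \<Rightarrow> bool" where
  "J_unitary J \<Theta> \<longleftrightarrow> cadj \<Theta> ** J ** \<Theta> = J"

text \<open>The space \<open>vec\<close> is \<open>complex^'k\<close> over the field of complex numbers, so subspaces and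
  dimensions here are complex ones.\<close>

definition max_J_isotropic :: "complex^'k^'k \<Rightarrow> nat \<Rightarrow> (complex^'k) set \<Rightarrow> bool" where
  "max_J_isotropic J n \<Lambda> \<longleftrightarrow>
     vec.subspace \<Lambda> \<and> (\<forall>u\<in>\<Lambda>. \<forall>v\<in>\<Lambda>. cdot u (J *v v) = 0) \<and> vec.dim \<Lambda> = n"

section \<open>Absolute continuity\<close>

text \<open>A family of intervals is given by its pairs of endpoints; the intervals may touch.\<close>

definition abs_cont_on :: "real \<Rightarrow> real \<Rightarrow> (real \<Rightarrow> 'a::metric_space) \<Rightarrow> bool" where
  "abs_cont_on a b f \<longleftrightarrow>
     (\<forall>\<epsilon>>0. \<exists>\<delta>>0. \<forall>P::(real \<times> real) set.
        finite P \<longrightarrow> (\<forall>(u, v)\<in>P. a \<le> u \<and> u \<le> v \<and> v \<le> b) \<longrightarrow>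
        disjoint_family_on (\<lambda>(u, v). {u<..<v}) P \<longrightarrow>
        (\<Sum>(u, v)\<in>P. v - u) < \<delta> \<longrightarrow> (\<Sum>(u, v)\<in>P. dist (f u) (f v)) < \<epsilon>)"

definition AC_loc :: "real set \<Rightarrow> (real \<Rightarrow> 'a::metric_space) \<Rightarrow> bool" where
  "AC_loc I f \<longleftrightarrow> (\<forall>a b. a \<le> b \<longrightarrow> {a..b} \<subseteq> I \<longrightarrow> abs_cont_on a b f)"

text \<open>The classical derivative; for locally absolutely continuous functions it exists almost
  everywhere, and its (arbitrary) value on the exceptional null set is never relevant.\<close>

abbreviation ddt :: "(real \<Rightarrow> 'a::real_normed_vector) \<Rightarrow> real \<Rightarrow> 'a" where
  "ddt f \<equiv> (\<lambda>t. vector_derivative f (at t))"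

section \<open>Weighted \<open>L\<^sup>2\<close> spaces of classes of functions\<close>

text \<open>Functions on \<open>I\<close> are total functions on the reals whose values outside \<open>I\<close> are irrelevant.
  The elements of the \<open>L\<^sup>2\<close> spaces are classes of measurable functions modulo equality almost
  everywhere on \<open>I\<close>.\<close>

definition ae_rel :: "real set \<Rightarrow> ((real \<Rightarrow> complex^'k) \<times> (real \<Rightarrow> complex^'k)) set" where
  "ae_rel I = {(f, g). f \<in> borel_measurable (lebesgue_on I) \<and>
     g \<in> borel_measurable (lebesgue_on I) \<and> (AE t in lebesgue_on I. f t = g t)}"

definition cls :: "real set \<Rightarrow> (real \<Rightarrow> complex^'k) \<Rightarrow> (real \<Rightarrow> complex^'k) set" where
  "cls I f = ae_rel I `` {f}"

definition L2fun :: "real set \<Rightarrow> (real \<Rightarrow> complex^'k^'k) \<Rightarrow> (real \<Rightarrow> complex^'k) set" where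
  "L2fun I W = {y \<in> borel_measurable (lebesgue_on I).
     integrable (lebesgue_on I) (\<lambda>t. cdot (y t) (W t *v y t))}"

definition L2 :: "real set \<Rightarrow> (real \<Rightarrow> complex^'k^'k) \<Rightarrow> (real \<Rightarrow> complex^'k) set set" where
  "L2 I W = L2fun I W // ae_rel I"

abbreviation one_weight :: "real \<Rightarrow> complex^'k^'k" where
  "one_weight \<equiv> (\<lambda>_. mat 1)"

definition cls_add :: "real set \<Rightarrow> (real \<Rightarrow> complex^'k) set \<Rightarrow> (real \<Rightarrow> complex^'k) set
    \<Rightarrow> (real \<Rightarrow> complex^'k) set" where
  "cls_add I F G = ae_rel I `` {(\<lambda>t. f t + g t) | f g. f \<in> F \<and> g \<in> G}"

definition cls_scale :: "real set \<Rightarrow> complex \<Rightarrow> (real \<Rightarrow> complex^'k) set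
    \<Rightarrow> (real \<Rightarrow> complex^'k) set" where
  "cls_scale I c F = ae_rel I `` {(\<lambda>t. c *s f t) | f. f \<in> F}"

definition L2_inner :: "real set \<Rightarrow> (real \<Rightarrow> complex^'k^'k) \<Rightarrow> (real \<Rightarrow> complex^'k) set
    \<Rightarrow> (real \<Rightarrow> complex^'k) set \<Rightarrow> complex" where
  "L2_inner I W Y Z = (let y = (SOME y. y \<in> Y); z = (SOME z. z \<in> Z)
     in (\<integral>t. cdot (y t) (W t *v z t) \<partial>lebesgue_on I))"

definition L2_dist :: "real set \<Rightarrow> (real \<Rightarrow> complex^'k^'k) \<Rightarrow> (real \<Rightarrow> complex^'k) set
    \<Rightarrow> (real \<Rightarrow> complex^'k) set \<Rightarrow> real" where
  "L2_dist I W Y Z = (let D = cls_add I Y (cls_scale I (-1) Z) in sqrt (Re (L2_inner I W D D)))"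

definition L2_unitary :: "real set \<Rightarrow> (real \<Rightarrow> complex^'k^'k) \<Rightarrow> (real \<Rightarrow> complex^'k^'k)
    \<Rightarrow> ((real \<Rightarrow> complex^'k) set \<Rightarrow> (real \<Rightarrow> complex^'k) set) \<Rightarrow> bool" where
  "L2_unitary I V W T \<longleftrightarrow>
     bij_betw T (L2 I V) (L2 I W) \<and>
     (\<forall>F\<in>L2 I V. \<forall>G\<in>L2 I V. T (cls_add I F G) = cls_add I (T F) (T G)) \<and>
     (\<forall>c. \<forall>F\<in>L2 I V. T (cls_scale I c F) = cls_scale I c (T F)) \<and>
     (\<forall>F\<in>L2 I V. \<forall>G\<in>L2 I V. L2_inner I W (T F) (T G) = L2_inner I V F G)"

section \<open>Self-adjoint operators\<close>

text \<open>An unbounded operator is represented by its graph.\<close>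

definition adjoint_graph where
  "adjoint_graph I W A = {(v, w). v \<in> L2 I W \<and> w \<in> L2 I W \<and>
     (\<forall>(u, z)\<in>A. L2_inner I W z v = L2_inner I W u w)}"

definition self_adjoint_in :: "real set \<Rightarrow> (real \<Rightarrow> complex^'k^'k)
    \<Rightarrow> ((real \<Rightarrow> complex^'k) set \<times> (real \<Rightarrow> complex^'k) set) set \<Rightarrow> bool" where
  "self_adjoint_in I W A \<longleftrightarrow>
     A \<subseteq> L2 I W \<times> L2 I W \<and> single_valued A \<and>
     (\<forall>v\<in>L2 I W. \<forall>\<epsilon>>0. \<exists>u\<in>Domain A. L2_dist I W v u < \<epsilon>) \<and>
     A = adjoint_graph I W A"

section \<open>Gauges and the transported operators\<close>

text \<open>The Sobolev space, given by the locally absolutely continuous representatives of its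
  elements, so that \<open>f 0\<close> is the trace at the endpoint.\<close>

definition H1 :: "real set \<Rightarrow> (real \<Rightarrow> complex^'k) set" where
  "H1 I = {f. AC_loc I f \<and> f \<in> L2fun I one_weight \<and> ddt f \<in> L2fun I one_weight}"

definition gauges :: "complex^'k^'k \<Rightarrow> (real \<Rightarrow> complex^'k^'k) \<Rightarrow> real set
    \<Rightarrow> (real \<Rightarrow> complex^'k^'k) set" where
  "gauges J H I = {\<Theta>. AC_loc I \<Theta> \<and> (\<forall>t\<in>I. J_unitary J (\<Theta> t)) \<and>
     (\<forall>t\<in>I. H t = cadj (matrix_inv (\<Theta> t)) ** matrix_inv (\<Theta> t))}"

definition gauge_pot :: "complex^'k^'k \<Rightarrow> complex^'k^'k \<Rightarrow> real \<Rightarrow> (real \<Rightarrow> complex^'k^'k)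
    \<Rightarrow> real \<Rightarrow> complex^'k^'k" where
  "gauge_pot J B m \<Theta> t =
     mat (- \<i>) ** cadj (\<Theta> t) ** J ** ddt \<Theta> t + m *\<^sub>R (cadj (\<Theta> t) ** B ** \<Theta> t - B)"

definition matrix_L2 :: "real set \<Rightarrow> (real \<Rightarrow> complex^'k^'k) \<Rightarrow> bool" where
  "matrix_L2 I P \<longleftrightarrow> P \<in> borel_measurable (lebesgue_on I) \<and>
     integrable (lebesgue_on I) (\<lambda>t. (norm (P t))\<^sup>2)"

definition dirac_expr :: "complex^'k^'k \<Rightarrow> complex^'k^'k \<Rightarrow> real \<Rightarrow> (real \<Rightarrow> complex^'k)
    \<Rightarrow> real \<Rightarrow> complex^'k" where
  "dirac_expr J B m f t = (- \<i>) *s (J *v ddt f t) + m *\<^sub>R (B *v f t)"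

text \<open>The graph of \<open>D\<^sub>m + P\<close> on the classes of the functions in \<open>D\<close>.\<close>

definition dirac_op :: "real set \<Rightarrow> complex^'k^'k \<Rightarrow> complex^'k^'k \<Rightarrow> real
    \<Rightarrow> (real \<Rightarrow> complex^'k^'k) \<Rightarrow> (real \<Rightarrow> complex^'k) set
    \<Rightarrow> ((real \<Rightarrow> complex^'k) set \<times> (real \<Rightarrow> complex^'k) set) set" where
  "dirac_op I J B m P D =
     (\<lambda>f. (cls I f, cls I (\<lambda>t. dirac_expr J B m f t + P t *v f t))) ` D"

definition U_fun :: "(real \<Rightarrow> complex^'k^'k) \<Rightarrow> (real \<Rightarrow> complex^'k) \<Rightarrow> real \<Rightarrow> complex^'k" where
  "U_fun \<Theta> f t = \<Theta> t *v f t"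

definition U_gauge :: "real set \<Rightarrow> (real \<Rightarrow> complex^'k^'k) \<Rightarrow> (real \<Rightarrow> complex^'k) set
    \<Rightarrow> (real \<Rightarrow> complex^'k) set" where
  "U_gauge I \<Theta> F = ae_rel I `` (U_fun \<Theta> ` F)"

text \<open>The graph of \<open>U T U\<^sup>-\<^sup>1\<close> consists of the pairs \<open>(U F, U G)\<close> with \<open>(F, G)\<close> in the graph of \<open>T\<close>.\<close>

definition transported_op :: "real set \<Rightarrow> complex^'k^'k \<Rightarrow> complex^'k^'k \<Rightarrow> real
    \<Rightarrow> (real \<Rightarrow> complex^'k^'k) \<Rightarrow> (real \<Rightarrow> complex^'k) set
    \<Rightarrow> ((real \<Rightarrow> complex^'k) set \<times> (real \<Rightarrow> complex^'k) set) set" where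
  "transported_op I J B m \<Theta> D =
     map_prod (U_gauge I \<Theta>) (U_gauge I \<Theta>) ` dirac_op I J B m (gauge_pot J B m \<Theta>) D"

definition full_line_op where
  "full_line_op J B m \<Theta> = transported_op UNIV J B m \<Theta> (H1 UNIV)"

definition L_gauge :: "(real \<Rightarrow> complex^'k^'k) \<Rightarrow> (complex^'k) set \<Rightarrow> (complex^'k) set" where
  "L_gauge \<Theta> \<Lambda> = (\<lambda>u. matrix_inv (\<Theta> 0) *v u) ` \<Lambda>"

definition half_line_op where
  "half_line_op J B m \<Theta> \<Lambda> =
     transported_op {0..} J B m \<Theta> {f \<in> H1 {0..}. f 0 \<in> L_gauge \<Theta> \<Lambda>}"

end

theory Submission
  imports Defs
begin

text \<open>For \<open>y = \<Theta> f\<close>, the relations \<open>\<Theta>\<^sup>* J \<Theta> = J\<close> and \<open>\<H>\<^sup>-\<^sup>1 = \<Theta> \<Theta>\<^sup>*\<close> give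
  \<open>\<Theta> (D\<^sub>m f + P f) = \<H>\<^sup>-\<^sup>1 (-\<i> J y' + m B y)\<close>. Hence the transported operator is the restriction of the
  gauge-free expression to the locally absolutely continuous \<open>y\<close> such that \<open>y\<close> and the expression are
  square integrable for the weight \<open>\<H>\<close>: if \<open>f\<close> and \<open>D\<^sub>m f + P f\<close> are square integrable, then \<open>f\<close> is
  bounded (on short intervals the term \<open>P f\<close> is absorbed because \<open>P \<in> L\<^sup>2\<close>), so \<open>P f\<close> and therefore \<open>f'\<close>
  are square integrable. Since \<open>P\<close> is Hermitian, self-adjointness is the same regularity statement for the elements of the
  adjoint domain, which are locally absolutely continuous by testing with trapezoidal functions.

  The underlying facts on absolutely continuous functions are obtained from Radon-Nikodym, applied to
  the measure of a monotone absolutely continuous function, together with the differentiation theorem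
  \<open>integrable_ccontinuous_explicit\<close>.\<close>

section \<open>Absolutely continuous functions\<close>

text \<open>The obstacle is that P is only square integrable: it is neither bounded nor visibly a
  small perturbation of D_m. What rescues P f is one-dimensional, namely that functions in H^1 are
  bounded. The same fact decides gauge independence. Two gauges of \<open>H\<close> differ by the
  factor \<Theta>0^{-1} \<Theta>1, and it is not apparent that multiplication by it preserves H^1,
  so the gauges are never compared with each other but each with \<open>canonical_op\<close>. A
  pulled-back function is then only known to be locally absolutely continuous with the sum D_m f + P
  f square integrable, and \<open>H1_of_dirac_expr\<close> has to separate the two terms. A second
  theme is the gap between classes and functions. Endpoint values and derivatives belong to
  functions, the operators act on classes. On \<open>I\<close> a class has at most one locally
  absolutely continuous representative (\<open>AC_loc_eq_of_AE_eq\<close>), which makes the graphs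
  single valued and boundary conditions meaningful. The algebraic relations of \<open>J\<close> also
  give \<Theta>^{-1} = J \<Theta>^* J, so that the inverse gauge is as regular as the gauge
  itself.\<close>

definition interval_family :: "real \<Rightarrow> real \<Rightarrow> (real \<times> real) set \<Rightarrow> bool" where
  "interval_family a b P \<longleftrightarrow> finite P \<and> (\<forall>(u, v)\<in>P. a \<le> u \<and> u \<le> v \<and> v \<le> b) \<and>
     disjoint_family_on (\<lambda>(u, v). {u<..<v}) P"

abbreviation total_length :: "(real \<times> real) set \<Rightarrow> real" where
  "total_length P \<equiv> \<Sum>(u, v)\<in>P. v - u"

abbreviation variation :: "(real \<Rightarrow> 'a::metric_space) \<Rightarrow> (real \<times> real) set \<Rightarrow> real" where
  "variation f P \<equiv> \<Sum>(u, v)\<in>P. dist (f u) (f v)"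

lemma abs_cont_on_iff:
  "abs_cont_on a b f \<longleftrightarrow>
     (\<forall>\<epsilon>>0. \<exists>\<delta>>0. \<forall>P. interval_family a b P \<longrightarrow> total_length P < \<delta> \<longrightarrow>
        variation f P < \<epsilon>)"
  unfolding abs_cont_on_def interval_family_def by (meson)

text \<open>Clipping and subdividing produce indexed families in which several indices may carry the
  same degenerate interval, while \<open>abs_cont_on\<close> speaks of sets of pairs. Disjoint
  nondegenerate intervals are distinct pairs, since equal ones would share their midpoint, and a
  degenerate one contributes \<open>h x x = 0\<close>; dropping the latter changes no such
  sum.\<close>

lemma interval_family_of_indexed:
  fixes u v :: "'i \<Rightarrow> real"
  assumes "finite S" and "\<And>i. i \<in> S \<Longrightarrow> a \<le> u i \<and> u i \<le> v i \<and> v i \<le> b"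
    and disj: "disjoint_family_on (\<lambda>i. {u i<..<v i}) S"
  obtains P where "interval_family a b P"
    and "\<And>h :: real \<Rightarrow> real \<Rightarrow> real. (\<And>x. h x x = 0) \<Longrightarrow> (\<Sum>(x, y)\<in>P. h x y) = (\<Sum>i\<in>S. h (u i) (v i))"
proof
  define S' where "S' = {i\<in>S. u i < v i}"
  have inj: "inj_on (\<lambda>i. (u i, v i)) S'"
  proof (rule inj_onI)
    fix i j assume ij: "i \<in> S'" "j \<in> S'" "(u i, v i) = (u j, v j)"
    have "(u i + v i) / 2 \<in> {u i<..<v i} \<inter> {u j<..<v j}"
      using ij by (auto simp: S'_def)
    then show "i = j" using disj ij unfolding disjoint_family_on_def S'_def by blast
  qed
  show "interval_family a b ((\<lambda>i. (u i, v i)) ` S')"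
    unfolding interval_family_def
  proof (intro conjI)
    show "finite ((\<lambda>i. (u i, v i)) ` S')" using assms(1) by (simp add: S'_def)
    show "\<forall>(x, y)\<in>(\<lambda>i. (u i, v i)) ` S'. a \<le> x \<and> x \<le> y \<and> y \<le> b"
      using assms(2) by (auto simp: S'_def)
    show "disjoint_family_on (\<lambda>(u, v). {u<..<v}) ((\<lambda>i. (u i, v i)) ` S')"
      using disj unfolding disjoint_family_on_def S'_def by auto
  qed
  fix h :: "real \<Rightarrow> real \<Rightarrow> real" assume h: "\<And>x. h x x = 0"
  have "(\<Sum>(x, y)\<in>(\<lambda>i. (u i, v i)) ` S'. h x y) = (\<Sum>i\<in>S'. h (u i) (v i))"
    by (subst sum.reindex[OF inj]) (simp add: o_def)
  also have "\<dots> = (\<Sum>i\<in>S. h (u i) (v i))"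
  proof (rule sum.mono_neutral_left)
    show "\<forall>i\<in>S - S'. h (u i) (v i) = 0"
      using assms(2) h by (force simp: S'_def order.order_iff_strict)
  qed (use assms(1) in \<open>auto simp: S'_def\<close>)
  finally show "(\<Sum>(x, y)\<in>(\<lambda>i. (u i, v i)) ` S'. h x y) = (\<Sum>i\<in>S. h (u i) (v i))" .
qed

lemma abs_cont_on_indexed:
  assumes "abs_cont_on a b f" "\<epsilon> > 0"
  obtains \<delta> where "\<delta> > 0"
    and "\<And>(S :: 'i set) u v. finite S \<Longrightarrow> (\<And>i. i \<in> S \<Longrightarrow> a \<le> u i \<and> u i \<le> v i \<and> v i \<le> b) \<Longrightarrow>
       disjoint_family_on (\<lambda>i. {u i<..<v i}) S \<Longrightarrow> (\<Sum>i\<in>S. v i - u i) < \<delta> \<Longrightarrow>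
       (\<Sum>i\<in>S. dist (f (u i)) (f (v i))) < \<epsilon>"
proof -
  obtain \<delta> where "\<delta> > 0" and \<delta>: "\<And>P. interval_family a b P \<Longrightarrow> total_length P < \<delta> \<Longrightarrow>
        variation f P < \<epsilon>"
    using assms unfolding abs_cont_on_iff by metis
  show thesis
  proof
    show "\<delta> > 0" by fact
    fix S :: "'i set" and u v
    assume *: "finite S" "\<And>i. i \<in> S \<Longrightarrow> a \<le> u i \<and> u i \<le> v i \<and> v i \<le> b"
       "disjoint_family_on (\<lambda>i. {u i<..<v i}) S" and len: "(\<Sum>i\<in>S. v i - u i) < \<delta>"
    obtain P where P: "interval_family a b P"
      and h: "\<And>h :: real \<Rightarrow> real \<Rightarrow> real. (\<And>x. h x x = 0) \<Longrightarrow> (\<Sum>(x, y)\<in>P. h x y) = (\<Sum>i\<in>S. h (u i) (v i))"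
      by (rule interval_family_of_indexed[OF *]) auto
    show "(\<Sum>i\<in>S. dist (f (u i)) (f (v i))) < \<epsilon>"
      using \<delta>[OF P] len h[of "\<lambda>x y. y - x"] h[of "\<lambda>x y. dist (f x) (f y)"] by simp
  qed
qed

text \<open>Once a total length is a measure, sums over disjoint intervals can be estimated by
  monotonicity of measure.\<close>

lemma
  fixes u v :: "'i \<Rightarrow> real"
  assumes "finite S" and le: "\<And>i. i \<in> S \<Longrightarrow> u i \<le> v i"
    and disj: "disjoint_family_on (\<lambda>i. {u i<..<v i}) S"
  shows sum_length_eq_measure: "(\<Sum>i\<in>S. v i - u i) = measure lebesgue (\<Union>i\<in>S. {u i<..<v i})"
    and UN_interval_lmeasurable: "(\<Union>i\<in>S. {u i<..<v i}) \<in> lmeasurable"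
proof -
  have eq: "measure lebesgue {u i<..<v i} = v i - u i" "emeasure lebesgue {u i<..<v i} \<noteq> \<infinity>" if "i \<in> S" for i
    using le[OF that] by (simp_all add: measure_def emeasure_lborel_Ioo)
  have "measure lebesgue (\<Union>i\<in>S. {u i<..<v i}) = (\<Sum>i\<in>S. measure lebesgue {u i<..<v i})"
    by (rule measure_finite_Union[OF assms(1) _ disj]) (use eq in auto)
  also have "\<dots> = (\<Sum>i\<in>S. v i - u i)" by (intro sum.cong refl eq(1))
  finally show "(\<Sum>i\<in>S. v i - u i) = measure lebesgue (\<Union>i\<in>S. {u i<..<v i})" ..
  show "(\<Union>i\<in>S. {u i<..<v i}) \<in> lmeasurable"
    using assms(1) eq(2) by (intro fmeasurable.finite_UN) (auto simp: fmeasurable_def less_top)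
qed

lemma interval_family_D:
  assumes "interval_family a b P"
  shows "finite P" and "\<And>p. p \<in> P \<Longrightarrow> a \<le> fst p \<and> fst p \<le> snd p \<and> snd p \<le> b"
    and "disjoint_family_on (\<lambda>p. {fst p<..<snd p}) P"
  using assms by (auto simp: interval_family_def case_prod_unfold)

lemma sum_interval_family_length:
  assumes P: "interval_family a b P" and ab: "a \<le> b"
  shows "total_length P \<le> b - a"
proof -
  note P' = interval_family_D[OF P]
  have "total_length P = measure lebesgue (\<Union>p\<in>P. {fst p<..<snd p})"
    using sum_length_eq_measure[OF P'(1) _ P'(3)] P'(2) by (simp add: case_prod_unfold)
  also have "\<dots> \<le> measure lebesgue {a..b}"
    using UN_interval_lmeasurable[OF P'(1) _ P'(3)] P'(2)
    by (intro measure_mono_fmeasurable) (force simp: fmeasurableD)+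
  finally show ?thesis using ab by simp
qed

section \<open>Closure properties of absolute continuity\<close>

lemma abs_cont_on_cong:
  assumes "abs_cont_on a b f" "\<And>t. t \<in> {a..b} \<Longrightarrow> f t = g t"
  shows "abs_cont_on a b g"
proof -
  have "variation f P = variation g P" if "interval_family a b P" for P
    using that assms(2) unfolding interval_family_def by (intro sum.cong) auto
  then show ?thesis using assms(1) unfolding abs_cont_on_iff by (metis (no_types, lifting))
qed

lemma abs_cont_on_imp_uniformly_continuous:
  assumes "abs_cont_on a b f"
  shows "uniformly_continuous_on {a..b} f"
  unfolding uniformly_continuous_on_def
proof (intro allI impI)
  fix e :: real assume "e > 0"
  then obtain \<delta> where "\<delta> > 0" and \<delta>: "\<And>P. interval_family a b P \<Longrightarrow> total_length P < \<delta> \<Longrightarrow>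
        variation f P < e"
    using assms unfolding abs_cont_on_iff by metis
  have "dist (f y) (f x) < e" if "x \<in> {a..b}" "y \<in> {a..b}" "dist y x < \<delta>" for x y
  proof -
    have "interval_family a b {(min x y, max x y)}"
      using that by (auto simp: interval_family_def disjoint_family_on_def)
    from \<delta>[OF this] show ?thesis using that
      by (cases "x \<le> y") (auto simp: min_def max_def dist_real_def dist_commute)
  qed
  then show "\<exists>d>0. \<forall>x\<in>{a..b}. \<forall>x'\<in>{a..b}. dist x' x < d \<longrightarrow> dist (f x') (f x) < e"
    using \<open>\<delta> > 0\<close> by blast
qed

lemma abs_cont_on_continuous:
  "abs_cont_on a b f \<Longrightarrow> continuous_on {a..b} f"
  by (simp add: abs_cont_on_imp_uniformly_continuous uniformly_continuous_imp_continuous)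

lemma abs_cont_on_dominated:
  assumes "abs_cont_on a b f"
    and "\<And>u v. a \<le> u \<Longrightarrow> u \<le> v \<Longrightarrow> v \<le> b \<Longrightarrow> dist (g u) (g v) \<le> C * dist (f u) (f v)"
  shows "abs_cont_on a b g"
  unfolding abs_cont_on_iff
proof (intro allI impI)
  fix e :: real assume "e > 0"
  \<comment> \<open>\<open>C\<close> may be zero or negative, so it is raised to at least 1 before
    dividing by it.\<close>
  define C' where "C' = max C 1"
  have "e / C' > 0" using \<open>e > 0\<close> by (simp add: C'_def)
  then obtain \<delta> where "\<delta> > 0" and \<delta>: "\<And>P. interval_family a b P \<Longrightarrow> total_length P < \<delta> \<Longrightarrow>
        variation f P < e / C'"
    using assms(1) unfolding abs_cont_on_iff by metis
  have "variation g P < e" if P: "interval_family a b P" "total_length P < \<delta>" for P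
  proof -
    have "variation g P \<le> (\<Sum>(u, v)\<in>P. C' * dist (f u) (f v))"
    proof (rule sum_mono, clarify)
      fix u v assume "(u, v) \<in> P"
      then have "dist (g u) (g v) \<le> C * dist (f u) (f v)"
        using P(1) assms(2) unfolding interval_family_def by auto
      also have "\<dots> \<le> C' * dist (f u) (f v)" by (intro mult_right_mono) (auto simp: C'_def)
      finally show "dist (g u) (g v) \<le> C' * dist (f u) (f v)" .
    qed
    also have "\<dots> = C' * variation f P"
      by (simp add: sum_distrib_left case_prod_unfold)
    also have "\<dots> < C' * (e / C')"
      using \<delta>[OF P] by (intro mult_strict_left_mono) (auto simp: C'_def)
    finally show ?thesis by (simp add: C'_def)
  qed
  then show "\<exists>\<delta>>0. \<forall>P. interval_family a b P \<longrightarrow> total_length P < \<delta> \<longrightarrow>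
      variation g P < e"
    using \<open>\<delta> > 0\<close> by blast
qed

text \<open>The pair \<open>(f, g)\<close> is absolutely continuous and its distance dominates both
  distances on the right, which reduces two controlling functions to one.\<close>

lemma abs_cont_on_dominated2:
  assumes f: "abs_cont_on a b f" and g: "abs_cont_on a b g"
    and h: "\<And>u v. a \<le> u \<Longrightarrow> u \<le> v \<Longrightarrow> v \<le> b \<Longrightarrow> dist (h u) (h v) \<le> C * dist (f u) (f v) + D * dist (g u) (g v)"
  shows "abs_cont_on a b h"
proof -
  have "abs_cont_on a b (\<lambda>t. (f t, g t))"
    unfolding abs_cont_on_iff
  proof (intro allI impI)
    fix e :: real assume "e > 0"
    then have "e / 2 > 0" by simp
    then obtain \<delta>1 \<delta>2 where "\<delta>1 > 0" "\<delta>2 > 0"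
      and \<delta>1: "\<And>P. interval_family a b P \<Longrightarrow> total_length P < \<delta>1 \<Longrightarrow>
          variation f P < e / 2"
      and \<delta>2: "\<And>P. interval_family a b P \<Longrightarrow> total_length P < \<delta>2 \<Longrightarrow>
          variation g P < e / 2"
      using f g unfolding abs_cont_on_iff by metis
    have "variation (\<lambda>t. (f t, g t)) P < e"
      if P: "interval_family a b P" "total_length P < min \<delta>1 \<delta>2" for P
    proof -
      have "variation (\<lambda>t. (f t, g t)) P \<le> (\<Sum>(u, v)\<in>P. dist (f u) (f v) + dist (g u) (g v))"
        by (intro sum_mono) (auto simp: dist_Pair_Pair intro: sqrt_sum_squares_le_sum)
      also have "\<dots> = variation f P + variation g P"
        by (simp add: sum.distrib case_prod_unfold)
      finally show ?thesis using \<delta>1[OF P(1)] \<delta>2[OF P(1)] P(2) by simp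
    qed
    then show "\<exists>\<delta>>0. \<forall>P. interval_family a b P \<longrightarrow> total_length P < \<delta> \<longrightarrow>
        variation (\<lambda>t. (f t, g t)) P < e"
      using \<open>\<delta>1 > 0\<close> \<open>\<delta>2 > 0\<close> by (intro exI[of _ "min \<delta>1 \<delta>2"]) auto
  qed
  then show ?thesis
  proof (rule abs_cont_on_dominated)
    fix u v assume uv: "a \<le> u" "u \<le> v" "v \<le> b"
    let ?d = "dist (f u, g u) (f v, g v)"
    have "dist (f u) (f v) \<le> ?d" "dist (g u) (g v) \<le> ?d"
      using dist_fst_le[of "(f u, g u)" "(f v, g v)"] dist_snd_le[of "(f u, g u)" "(f v, g v)"] by auto
    then have "C * dist (f u) (f v) \<le> \<bar>C\<bar> * ?d" "D * dist (g u) (g v) \<le> \<bar>D\<bar> * ?d"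
      by (metis abs_ge_self abs_ge_zero mult_mono zero_le_dist)+
    with h[OF uv] show "dist (h u) (h v) \<le> (\<bar>C\<bar> + \<bar>D\<bar>) * ?d"
      by (simp add: algebra_simps)
  qed
qed

lemma abs_cont_on_bilinear:
  fixes f :: "real \<Rightarrow> 'a::real_normed_vector" and g :: "real \<Rightarrow> 'b::real_normed_vector"
  assumes "bounded_bilinear pr" and f: "abs_cont_on a b f" and g: "abs_cont_on a b g"
  shows "abs_cont_on a b (\<lambda>t. pr (f t) (g t))"
proof -
  interpret bounded_bilinear pr by fact
  obtain K where K: "K > 0" "\<And>x y. norm (pr x y) \<le> norm x * norm y * K"
    using pos_bounded by metis
  have "bounded (f ` {a..b})" "bounded (g ` {a..b})"
    by (auto intro!: compact_imp_bounded compact_continuous_image abs_cont_on_continuous f g)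
  then obtain Mf Mg where Mf: "\<And>t. t \<in> {a..b} \<Longrightarrow> norm (f t) \<le> Mf" and Mg: "\<And>t. t \<in> {a..b} \<Longrightarrow> norm (g t) \<le> Mg"
    unfolding bounded_iff by (metis imageI)
  show ?thesis
  proof (rule abs_cont_on_dominated2[OF f g])
    fix u v assume uv: "a \<le> u" "u \<le> v" "v \<le> b"
    have "norm (pr (f u - f v) (g u)) \<le> dist (f u) (f v) * norm (g u) * K"
      using K(2)[of "f u - f v" "g u"] by (simp add: dist_norm)
    also have "\<dots> \<le> dist (f u) (f v) * Mg * K"
      using uv K(1) by (intro mult_right_mono mult_left_mono Mg) auto
    finally have 1: "norm (pr (f u - f v) (g u)) \<le> Mg * K * dist (f u) (f v)" by (simp add: mult_ac)
    have "norm (pr (f v) (g u - g v)) \<le> norm (f v) * dist (g u) (g v) * K"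
      using K(2)[of "f v" "g u - g v"] by (simp add: dist_norm)
    also have "\<dots> \<le> Mf * dist (g u) (g v) * K"
      using uv K(1) by (intro mult_right_mono Mf) auto
    finally have 2: "norm (pr (f v) (g u - g v)) \<le> Mf * K * dist (g u) (g v)" by (simp add: mult_ac)
    have "pr (f u) (g u) - pr (f v) (g v) = pr (f u - f v) (g u) + pr (f v) (g u - g v)"
      by (simp add: diff_left diff_right)
    then show "dist (pr (f u) (g u)) (pr (f v) (g v)) \<le> Mg * K * dist (f u) (f v) + Mf * K * dist (g u) (g v)"
      using 1 2 norm_triangle_le[of "pr (f u - f v) (g u)" "pr (f v) (g u - g v)"]
      by (simp add: dist_norm)
  qed
qed

lemma abs_cont_on_bounded_linear:
  assumes "bounded_linear L" and f: "abs_cont_on a b f"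
  shows "abs_cont_on a b (\<lambda>t. L (f t))"
proof -
  obtain K where K: "\<And>x. norm (L x) \<le> norm x * K"
    using bounded_linear.bounded[OF assms(1)] by auto
  show ?thesis
  proof (rule abs_cont_on_dominated[OF f])
    fix u v
    show "dist (L (f u)) (L (f v)) \<le> K * dist (f u) (f v)"
      using K[of "f u - f v"] linear_diff[OF bounded_linear.linear[OF assms(1)], of "f u" "f v"]
      by (simp add: dist_norm mult.commute)
  qed
qed

text \<open>Clamping maps an interval onto a subinterval of itself or to a point, so lengths do not
  grow and disjointness survives. The clamped function is the constant continuation of
  \<open>f\<close>; it is wanted because Stieltjes measures and primitives live on the whole
  line.\<close>

lemma abs_cont_on_clamp:
  assumes f: "abs_cont_on a b f" and "a \<le> b"
  shows "abs_cont_on c d (\<lambda>t. f (max a (min b t)))"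
  unfolding abs_cont_on_iff
proof (intro allI impI)
  let ?c = "\<lambda>t. max a (min b t)"
  fix e :: real assume "e > 0"
  from f this obtain \<delta> where "\<delta> > 0" and \<delta>: "\<And>(S :: (real \<times> real) set) u v. finite S \<Longrightarrow> (\<And>i. i \<in> S \<Longrightarrow> a \<le> u i \<and> u i \<le> v i \<and> v i \<le> b) \<Longrightarrow>
       disjoint_family_on (\<lambda>i. {u i<..<v i}) S \<Longrightarrow> (\<Sum>i\<in>S. v i - u i) < \<delta> \<Longrightarrow>
       (\<Sum>i\<in>S. dist (f (u i)) (f (v i))) < e"
    by (rule abs_cont_on_indexed) blast
  have "variation (\<lambda>t. f (?c t)) P < e"
    if P: "interval_family c d P" and len: "total_length P < \<delta>" for P
  proof -
    have "(\<Sum>p\<in>P. dist (f (?c (fst p))) (f (?c (snd p)))) < e"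
    proof (rule \<delta>)
      show "finite P" using P by (simp add: interval_family_def)
      show "a \<le> ?c (fst p) \<and> ?c (fst p) \<le> ?c (snd p) \<and> ?c (snd p) \<le> b" if "p \<in> P" for p
      proof -
        have "fst p \<le> snd p" using P that by (auto simp: interval_family_def)
        then show ?thesis using \<open>a \<le> b\<close> by auto
      qed
      have sub: "{?c u<..<?c v} \<subseteq> {u<..<v}" for u v
        by (auto simp: max_def min_def split: if_splits)
      have "disjoint_family_on (\<lambda>p. {fst p<..<snd p}) P"
        using P by (simp add: interval_family_def case_prod_unfold)
      then show "disjoint_family_on (\<lambda>p. {?c (fst p)<..<?c (snd p)}) P"
        unfolding disjoint_family_on_def using sub by blast
      have "(\<Sum>p\<in>P. ?c (snd p) - ?c (fst p)) \<le> (\<Sum>p\<in>P. snd p - fst p)"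
      proof (rule sum_mono)
        fix p assume "p \<in> P"
        then have "fst p \<le> snd p" using P by (auto simp: interval_family_def)
        then show "?c (snd p) - ?c (fst p) \<le> snd p - fst p" by (auto simp: max_def min_def)
      qed
      then show "(\<Sum>p\<in>P. ?c (snd p) - ?c (fst p)) < \<delta>" using len by (simp add: case_prod_unfold)
    qed
    then show ?thesis by (simp add: case_prod_unfold)
  qed
  then show "\<exists>\<delta>>0. \<forall>P. interval_family c d P \<longrightarrow> total_length P < \<delta> \<longrightarrow>
      variation (\<lambda>t. f (?c t)) P < e"
    using \<open>\<delta> > 0\<close> by blast
qed

section \<open>The variation function\<close>

lemma interval_family_mono:
  "interval_family a b P \<Longrightarrow> c \<le> a \<Longrightarrow> b \<le> d \<Longrightarrow> interval_family c d P"
  unfolding interval_family_def by fastforce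

text \<open>Every interval is replaced by its clippings to the two sides of \<open>b\<close>. For an
  interval containing \<open>b\<close> the estimate is the triangle inequality through
  \<open>f b\<close>; for any other, one of the clippings is a point.\<close>

lemma interval_family_split:
  fixes f :: "real \<Rightarrow> 'a::metric_space"
  assumes P: "interval_family a c P" and b: "a \<le> b" "b \<le> c"
  obtains P1 P2 where "interval_family a b P1" "interval_family b c P2"
    "variation f P \<le> variation f P1 + variation f P2"
proof -
  note fin = interval_family_D(1)[OF P] and bnd = interval_family_D(2)[OF P] and disj = interval_family_D(3)[OF P]
  have clip: "disjoint_family_on (\<lambda>p. {k (fst p)<..<k (snd p)}) P"
    if "\<And>x y. {k x<..<k y} \<subseteq> {x<..<y}" for k :: "real \<Rightarrow> real"
    using disj that unfolding disjoint_family_on_def by blast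
  have d1: "disjoint_family_on (\<lambda>p. {min b (fst p)<..<min b (snd p)}) P"
    by (rule clip) (auto simp: min_def)
  have d2: "disjoint_family_on (\<lambda>p. {max b (fst p)<..<max b (snd p)}) P"
    by (rule clip) (auto simp: max_def split: if_splits)
  have le1: "a \<le> min b (fst p) \<and> min b (fst p) \<le> min b (snd p) \<and> min b (snd p) \<le> b"
    and le2: "b \<le> max b (fst p) \<and> max b (fst p) \<le> max b (snd p) \<and> max b (snd p) \<le> c" if "p \<in> P" for p
    using bnd[OF that] b by auto
  obtain P1 where P1: "interval_family a b P1"
    and h1: "\<And>h :: real \<Rightarrow> real \<Rightarrow> real. (\<And>x. h x x = 0) \<Longrightarrow>
        (\<Sum>(x, y)\<in>P1. h x y) = (\<Sum>p\<in>P. h (min b (fst p)) (min b (snd p)))"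
    using interval_family_of_indexed[OF fin le1 d1] by blast
  obtain P2 where P2: "interval_family b c P2"
    and h2: "\<And>h :: real \<Rightarrow> real \<Rightarrow> real. (\<And>x. h x x = 0) \<Longrightarrow>
        (\<Sum>(x, y)\<in>P2. h x y) = (\<Sum>p\<in>P. h (max b (fst p)) (max b (snd p)))"
    using interval_family_of_indexed[OF fin le2 d2] by blast
  have "variation f P = (\<Sum>p\<in>P. dist (f (fst p)) (f (snd p)))" by (simp add: case_prod_unfold)
  also have "\<dots> \<le> (\<Sum>p\<in>P. dist (f (min b (fst p))) (f (min b (snd p)))
      + dist (f (max b (fst p))) (f (max b (snd p))))"
  proof (rule sum_mono)
    fix p assume "p \<in> P"
    then have "fst p \<le> snd p" using bnd by blast
    then show "dist (f (fst p)) (f (snd p)) \<le> dist (f (min b (fst p))) (f (min b (snd p)))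
      + dist (f (max b (fst p))) (f (max b (snd p)))"
      using dist_triangle[of "f (fst p)" "f (snd p)" "f b"]
      by (cases "b \<le> fst p"; cases "b \<le> snd p") auto
  qed
  also have "\<dots> = variation f P1 + variation f P2"
    using h1[of "\<lambda>x y. dist (f x) (f y)"] h2[of "\<lambda>x y. dist (f x) (f y)"] by (simp add: sum.distrib)
  finally show thesis using P1 P2 that by blast
qed

text \<open>Bisection: on subintervals shorter than the \<delta> belonging to \<epsilon> = 1 the
  variation stays below 1, and bounds on adjacent intervals add up.\<close>

lemma abs_cont_on_bounded_variation:
  assumes f: "abs_cont_on a b f" and ab: "a \<le> b"
  obtains K where "\<And>P. interval_family a b P \<Longrightarrow> variation f P \<le> K"
proof -
  define bv where "bv c d \<longleftrightarrow> (a \<le> c \<longrightarrow> c \<le> d \<longrightarrow> d \<le> b \<longrightarrow>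
    (\<exists>K. \<forall>P. interval_family c d P \<longrightarrow> variation f P \<le> K))" for c d
  have "bv a b"
    using ab
  proof (induction rule: Bolzano)
    case (trans x y z)
    show ?case
      unfolding bv_def
    proof (intro impI)
      assume *: "a \<le> x" "x \<le> z" "z \<le> b"
      then obtain K1 K2 where K: "\<And>P. interval_family x y P \<Longrightarrow> variation f P \<le> K1"
        "\<And>P. interval_family y z P \<Longrightarrow> variation f P \<le> K2"
        using trans unfolding bv_def by fastforce
      have "variation f P \<le> K1 + K2" if "interval_family x z P" for P
        using interval_family_split[OF that trans(3,4), of f] K by (smt (verit))
      then show "\<exists>K. \<forall>P. interval_family x z P \<longrightarrow> variation f P \<le> K" by blast
    qed
  next
    case (local x)
    obtain \<delta> where "\<delta> > 0" and \<delta>: "\<And>P. interval_family a b P \<Longrightarrow> total_length P < \<delta> \<Longrightarrow> variation f P < 1"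
      using f unfolding abs_cont_on_iff by (metis zero_less_one)
    have "bv c d" if "d - c < \<delta>" for c d
      unfolding bv_def
      using \<delta>[OF interval_family_mono] sum_interval_family_length that
      by (intro impI exI[of _ 1] allI) (meson le_less_trans less_imp_le)
    with \<open>\<delta> > 0\<close> show ?case by blast
  qed
  then show thesis using that ab unfolding bv_def by blast
qed

text \<open>\<open>W\<close> is the total variation of \<open>f\<close> counted from
  \<open>c\<close>. Adjoining the interval from \<open>u\<close> to \<open>v\<close> to a family on
  \<open>{c..u}\<close> gives the estimate. For absolute continuity of \<open>W\<close>, the
  intervals of a short family are refined into nearly optimal families; together these are again
  short, so the variation of \<open>f\<close> over them is small.\<close>

lemma abs_cont_on_variation:
  fixes f :: "real \<Rightarrow> 'a::metric_space"
  assumes f: "abs_cont_on c d f" and cd: "c \<le> d"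
  obtains W :: "real \<Rightarrow> real" where "abs_cont_on c d W"
    and "\<And>u v. c \<le> u \<Longrightarrow> u \<le> v \<Longrightarrow> v \<le> d \<Longrightarrow> dist (f u) (f v) \<le> W v - W u"
proof -
  obtain K where bound: "\<And>P. interval_family c d P \<Longrightarrow> variation f P \<le> K"
    using abs_cont_on_bounded_variation[OF f cd] by blast
  define var where "var P = variation f P" for P
  define W where "W x = Sup (var ` {P. interval_family c x P})" for x
  have bdd: "bdd_above (var ` {P. interval_family c x P})" if "x \<le> d" for x
  proof (rule bdd_aboveI2)
    fix P assume "P \<in> {P. interval_family c x P}"
    then show "var P \<le> K" using bound interval_family_mono[of c x P c d] that by (simp add: var_def)
  qed
  have ne: "{P. interval_family c x P} \<noteq> {}" for x
  proof -
    have "interval_family c x {}" by (simp add: interval_family_def disjoint_family_on_def)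
    then show ?thesis by blast
  qed
  have upper: "var P \<le> W x" if "interval_family c x P" "x \<le> d" for P x
    unfolding W_def using that by (intro cSup_upper bdd) auto
  have super: "dist (f u) (f v) + W u \<le> W v" if uv: "c \<le> u" "u \<le> v" "v \<le> d" for u v
  proof (cases "u = v")
    case False
    then have "u < v" using uv by simp
    have "W u \<le> W v - dist (f u) (f v)"
      unfolding W_def[of u]
    proof (rule cSup_least)
      show "var ` {P. interval_family c u P} \<noteq> {}" using ne by blast
      fix s assume "s \<in> var ` {P. interval_family c u P}"
      then obtain P where P: "interval_family c u P" and s: "s = var P" by auto
      have bnd: "\<And>x y. (x, y) \<in> P \<Longrightarrow> c \<le> x \<and> x \<le> y \<and> y \<le> u"
        using P by (auto simp: interval_family_def)
      have notin: "(u, v) \<notin> P" using bnd \<open>u < v\<close> by fastforce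
      have "interval_family c v (insert (u, v) P)"
        unfolding interval_family_def
      proof (intro conjI)
        show "\<forall>(x, y)\<in>insert (u, v) P. c \<le> x \<and> x \<le> y \<and> y \<le> v" using bnd uv by fastforce
        have "\<And>x y t. (x, y) \<in> P \<Longrightarrow> u < t \<Longrightarrow> t < y \<Longrightarrow> False" using bnd by fastforce
        then have "{u<..<v} \<inter> (\<Union>p\<in>P. case p of (x, y) \<Rightarrow> {x<..<y}) = {}" by fastforce
        then show "disjoint_family_on (\<lambda>(x, y). {x<..<y}) (insert (u, v) P)"
          using P notin by (subst disjoint_family_on_insert) (auto simp: interval_family_def)
      qed (use P in \<open>auto simp: interval_family_def\<close>)
      from upper[OF this uv(3)] show "s \<le> W v - dist (f u) (f v)"
        using notin P by (simp add: s var_def interval_family_def)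
    qed
    then show ?thesis by simp
  qed simp
  \<comment> \<open>A nearly optimal family for \<open>W v\<close>, split at \<open>u\<close>,
    leaves a family on \<open>{u..v}\<close> that nearly exhausts the increment of
    \<open>W\<close>.\<close>
  have sub: "\<exists>Q. interval_family u v Q \<and> W v - W u \<le> var Q + \<eta>"
    if uv: "c \<le> u" "u \<le> v" "v \<le> d" and "\<eta> > 0" for u v \<eta>
  proof -
    have "W v - \<eta> < Sup (var ` {P. interval_family c v P})" using \<open>\<eta> > 0\<close> by (simp add: W_def)
    then obtain P where P: "interval_family c v P" and big: "W v - \<eta> < var P"
      using ne[of v] by (subst (asm) less_cSup_iff) (use bdd uv in auto)
    obtain P1 P2 where P1: "interval_family c u P1" and P2: "interval_family u v P2"
      and "variation f P \<le> variation f P1 + variation f P2"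
      using interval_family_split[OF P, of u] uv by metis
    moreover have "var P1 \<le> W u" using P1 uv by (intro upper) auto
    ultimately have "W v - W u \<le> var P2 + \<eta>" using big by (simp add: var_def)
    with P2 show ?thesis by blast
  qed
  have "abs_cont_on c d W"
    unfolding abs_cont_on_iff
  proof (intro allI impI)
    fix e :: real assume "e > 0"
    then have "e / 2 > 0" by simp
    \<comment> \<open>An index is a pair of an interval of \<open>P\<close> and a piece of its
      refinement, so that equal degenerate pieces of different refinements are counted
      separately.\<close>
    obtain \<delta> where "\<delta> > 0" and \<delta>: "\<And>(S :: ((real \<times> real) \<times> (real \<times> real)) set) u v. finite S \<Longrightarrow>
       (\<And>i. i \<in> S \<Longrightarrow> c \<le> u i \<and> u i \<le> v i \<and> v i \<le> d) \<Longrightarrow>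
       disjoint_family_on (\<lambda>i. {u i<..<v i}) S \<Longrightarrow> (\<Sum>i\<in>S. v i - u i) < \<delta> \<Longrightarrow>
       (\<Sum>i\<in>S. dist (f (u i)) (f (v i))) < e / 2"
      by (rule abs_cont_on_indexed[OF f \<open>e / 2 > 0\<close>]) blast
    have "variation W P < e"
      if P: "interval_family c d P" and len: "total_length P < \<delta>" for P
    proof -
      note fin = interval_family_D(1)[OF P] and bnd = interval_family_D(2)[OF P] and disj = interval_family_D(3)[OF P]
      \<comment> \<open>One error \<eta> per interval of \<open>P\<close>, at most e/2 in total; the
        summand 1 covers an empty \<open>P\<close>.\<close>
      define \<eta> where "\<eta> = e / (2 * (real (card P) + 1))"
      have "\<eta> > 0" using \<open>e > 0\<close> by (simp add: \<eta>_def)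
      have "\<forall>p\<in>P. \<exists>Q. interval_family (fst p) (snd p) Q \<and> W (snd p) - W (fst p) \<le> var Q + \<eta>"
        using bnd sub \<open>\<eta> > 0\<close> by blast
      then obtain Q where Q: "\<And>p. p \<in> P \<Longrightarrow> interval_family (fst p) (snd p) (Q p)"
        and QW: "\<And>p. p \<in> P \<Longrightarrow> W (snd p) - W (fst p) \<le> var (Q p) + \<eta>" by metis
      note finQ = interval_family_D(1)[OF Q] and bndQ = interval_family_D(2)[OF Q] and disjQ = interval_family_D(3)[OF Q]
      have "(\<Sum>i\<in>Sigma P Q. dist (f (fst (snd i))) (f (snd (snd i)))) < e / 2"
      proof (rule \<delta>)
        show "finite (Sigma P Q)" using fin finQ by blast
        show "c \<le> fst (snd i) \<and> fst (snd i) \<le> snd (snd i) \<and> snd (snd i) \<le> d" if i: "i \<in> Sigma P Q" for i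
        proof -
          have "fst i \<in> P" "snd i \<in> Q (fst i)" using i by auto
          then show ?thesis using bndQ[of "fst i" "snd i"] bnd[of "fst i"] by linarith
        qed
        show "disjoint_family_on (\<lambda>i. {fst (snd i)<..<snd (snd i)}) (Sigma P Q)"
          unfolding disjoint_family_on_def
        proof (intro ballI impI)
          fix i j assume ij: "i \<in> Sigma P Q" "j \<in> Sigma P Q" "i \<noteq> j"
          then have m: "fst i \<in> P" "snd i \<in> Q (fst i)" "fst j \<in> P" "snd j \<in> Q (fst j)" by auto
          show "{fst (snd i)<..<snd (snd i)} \<inter> {fst (snd j)<..<snd (snd j)} = {}"
          proof (cases "fst i = fst j")
            case True
            then have "snd i \<noteq> snd j" using ij by (auto simp: prod_eq_iff)
            then show ?thesis using disjQ[OF m(1)] m True unfolding disjoint_family_on_def by auto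
          next
            case False
            have "{fst (snd i)<..<snd (snd i)} \<subseteq> {fst (fst i)<..<snd (fst i)}"
              "{fst (snd j)<..<snd (snd j)} \<subseteq> {fst (fst j)<..<snd (fst j)}"
              using bndQ[OF m(1,2)] bndQ[OF m(3,4)] by auto
            moreover have "{fst (fst i)<..<snd (fst i)} \<inter> {fst (fst j)<..<snd (fst j)} = {}"
              using disj m False unfolding disjoint_family_on_def by blast
            ultimately show ?thesis by blast
          qed
        qed
        have "(\<Sum>i\<in>Sigma P Q. snd (snd i) - fst (snd i)) = (\<Sum>p\<in>P. \<Sum>q\<in>Q p. snd q - fst q)"
          using fin finQ by (subst sum.Sigma) (auto simp: case_prod_unfold)
        also have "\<dots> \<le> (\<Sum>p\<in>P. snd p - fst p)"
        proof (rule sum_mono)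
          fix p assume "p \<in> P"
          then show "(\<Sum>q\<in>Q p. snd q - fst q) \<le> snd p - fst p"
            using sum_interval_family_length[OF Q] bnd by (fastforce simp: case_prod_unfold)
        qed
        finally show "(\<Sum>i\<in>Sigma P Q. snd (snd i) - fst (snd i)) < \<delta>"
          using len by (simp add: case_prod_unfold)
      qed
      moreover have "(\<Sum>i\<in>Sigma P Q. dist (f (fst (snd i))) (f (snd (snd i)))) = (\<Sum>p\<in>P. var (Q p))"
        unfolding var_def using fin finQ by (subst sum.Sigma) (auto simp: case_prod_unfold)
      ultimately have lt: "(\<Sum>p\<in>P. var (Q p)) < e / 2" by simp
      have "variation W P \<le> (\<Sum>p\<in>P. var (Q p) + \<eta>)"
        unfolding case_prod_unfold
      proof (rule sum_mono)
        fix p assume p: "p \<in> P"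
        have "0 \<le> W (snd p) - W (fst p)"
          using super[of "fst p" "snd p"] bnd[OF p] zero_le_dist[of "f (fst p)" "f (snd p)"] by linarith
        then show "dist (W (fst p)) (W (snd p)) \<le> var (Q p) + \<eta>"
          using QW[OF p] by (simp add: dist_real_def)
      qed
      also have "\<dots> = (\<Sum>p\<in>P. var (Q p)) + real (card P) * \<eta>" by (simp add: sum.distrib)
      also have "real (card P) * \<eta> \<le> e / 2"
        using \<open>e > 0\<close> by (simp add: \<eta>_def field_simps)
      finally show ?thesis using lt by simp
    qed
    then show "\<exists>\<delta>>0. \<forall>P. interval_family c d P \<longrightarrow> total_length P < \<delta> \<longrightarrow>
        variation W P < e"
      using \<open>\<delta> > 0\<close> by blast
  qed
  moreover have "dist (f u) (f v) \<le> W v - W u" if "c \<le> u" "u \<le> v" "v \<le> d" for u v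
    using super[OF that] by simp
  ultimately show thesis by (rule that)
qed

section \<open>Stieltjes measure of a monotone absolutely continuous function\<close>

lemma abs_cont_on_continuous_UNIV:
  assumes "\<And>a b. a \<le> b \<Longrightarrow> abs_cont_on a b (G :: real \<Rightarrow> 'a::metric_space)"
  shows "continuous_on UNIV G"
proof -
  have "isCont G t" for t
  proof (rule continuous_on_interior)
    show "continuous_on {t - 1..t + 1} G" using assms by (intro abs_cont_on_continuous) auto
  qed auto
  then show ?thesis by (simp add: continuous_at_imp_continuous_on)
qed

text \<open>A bounded null set lies in an open set of measure below \<delta>, and
  \<open>covering_lemma\<close> covers it by nonoverlapping compact intervals inside that open set.
  Finitely many of them have total increment of \<open>G\<close> below \<open>e\<close> by absolute
  continuity, and continuity from below passes to all of them.\<close>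

lemma null_sets_interval_measure:
  fixes G :: "real \<Rightarrow> real"
  assumes ac: "\<And>a b. a \<le> b \<Longrightarrow> abs_cont_on a b G" and "mono G" and N: "N \<in> null_sets lborel"
  shows "N \<in> null_sets (interval_measure G)"
proof -
  let ?\<mu> = "interval_measure G"
  have cont: "continuous_on UNIV G" using ac by (rule abs_cont_on_continuous_UNIV)
  have mono: "\<And>x y. x \<le> y \<Longrightarrow> G x \<le> G y" using \<open>mono G\<close> by (rule monoD)
  have local: "emeasure ?\<mu> M = 0" if M: "M \<in> null_sets lborel" "M \<subseteq> {a..b}" "a < b" for M a b
  proof -
    have "emeasure ?\<mu> M \<le> 0"
    proof (rule ennreal_le_epsilon)
      fix e :: real assume "e > 0"
      obtain \<delta> where "\<delta> > 0" and \<delta>: "\<And>(S :: real set set) u v. finite S \<Longrightarrow>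
         (\<And>i. i \<in> S \<Longrightarrow> a \<le> u i \<and> u i \<le> v i \<and> v i \<le> b) \<Longrightarrow>
         disjoint_family_on (\<lambda>i. {u i<..<v i}) S \<Longrightarrow> (\<Sum>i\<in>S. v i - u i) < \<delta> \<Longrightarrow>
         (\<Sum>i\<in>S. dist (G (u i)) (G (v i))) < e"
        by (rule abs_cont_on_indexed[of a b G e]) (use \<open>a < b\<close> \<open>e > 0\<close> ac in auto)
      have Mleb: "M \<in> null_sets lebesgue" using M(1) by (rule null_sets_completionI)
      obtain U where U: "open U" "M \<subseteq> U" "U - M \<in> lmeasurable" "emeasure lebesgue (U - M) < ennreal \<delta>"
        using sets_lebesgue_outer_open[of M \<delta>] Mleb \<open>\<delta> > 0\<close> by auto
      have UM: "emeasure lebesgue U < ennreal \<delta>"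
        using U(2-4) Mleb emeasure_Un_null_set[of "U - M" lebesgue M] by (simp add: Un_absorb2 fmeasurableD)
      \<comment> \<open>\<open>U\<close> is prescribed at the points of \<open>M\<close>, where the
        tags will lie; elsewhere a gauge must still contain its point, whence
        \<open>UNIV\<close>.\<close>
      have gauge: "gauge (\<lambda>x. if x \<in> M then U else UNIV)"
        using U by (auto simp: gauge_def)
      obtain D where D: "countable D" "\<Union>D \<subseteq> cbox a b"
        "\<And>K. K \<in> D \<Longrightarrow> interior K \<noteq> {} \<and> (\<exists>c d. K = cbox c d)"
        "pairwise (\<lambda>A B. interior A \<inter> interior B = {}) D"
        "\<And>K. K \<in> D \<Longrightarrow> \<exists>x \<in> M \<inter> K. K \<subseteq> (if x \<in> M then U else UNIV)"
        "M \<subseteq> \<Union>D"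
        by (rule covering_lemma[OF _ _ gauge, of M a b]) (use M in auto)
      have K: "\<exists>c d. K = {c..d} \<and> c < d \<and> a \<le> c \<and> d \<le> b" if "K \<in> D" for K
        using D(2) D(3)[OF that] that by (fastforce simp: box_real)
      have fin: "emeasure ?\<mu> (\<Union>T) \<le> ennreal e" if T: "finite T" "T \<subseteq> D" for T
      proof -
        have disj: "disjoint_family_on interior T"
          using D(4) T(2) unfolding pairwise_def disjoint_family_on_def by blast
        have intK: "interior X = {Inf X<..<Sup X}" "Inf X < Sup X" "a \<le> Inf X" "Sup X \<le> b"
          "X = {Inf X..Sup X}" if "X \<in> T" for X
        proof -
          obtain c d where "X = {c..d}" "c < d" "a \<le> c" "d \<le> b" using K[of X] \<open>X \<in> T\<close> T(2) by blast
          then show "interior X = {Inf X<..<Sup X}" "Inf X < Sup X" "a \<le> Inf X" "Sup X \<le> b"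
            "X = {Inf X..Sup X}" by auto
        qed
        have disj': "disjoint_family_on (\<lambda>X. {Inf X<..<Sup X}) T"
          using disj intK(1) by (simp add: disjoint_family_on_def)
        note meas = sum_length_eq_measure[OF T(1) less_imp_le[OF intK(2)] disj']
          UN_interval_lmeasurable[OF T(1) less_imp_le[OF intK(2)] disj']
        have "(\<Sum>X\<in>T. Sup X - Inf X) = measure lebesgue (\<Union>X\<in>T. {Inf X<..<Sup X})" by (rule meas(1))
        also have "\<dots> \<le> measure lebesgue U"
        proof (rule measure_mono_fmeasurable)
          show "(\<Union>X\<in>T. {Inf X<..<Sup X}) \<subseteq> U" using D(5) T(2) interior_subset intK(1) by fastforce
          show "(\<Union>X\<in>T. {Inf X<..<Sup X}) \<in> sets lebesgue" using meas(2) by (rule fmeasurableD)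
          show "U \<in> lmeasurable" using UM U(1) by (auto simp: fmeasurable_def intro: order.strict_trans)
        qed
        also have "\<dots> < \<delta>"
        proof -
          have "emeasure lebesgue U = ennreal (measure lebesgue U)"
            using UM by (intro emeasure_eq_ennreal_measure) auto
          then show ?thesis using UM by (simp add: ennreal_less_iff)
        qed
        finally have "(\<Sum>X\<in>T. dist (G (Inf X)) (G (Sup X))) < e"
          using intK less_imp_le[OF intK(2)] by (intro \<delta> T(1) disj') auto
        moreover have "emeasure ?\<mu> X = ennreal (dist (G (Inf X)) (G (Sup X)))" if "X \<in> T" for X
        proof -
          have "emeasure ?\<mu> {Inf X..Sup X} = ennreal (G (Sup X) - G (Inf X))"
            using intK[OF that] mono cont by (intro emeasure_interval_measure_Icc) auto
          then show ?thesis using intK[OF that] mono[of "Inf X" "Sup X"] by (simp add: dist_real_def)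
        qed
        moreover have "emeasure ?\<mu> (\<Union>T) \<le> (\<Sum>X\<in>T. emeasure ?\<mu> X)"
        proof -
          have "emeasure ?\<mu> (\<Union>X\<in>T. X) \<le> (\<Sum>X\<in>T. emeasure ?\<mu> X)"
          proof (rule emeasure_subadditive_finite[OF T(1)])
            have "X \<in> sets borel" if "X \<in> T" for X
              by (subst intK(5)[OF that]) simp
            then show "(\<lambda>X. X) ` T \<subseteq> sets ?\<mu>" by auto
          qed
          then show ?thesis by simp
        qed
        ultimately show ?thesis by (simp add: ennreal_leI order_trans)
      qed
      show "emeasure ?\<mu> M \<le> 0 + ennreal e"
      proof (cases "D = {}")
        case False
        \<comment> \<open>Finite unions of the first intervals of the cover increase to the whole
          cover, so the bound \<open>fin\<close> passes to the supremum.\<close>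
        define A where "A n = \<Union>(from_nat_into D ` {..n})" for n :: nat
        have sub: "from_nat_into D ` {..n} \<subseteq> D" for n
          using False by (auto intro: from_nat_into)
        have setsA: "A n \<in> sets ?\<mu>" for n
        proof -
          have "X \<in> sets borel" if "X \<in> D" for X using K[OF that] by auto
          then show ?thesis unfolding A_def using sub[of n] by (intro sets.finite_Union) auto
        qed
        have "M \<subseteq> (\<Union>n. A n)"
        proof
          fix x assume "x \<in> M"
          then obtain X where X: "X \<in> D" "x \<in> X" using D(6) by auto
          then obtain n where "from_nat_into D n = X" using from_nat_into_surj[OF D(1)] by blast
          then show "x \<in> (\<Union>n. A n)" using X by (auto simp: A_def)
        qed
        then have "emeasure ?\<mu> M \<le> emeasure ?\<mu> (\<Union>n. A n)"
          using setsA by (intro emeasure_mono) auto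
        also have "\<dots> = (SUP n. emeasure ?\<mu> (A n))"
        proof (rule SUP_emeasure_incseq[symmetric])
          show "incseq A"
            unfolding incseq_def A_def by (intro allI impI Union_mono image_mono) auto
        qed (use setsA in auto)
        also have "\<dots> \<le> ennreal e"
          using sub by (intro SUP_least) (auto simp: A_def intro!: fin)
        finally show ?thesis by simp
      qed (use D(6) in auto)
    qed
    then show ?thesis by simp
  qed
  \<comment> \<open>The exhausting intervals are widened by 1 because \<open>local\<close> requires
    a nondegenerate interval also for \<open>n = 0\<close>.\<close>
  have "(\<Union>n::nat. N \<inter> {- real n - 1..real n + 1}) \<in> null_sets ?\<mu>"
  proof (rule null_sets_UN)
    fix n :: nat
    have "N \<inter> {- real n - 1..real n + 1} \<in> null_sets lborel"
      using N by (intro null_set_Int2) auto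
    then show "N \<inter> {- real n - 1..real n + 1} \<in> null_sets ?\<mu>"
      using local[of _ "- real n - 1" "real n + 1"] by (auto simp: null_sets_def)
  qed
  moreover have "(\<Union>n::nat. N \<inter> {- real n - 1..real n + 1}) = N"
  proof -
    have "\<exists>n::nat. x \<in> {- real n - 1..real n + 1}" for x
    proof -
      obtain n :: nat where "\<bar>x\<bar> \<le> real n" using real_arch_simple by blast
      then show ?thesis by (intro exI[of _ n]) auto
    qed
    then show ?thesis by blast
  qed
  ultimately show ?thesis by simp
qed

text \<open>The Radon-Nikodym density is extended-valued. Bounded intervals have finite mass, so it
  is finite almost everywhere and \<open>enn2real\<close> changes no integral over them.\<close>

lemma monotone_abs_cont_density:
  fixes G :: "real \<Rightarrow> real"
  assumes ac: "\<And>a b. a \<le> b \<Longrightarrow> abs_cont_on a b G" and "mono G"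
  obtains g where "\<And>x. 0 \<le> g x" "\<And>a b. a \<le> b \<Longrightarrow> (g has_integral (G b - G a)) {a..b}"
proof -
  let ?\<mu> = "interval_measure G"
  have cont: "continuous_on UNIV G" using ac by (rule abs_cont_on_continuous_UNIV)
  have mono: "\<And>x y. x \<le> y \<Longrightarrow> G x \<le> G y" using \<open>mono G\<close> by (rule monoD)

  have "absolutely_continuous lborel ?\<mu>"
    unfolding absolutely_continuous_def using null_sets_interval_measure[OF ac \<open>mono G\<close>] by auto
  from sigma_finite_measure.Radon_Nikodym[OF sigma_finite_lborel this] obtain f where f: "f \<in> borel_measurable borel" "density lborel f = ?\<mu>"
    by auto
  define g where "g x = enn2real (f x)" for x
  show thesis
  proof
    show "0 \<le> g x" for x by (simp add: g_def)
    fix a b :: real assume "a \<le> b"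
    let ?h = "\<lambda>x. f x * indicator {a..b} x"
    have int: "(\<integral>\<^sup>+x. ?h x \<partial>lborel) = ennreal (G b - G a)"
      using emeasure_density[of f lborel "{a..b}"] f emeasure_interval_measure_Icc[OF \<open>a \<le> b\<close> mono cont]
      by simp
    have hm: "?h \<in> borel_measurable lborel" using f(1) by simp
    have "AE x in lborel. ?h x \<noteq> \<infinity>"
      by (rule nn_integral_PInf_AE[OF hm]) (simp add: int)
    then have "AE x in lborel. ennreal (g x * indicator {a..b} x) = ?h x"
      by eventually_elim (auto simp: g_def indicator_def less_top split: if_splits)
    then have "(\<integral>\<^sup>+x. ennreal (g x * indicator {a..b} x) \<partial>lborel) = ennreal (G b - G a)"
      using int nn_integral_cong_AE by metis
    then have "((\<lambda>x. g x * indicator {a..b} x) has_integral (G b - G a)) UNIV"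
      using f(1) mono[OF \<open>a \<le> b\<close>] by (intro nn_integral_has_integral) (auto simp: g_def)
    moreover have "(\<lambda>x. g x * indicator {a..b} x) = (\<lambda>x. if x \<in> {a..b} then g x else 0)"
      by (auto simp: indicator_def)
    ultimately show "(g has_integral (G b - G a)) {a..b}" by (metis has_integral_restrict_UNIV)
  qed
qed

section \<open>Densities and differentiation almost everywhere\<close>

lemma AE_not_in_negligible: "negligible N \<Longrightarrow> AE t in lebesgue. t \<notin> N"
  by (intro AE_not_in) (simp add: negligible_iff_null_sets)

text \<open>So far only monotone functions have densities. The increments of a component f \<bullet>
  b are bounded by those of \<open>W\<close>, so both W and W + f \<bullet> b have increments
  between 0 and twice those of \<open>W\<close>; the difference of their densities is a density of
  the component.\<close>

lemma abs_cont_on_density: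
  fixes f :: "real \<Rightarrow> 'a::euclidean_space"
  assumes f: "abs_cont_on c d f" and cd: "c \<le> d"
  obtains g where "g absolutely_integrable_on {c..d}"
    and "\<And>u v. c \<le> u \<Longrightarrow> u \<le> v \<Longrightarrow> v \<le> d \<Longrightarrow> (g has_integral (f v - f u)) {u..v}"
proof -
  obtain W :: "real \<Rightarrow> real" where W: "abs_cont_on c d W"
    and fW: "\<And>u v. c \<le> u \<Longrightarrow> u \<le> v \<Longrightarrow> v \<le> d \<Longrightarrow> dist (f u) (f v) \<le> W v - W u"
    using abs_cont_on_variation[OF f cd] by metis
  define dens where "dens g G \<longleftrightarrow> g absolutely_integrable_on {c..d} \<and>
      (\<forall>u v. c \<le> u \<longrightarrow> u \<le> v \<longrightarrow> v \<le> d \<longrightarrow> (g has_integral (G v - G u)) {u..v})" for g G :: "real \<Rightarrow> real"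
  have ex: "\<exists>g. dens g G"
    if G: "\<And>u v. c \<le> u \<Longrightarrow> u \<le> v \<Longrightarrow> v \<le> d \<Longrightarrow> 0 \<le> G v - G u \<and> G v - G u \<le> 2 * (W v - W u)"
    for G :: "real \<Rightarrow> real"
  proof -
    have "abs_cont_on c d G"
    proof (rule abs_cont_on_dominated[OF W, of _ 2])
      fix u v assume "c \<le> u" "u \<le> v" "v \<le> d"
      from G[OF this] show "dist (G u) (G v) \<le> 2 * dist (W u) (W v)"
        by (auto simp: dist_real_def)
    qed
    then have ac: "abs_cont_on x y (\<lambda>t. G (max c (min d t)))" for x y
      using abs_cont_on_clamp cd by blast
    have "mono (\<lambda>t. G (max c (min d t)))"
    proof (rule monoI)
      fix x y :: real assume "x \<le> y"
      then show "G (max c (min d x)) \<le> G (max c (min d y))"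
        using G[of "max c (min d x)" "max c (min d y)"] cd by fastforce
    qed
    from monotone_abs_cont_density[OF ac this] obtain g where g: "\<And>x. 0 \<le> g x"
      "\<And>a b. a \<le> b \<Longrightarrow> (g has_integral (G (max c (min d b)) - G (max c (min d a)))) {a..b}" by blast
    have "g absolutely_integrable_on {c..d}"
      using g cd by (intro nonnegative_absolutely_integrable_1) (auto simp: integrable_on_def)
    moreover have "(g has_integral (G v - G u)) {u..v}" if "c \<le> u" "u \<le> v" "v \<le> d" for u v
    proof -
      have "max c (min d u) = u" "max c (min d v) = v" using that by auto
      then show ?thesis using g(2)[OF that(2)] by simp
    qed
    ultimately show ?thesis unfolding dens_def by blast
  qed
  have "\<exists>g. dens g W"
  proof (rule ex)
    fix u v assume "c \<le> u" "u \<le> v" "v \<le> d"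
    from fW[OF this] have "0 \<le> W v - W u" using zero_le_dist order_trans by blast
    then show "0 \<le> W v - W u \<and> W v - W u \<le> 2 * (W v - W u)" by simp
  qed
  then obtain gW where gW: "gW absolutely_integrable_on {c..d}"
    "\<And>u v. c \<le> u \<Longrightarrow> u \<le> v \<Longrightarrow> v \<le> d \<Longrightarrow> (gW has_integral (W v - W u)) {u..v}" unfolding dens_def by blast
  have "\<exists>g. dens g (\<lambda>t. W t + f t \<bullet> b)"
    if b: "b \<in> Basis" for b
  proof (rule ex)
    fix u v assume "c \<le> u" "u \<le> v" "v \<le> d"
    from fW[OF this] have "\<bar>(f v - f u) \<bullet> b\<bar> \<le> W v - W u"
      using Basis_le_norm[OF b, of "f v - f u"] by (simp add: dist_norm norm_minus_commute)
    then show "0 \<le> (W v + f v \<bullet> b) - (W u + f u \<bullet> b) \<and> (W v + f v \<bullet> b) - (W u + f u \<bullet> b) \<le> 2 * (W v - W u)"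
      by (auto simp: inner_diff_left)
  qed
  then obtain gb where gb: "\<And>b. b \<in> Basis \<Longrightarrow> gb b absolutely_integrable_on {c..d}"
    "\<And>b u v. b \<in> Basis \<Longrightarrow> c \<le> u \<Longrightarrow> u \<le> v \<Longrightarrow> v \<le> d \<Longrightarrow>
        (gb b has_integral ((W v + f v \<bullet> b) - (W u + f u \<bullet> b))) {u..v}" unfolding dens_def by metis
  define g where "g t = (\<Sum>b\<in>Basis. (gb b t - gW t) *\<^sub>R b)" for t
  show thesis
  proof
    show "g absolutely_integrable_on {c..d}"
      unfolding g_def
    proof (rule absolutely_integrable_sum)
      fix b :: 'a assume "b \<in> Basis"
      then have "(\<lambda>t. gb b t - gW t) absolutely_integrable_on {c..d}"
        using gb(1) gW(1) set_integral_diff(1) by blast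
      then show "(\<lambda>t. (gb b t - gW t) *\<^sub>R b) absolutely_integrable_on {c..d}"
        by (rule set_integrable_scaleR_left)
    qed simp
    fix u v assume uv: "c \<le> u" "u \<le> v" "v \<le> d"
    have "(g has_integral (\<Sum>b\<in>Basis. (((W v + f v \<bullet> b) - (W u + f u \<bullet> b)) - (W v - W u)) *\<^sub>R b)) {u..v}"
      unfolding g_def
      by (intro has_integral_sum has_integral_scaleR_left has_integral_diff gb gW uv) auto
    moreover have "(\<Sum>b\<in>Basis. (((W v + f v \<bullet> b) - (W u + f u \<bullet> b)) - (W v - W u)) *\<^sub>R b) = f v - f u"
      by (simp add: euclidean_representation sum_subtractf scaleR_diff_left)
    ultimately show "(g has_integral (f v - f u)) {u..v}" by simp
  qed
qed

text \<open>The averages in \<open>integrable_ccontinuous_explicit\<close> are over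
  \<open>{x..x + h}\<close> with \<open>h > 0\<close>, that is, right difference quotients of the
  primitive.\<close>

lemma AE_has_right_derivative_of_integral:
  fixes F g :: "real \<Rightarrow> 'a::euclidean_space"
  assumes g: "\<And>a b. a \<le> b \<Longrightarrow> (g has_integral (F b - F a)) {a..b}"
  shows "AE t in lebesgue. (F has_vector_derivative g t) (at_right t)"
proof -
  have "g integrable_on cbox a b" for a b
    using g[of a b] by (cases "a \<le> b") (auto simp: integrable_on_def)
  then obtain N where N: "negligible N" and lim: "\<And>x e. x \<notin> N \<Longrightarrow> 0 < e \<Longrightarrow> \<exists>d>0. \<forall>h. 0 < h \<and> h < d \<longrightarrow>
      norm (integral (cbox x (x + h *\<^sub>R One)) g /\<^sub>R h ^ DIM(real) - g x) < e"
    using integrable_ccontinuous_explicit[of g] by metis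
  have "(F has_vector_derivative g x) (at_right x)" if "x \<notin> N" for x
    unfolding has_vector_derivative_def has_derivative_within_alt
  proof (intro conjI allI impI)
    show "bounded_linear (\<lambda>h. h *\<^sub>R g x)" by (rule bounded_linear_scaleR_left)
    fix e :: real assume "e > 0"
    then obtain d where "d > 0" and d: "\<And>h. 0 < h \<Longrightarrow> h < d \<Longrightarrow>
        norm (integral (cbox x (x + h *\<^sub>R One)) g /\<^sub>R h ^ DIM(real) - g x) < e"
      using lim[OF \<open>x \<notin> N\<close>] by metis
    have "norm (F y - F x - (y - x) *\<^sub>R g x) \<le> e * norm (y - x)" if y: "x < y" "norm (y - x) < d" for y
    proof -
      have "integral {x..y} g = F y - F x" using g[of x y] y by (simp add: integral_unique)
      then have "norm ((F y - F x) /\<^sub>R (y - x) - g x) < e"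
        using d[of "y - x"] y by simp
      moreover have "F y - F x - (y - x) *\<^sub>R g x = (y - x) *\<^sub>R ((F y - F x) /\<^sub>R (y - x) - g x)"
        using y by (simp add: scaleR_diff_right)
      ultimately show ?thesis using y by (simp add: mult.commute)
    qed
    then show "\<exists>d>0. \<forall>y\<in>{x<..}. norm (y - x) < d \<longrightarrow> norm (F y - F x - (y - x) *\<^sub>R g x) \<le> e * norm (y - x)"
      using \<open>d > 0\<close> by auto
  qed
  then show ?thesis
    using AE_not_in_negligible[OF N] by (auto elim: eventually_mono)
qed

text \<open>The left derivative at t comes from the right derivative at -t of the reflected
  primitive -F(-x), and reflection preserves null sets.\<close>

lemma AE_has_derivative_of_integral:
  fixes F g :: "real \<Rightarrow> 'a::euclidean_space"
  assumes g: "\<And>a b. a \<le> b \<Longrightarrow> (g has_integral (F b - F a)) {a..b}"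
  shows "AE t in lebesgue. (F has_vector_derivative g t) (at t)"
proof -
  have "((\<lambda>x. g (- x)) has_integral ((- F (- b)) - (- F (- a)))) {a..b}" if "a \<le> b" for a b
    using has_integral_reflect_real[of g "F (-a) - F (-b)" "-a" "-b", unfolded minus_minus] g[of "-b" "-a"] that by simp
  from AE_has_right_derivative_of_integral[of "\<lambda>x. g (- x)" "\<lambda>x. - F (- x)", OF this]
  obtain N where N: "N \<in> null_sets lebesgue"
    and right: "\<And>t. t \<notin> N \<Longrightarrow> ((\<lambda>x. - F (- x)) has_vector_derivative g (- t)) (at_right t)"
    by (auto elim!: AE_E3)
  have "negligible (uminus ` N)"
    using N by (intro negligible_differentiable_image_negligible linear_imp_differentiable_on)
      (auto simp: negligible_iff_null_sets intro!: linearI)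
  from AE_not_in_negligible[OF this]
  have "AE t in lebesgue. (F has_vector_derivative g t) (at_left t)"
  proof eventually_elim
    case (elim t)
    then have "((\<lambda>x. - F (- x)) has_vector_derivative g t) (at_right (- t))"
      using right[of "- t"] by (metis imageI minus_minus)
    then have "((\<lambda>x. - F (- x)) \<circ> uminus has_vector_derivative (- 1) *\<^sub>R g t) (at_left t)"
      by (intro vector_diff_chain_within) (auto intro!: derivative_eq_intros simp: image_uminus_lessThan)
    then have "((\<lambda>x. - ((\<lambda>x. - F (- x)) \<circ> uminus) x) has_vector_derivative - ((- 1) *\<^sub>R g t)) (at_left t)"
      by (rule has_vector_derivative_minus)
    then show ?case by (simp add: o_def)
  qed
  moreover have "AE t in lebesgue. (F has_vector_derivative g t) (at_right t)"
    by (rule AE_has_right_derivative_of_integral) (rule g)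
  ultimately show ?thesis
  proof eventually_elim
    case (elim t)
    then show ?case
      unfolding has_vector_derivative_def has_derivative_iff_norm by (auto intro: filterlim_split_at)
  qed
qed

lemma absolutely_integrable_on_iff_lebesgue_on:
  fixes f :: "'a::euclidean_space \<Rightarrow> 'b::euclidean_space"
  assumes "S \<in> sets lebesgue"
  shows "f absolutely_integrable_on S \<longleftrightarrow> integrable (lebesgue_on S) f"
  using assms by (simp add: set_integrable_def integrable_restrict_space)

text \<open>The differentiation result concerns the whole line, so \<open>f\<close> is continued
  constantly and its density by zero. The endpoints are then discarded, because \<open>ddt\<close>
  is two-sided and \<open>f\<close> is uncontrolled outside \<open>{a..b}\<close>.\<close>

lemma
  fixes f :: "real \<Rightarrow> 'a::euclidean_space"
  assumes f: "abs_cont_on a b f" and ab: "a \<le> b"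
  shows abs_cont_on_AE_derivative: "AE t in lebesgue. t \<in> {a..b} \<longrightarrow> (f has_vector_derivative ddt f t) (at t)"
    and abs_cont_on_ddt_integrable: "ddt f absolutely_integrable_on {a..b}"
    and abs_cont_on_has_integral_ddt:
      "\<And>u v. a \<le> u \<Longrightarrow> u \<le> v \<Longrightarrow> v \<le> b \<Longrightarrow> (ddt f has_integral (f v - f u)) {u..v}"
proof -
  obtain g where g: "g absolutely_integrable_on {a..b}"
    "\<And>u v. a \<le> u \<Longrightarrow> u \<le> v \<Longrightarrow> v \<le> b \<Longrightarrow> (g has_integral (f v - f u)) {u..v}"
    using abs_cont_on_density[OF f ab] by blast
  define F where "F t = f (max a (min b t))" for t
  define g0 where "g0 t = (if t \<in> {a..b} then g t else 0)" for t
  have "(g0 has_integral (F d - F c)) {c..d}" if "c \<le> d" for c d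
  proof -
    have "(g has_integral (F d - F c)) ({a..b} \<inter> {c..d})"
    proof (cases "max a c \<le> min b d")
      case True
      then have "F d = f (min b d)" "F c = f (max a c)"
        using that ab by (auto simp: F_def max_def min_def intro!: arg_cong[of _ _ f])
      moreover have "{a..b} \<inter> {c..d} = {max a c..min b d}" by auto
      ultimately show ?thesis using g(2)[OF _ True] by simp
    next
      case False
      then have "max a (min b c) = max a (min b d)" "{a..b} \<inter> {c..d} = {}"
        using that ab by (auto simp: max_def min_def split: if_splits)
      then show ?thesis by (simp add: F_def)
    qed
    then show ?thesis
      using has_integral_restrict_Int[of "{a..b}" g "F d - F c" "{c..d}"] by (simp add: g0_def[abs_def])
  qed
  from AE_has_derivative_of_integral[of g0 F, OF this]
  have "AE t in lebesgue. (F has_vector_derivative g0 t) (at t)" by simp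
  moreover have "AE t in lebesgue. t \<notin> {a, b}"
    by (rule AE_not_in_negligible) simp
  ultimately have AE: "AE t in lebesgue. t \<in> {a..b} \<longrightarrow> (f has_vector_derivative g t) (at t)"
  proof eventually_elim
    case (elim t)
    show ?case
    proof
      assume "t \<in> {a..b}"
      then have t: "t \<in> {a<..<b}" using elim by auto
      have "(f has_vector_derivative g0 t) (at t)"
        by (rule has_vector_derivative_transform_within_open[OF elim(1) open_greaterThanLessThan t])
          (auto simp: F_def max_def min_def)
      then show "(f has_vector_derivative g t) (at t)" using t by (simp add: g0_def)
    qed
  qed
  then show "AE t in lebesgue. t \<in> {a..b} \<longrightarrow> (f has_vector_derivative ddt f t) (at t)"
    by eventually_elim (metis vector_derivative_at)
  from AE obtain N where N: "N \<in> null_sets lebesgue"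
    and eq: "\<And>t. t \<notin> N \<Longrightarrow> t \<in> {a..b} \<Longrightarrow> (f has_vector_derivative g t) (at t)"
    by (auto elim!: AE_E3)
  have N': "negligible N" using N by (simp add: negligible_iff_null_sets)
  have eq': "ddt f t = g t" if "t \<notin> N" "t \<in> {a..b}" for t
    using eq[OF that] by (rule vector_derivative_at)
  show "ddt f absolutely_integrable_on {a..b}"
    by (rule absolutely_integrable_spike[OF g(1) N']) (use eq' in auto)
  fix u v assume uv: "a \<le> u" "u \<le> v" "v \<le> b"
  show "(ddt f has_integral (f v - f u)) {u..v}"
    by (rule has_integral_spike[OF N' _ g(2)[OF uv]]) (use eq' uv in auto)
qed

text \<open>The freedom in \<open>S\<close> covers the open, half-open and closed intervals that
  occur later.\<close>

lemma integral_indicator_interval: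
  fixes g :: "real \<Rightarrow> 'a::euclidean_space"
  assumes g: "g absolutely_integrable_on {a..b}" "(g has_integral x) {a..b}"
    and S: "{a<..<b} \<subseteq> S" "S \<subseteq> {a..b}"
  shows "integrable lebesgue (\<lambda>t. indicator S t *\<^sub>R g t)"
    and "(\<integral>t. indicator S t *\<^sub>R g t \<partial>lebesgue) = x"
proof -
  have neg: "negligible {t \<in> S - {a..b}. g t \<noteq> 0}" "negligible {t \<in> {a..b} - S. g t \<noteq> 0}"
    by (rule negligible_subset[of "{a, b}"]; use S in force)+
  have i: "g absolutely_integrable_on S"
    by (rule absolutely_integrable_spike_set[OF g(1) neg(2,1)])
  then show "integrable lebesgue (\<lambda>t. indicator S t *\<^sub>R g t)" by (simp add: set_integrable_def)
  show "(\<integral>t. indicator S t *\<^sub>R g t \<partial>lebesgue) = x"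
    using set_lebesgue_integral_eq_integral(2)[OF i] integral_spike_set[OF neg] integral_unique[OF g(2)]
    by (simp add: set_lebesgue_integral_def)
qed

text \<open>The norm of \<open>g\<close> is at most n plus its excess over n. The integral of the
  excess tends to 0 as n grows, and the part of height n is controlled by the total length of the
  family.\<close>

lemma abs_cont_on_of_integral:
  fixes g :: "real \<Rightarrow> 'a::euclidean_space"
  assumes g: "g absolutely_integrable_on {a..b}"
    and F: "\<And>u v. a \<le> u \<Longrightarrow> u \<le> v \<Longrightarrow> v \<le> b \<Longrightarrow> (g has_integral (F v - F u)) {u..v}"
  shows "abs_cont_on a b F"
  unfolding abs_cont_on_iff
proof (intro allI impI)
  fix e :: real assume "e > 0"
  define G where "G t = norm (indicator {a..b} t *\<^sub>R g t)" for t
  have G: "integrable lebesgue G" "\<And>t. 0 \<le> G t"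
    using integrable_norm[OF g[unfolded set_integrable_def]]
    unfolding G_def[abs_def] by (blast, simp)
  then have Gm: "G \<in> borel_measurable lebesgue" by auto
  have "(\<lambda>n. \<integral>t. max (G t - real n) 0 \<partial>lebesgue) \<longlonglongrightarrow> integral\<^sup>L lebesgue (\<lambda>t::real. 0)"
  proof (rule integral_dominated_convergence[where w = G])
    show "AE t in lebesgue. (\<lambda>n. max (G t - real n) 0) \<longlonglongrightarrow> 0"
    proof (rule AE_I2)
      fix t
      obtain k :: nat where "G t \<le> real k" using real_arch_simple by blast
      then have "\<forall>\<^sub>F n in sequentially. max (G t - real n) 0 = 0"
        by (intro eventually_sequentiallyI[of k]) auto
      then show "(\<lambda>n. max (G t - real n) 0) \<longlonglongrightarrow> 0" by (rule tendsto_eventually)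
    qed
    show "AE t in lebesgue. norm (max (G t - real n) 0) \<le> G t" for n
      using G(2) by (intro AE_I2) auto
  qed (use Gm G(1) in auto)
  then have "(\<lambda>n. \<integral>t. max (G t - real n) 0 \<partial>lebesgue) \<longlonglongrightarrow> 0" by simp
  moreover have "e / 2 > 0" using \<open>e > 0\<close> by simp
  ultimately have "\<forall>\<^sub>F n in sequentially. (\<integral>t. max (G t - real n) 0 \<partial>lebesgue) < e / 2"
    by (rule order_tendstoD(2))
  then obtain n where n: "(\<integral>t. max (G t - real n) 0 \<partial>lebesgue) < e / 2"
    by (auto simp: eventually_sequentially)
  have hint: "integrable lebesgue (\<lambda>t. max (G t - real n) 0)"
    by (rule Bochner_Integration.integrable_bound[OF G(1)]) (use Gm G(2) in auto)
  \<comment> \<open>Keeps the part of height \<open>n\<close> below e/2; the summand 1 covers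
    \<open>n = 0\<close>.\<close>
  define \<delta> where "\<delta> = e / (2 * (real n + 1))"
  have "\<delta> > 0" using \<open>e > 0\<close> by (simp add: \<delta>_def)
  have "variation F P < e"
    if P: "interval_family a b P" and len: "total_length P < \<delta>" for P
  proof -
    note fin = interval_family_D(1)[OF P] and bnd = interval_family_D(2)[OF P] and disj = interval_family_D(3)[OF P]
    let ?U = "\<Union>p\<in>P. {fst p<..<snd p}"
    have one: "dist (F (fst p)) (F (snd p)) \<le> (\<integral>t. indicator {fst p<..<snd p} t * G t \<partial>lebesgue)"
      if "p \<in> P" for p
    proof -
      define u v where "u = fst p" and "v = snd p"
      have uv: "a \<le> u" "u \<le> v" "v \<le> b" using bnd[OF that] by (auto simp: u_def v_def)
      have "g absolutely_integrable_on {u..v}"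
        by (rule set_integrable_subset[OF g]) (use uv in auto)
      from integral_indicator_interval(2)[OF this F[OF uv], of "{u<..<v}"]
      have "norm (F v - F u) \<le> (\<integral>t. norm (indicator {u<..<v} t *\<^sub>R g t) \<partial>lebesgue)"
        using integral_norm_bound by (metis greaterThanLessThan_subseteq_atLeastAtMost_iff order_refl)
      also have "(\<lambda>t. norm (indicator {u<..<v} t *\<^sub>R g t)) = (\<lambda>t. indicator {u<..<v} t * G t)"
        using uv by (auto simp: G_def indicator_def)
      finally show ?thesis by (simp add: u_def v_def dist_norm norm_minus_commute)
    qed
    have intp: "integrable lebesgue (\<lambda>t. indicator S t * G t)" if "S \<in> sets lebesgue" for S :: "real set"
      using integrable_mult_indicator[OF that G(1)] by simp
    have measU: "(\<Sum>p\<in>P. snd p - fst p) = measure lebesgue ?U" and "?U \<in> lmeasurable"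
      using sum_length_eq_measure[OF fin _ disj] UN_interval_lmeasurable[OF fin _ disj] bnd by auto
    then have Usets: "?U \<in> sets lebesgue" and Ufin: "emeasure lebesgue ?U < \<infinity>"
      by (auto simp: fmeasurable_def)
    have "variation F P \<le> (\<Sum>p\<in>P. \<integral>t. indicator {fst p<..<snd p} t * G t \<partial>lebesgue)"
      unfolding case_prod_unfold by (intro sum_mono one)
    also have "\<dots> = (\<integral>t. (\<Sum>p\<in>P. indicator {fst p<..<snd p} t * G t) \<partial>lebesgue)"
      by (intro Bochner_Integration.integral_sum[symmetric] intp) auto
    also have "\<dots> = (\<integral>t. indicator ?U t * G t \<partial>lebesgue)"
      using fin disj by (simp add: indicator_UN_disjoint sum_distrib_right)
    also have "\<dots> \<le> (\<integral>t. indicator ?U t * real n + max (G t - real n) 0 \<partial>lebesgue)"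
      using Usets Ufin hint
      by (intro integral_mono intp Bochner_Integration.integrable_add integrable_mult_left integrable_real_indicator)
        (auto simp: indicator_def G(2))
    also have "\<dots> = measure lebesgue ?U * real n + (\<integral>t. max (G t - real n) 0 \<partial>lebesgue)"
      using Usets Ufin hint
      by (subst Bochner_Integration.integral_add) (auto intro!: integrable_mult_left integrable_real_indicator)
    also have "\<dots> < e"
    proof -
      have "measure lebesgue ?U * real n \<le> \<delta> * real n"
        using measU[symmetric] len by (intro mult_right_mono) (auto simp: case_prod_unfold)
      also have "\<dots> \<le> e / 2" using \<open>e > 0\<close> by (simp add: \<delta>_def field_simps)
      finally show ?thesis using n by simp
    qed
    finally show ?thesis .
  qed
  then show "\<exists>\<delta>>0. \<forall>P. interval_family a b P \<longrightarrow> total_length P < \<delta> \<longrightarrow>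
      variation F P < e"
    using \<open>\<delta> > 0\<close> by blast
qed

lemma locally_integrable_primitive:
  fixes g :: "real \<Rightarrow> 'a::euclidean_space"
  assumes g: "\<And>a b. g absolutely_integrable_on {a..b}"
  obtains F where "\<And>a b. a \<le> b \<Longrightarrow> (g has_integral (F b - F a)) {a..b}"
    and "AC_loc UNIV F" and "AE t in lebesgue. (F has_vector_derivative g t) (at t)"
proof -
  have gi: "g integrable_on {a..b}" for a b
    using g by (simp add: absolutely_integrable_on_def)
  \<comment> \<open>An interval with reversed endpoints is empty, so at most one of the two
    integrals is nonzero and this is the signed integral from 0.\<close>
  define F where "F t = integral {0..t} g - integral {t..0} g" for t
  have F: "(g has_integral (F b - F a)) {a..b}" if "a \<le> b" for a b
  proof -
    have "integral {a..b} g = F b - F a"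
    proof -
      consider "0 \<le> a" | "a < 0" "0 \<le> b" | "b < 0" by linarith
      then show ?thesis
      proof cases
        case 1
        have "integral {x..0} g = 0" if "x \<ge> 0" for x
          using that by (cases "x = 0") auto
        then show ?thesis
          using Henstock_Kurzweil_Integration.integral_combine[OF 1 that gi] 1 that by (simp add: F_def algebra_simps)
      next
        case 2
        have "integral {b..0} g = 0" using 2 by (cases "b = 0") auto
        then show ?thesis
          using Henstock_Kurzweil_Integration.integral_combine[of a 0 b g] 2 gi by (simp add: F_def algebra_simps)
      next
        case 3
        then show ?thesis
          using Henstock_Kurzweil_Integration.integral_combine[of a b 0 g] that gi by (simp add: F_def algebra_simps)
      qed
    qed
    then show ?thesis using gi by (simp add: has_integral_iff)
  qed
  show thesis
  proof
    show "AC_loc UNIV F"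
      unfolding AC_loc_def by (auto intro!: abs_cont_on_of_integral[OF g F])
    show "AE t in lebesgue. (F has_vector_derivative g t) (at t)"
      by (rule AE_has_derivative_of_integral[OF F])
  qed (rule F)
qed

section \<open>Local absolute continuity on the line and the half-line\<close>

lemma AC_loc_cong: "AC_loc I f \<Longrightarrow> (\<And>t. t \<in> I \<Longrightarrow> f t = g t) \<Longrightarrow> AC_loc I g"
  unfolding AC_loc_def by (metis abs_cont_on_cong subset_iff)

lemma AC_loc_bilinear:
  "bounded_bilinear pr \<Longrightarrow> AC_loc I f \<Longrightarrow> AC_loc I g \<Longrightarrow> AC_loc I (\<lambda>t. pr (f t) (g t))"
  unfolding AC_loc_def by (blast intro: abs_cont_on_bilinear)

lemma AC_loc_bounded_linear: "bounded_linear L \<Longrightarrow> AC_loc I f \<Longrightarrow> AC_loc I (\<lambda>t. L (f t))"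
  unfolding AC_loc_def by (blast intro: abs_cont_on_bounded_linear)

lemma AC_loc_const: "AC_loc I (\<lambda>_. c)"
  unfolding AC_loc_def abs_cont_on_def by (auto intro: exI[of _ 1])

lemma AC_loc_add:
  fixes f g :: "real \<Rightarrow> 'a::real_normed_vector"
  assumes "AC_loc I f" "AC_loc I g" shows "AC_loc I (\<lambda>t. f t + g t)"
proof -
  have "dist (f u + g u) (f v + g v) \<le> 1 * dist (f u) (f v) + 1 * dist (g u) (g v)" for u v
    using dist_triangle_add[of "f u" "g u" "f v" "g v"] by simp
  then show ?thesis using assms unfolding AC_loc_def by (blast intro: abs_cont_on_dominated2)
qed

lemma AC_loc_extend:
  assumes "AC_loc {0..} f" shows "AC_loc UNIV (\<lambda>t. f (max 0 t))"
  unfolding AC_loc_def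
proof (intro allI impI)
  fix a b :: real assume "a \<le> b"
  have "abs_cont_on 0 (max 0 b) f" using assms unfolding AC_loc_def by (auto simp: subset_eq)
  then have "abs_cont_on a b (\<lambda>t. f (max 0 (min (max 0 b) t)))" by (rule abs_cont_on_clamp) simp
  then show "abs_cont_on a b (\<lambda>t. f (max 0 t))"
    by (rule abs_cont_on_cong) (auto simp: max_def min_def)
qed

lemma AC_loc_continuous_on:
  assumes I: "I = UNIV \<or> I = {0..}" and f: "AC_loc I f"
  shows "continuous_on I f"
  using I
proof
  assume "I = UNIV"
  then show ?thesis using f abs_cont_on_continuous_UNIV by (auto simp: AC_loc_def)
next
  assume I: "I = {0..}"
  then have "continuous_on UNIV (\<lambda>t. f (max 0 t))"
    using AC_loc_extend[of f] f abs_cont_on_continuous_UNIV[of "\<lambda>t. f (max 0 t)"] by (simp add: AC_loc_def)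
  then have "continuous_on I (\<lambda>t. f (max 0 t))" by (rule continuous_on_subset) simp
  then show ?thesis by (rule continuous_on_eq) (use I in auto)
qed

lemma AC_loc_AE_derivative:
  fixes f :: "real \<Rightarrow> 'a::euclidean_space"
  assumes I: "I = UNIV \<or> I = {0..}" and f: "AC_loc I f"
  shows "AE t in lebesgue_on I. (f has_vector_derivative ddt f t) (at t)"
proof -
  \<comment> \<open>Compact intervals exhausting \<open>I\<close>; on the half-line they start at 0
    so as not to leave \<open>I\<close>.\<close>
  define a where "a n = (if I = UNIV then - real n else 0)" for n
  have sub: "{a n..real n} \<subseteq> I" for n using I by (auto simp: a_def)
  have "AE t in lebesgue. \<forall>n. t \<in> {a n..real n} \<longrightarrow> (f has_vector_derivative ddt f t) (at t)"
    unfolding AE_all_countable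
  proof
    fix n
    have "a n \<le> real n" by (simp add: a_def)
    then show "AE t in lebesgue. t \<in> {a n..real n} \<longrightarrow> (f has_vector_derivative ddt f t) (at t)"
      using abs_cont_on_AE_derivative f sub unfolding AC_loc_def by blast
  qed
  then have "AE t in lebesgue. t \<in> I \<longrightarrow> (f has_vector_derivative ddt f t) (at t)"
  proof eventually_elim
    case (elim t)
    obtain n :: nat where "\<bar>t\<bar> \<le> real n" using real_arch_simple by blast
    then have "t \<in> I \<Longrightarrow> t \<in> {a n..real n}" using I by (auto simp: a_def)
    then show ?case using elim by blast
  qed
  then show ?thesis using I by (subst AE_restrict_space_iff) auto
qed

lemma AC_loc_ddt_measurable:
  fixes f :: "real \<Rightarrow> 'a::euclidean_space"
  assumes I: "I = UNIV \<or> I = {0..}" and f: "AC_loc I f"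
  shows "ddt f \<in> borel_measurable (lebesgue_on I)"
proof -
  define a where "a n = (if I = UNIV then - real n else 0)" for n
  have sub: "{a n..real n} \<subseteq> I" for n using I by (auto simp: a_def)
  show ?thesis
  proof (rule measurable_piecewise_restrict[of "range (\<lambda>n. {a n..real n})"])
    show "space (lebesgue_on I) \<subseteq> \<Union> (range (\<lambda>n. {a n..real n}))"
    proof
      fix t assume "t \<in> space (lebesgue_on I)"
      moreover obtain n :: nat where "\<bar>t\<bar> \<le> real n" using real_arch_simple by blast
      ultimately have "t \<in> {a n..real n}" using I by (auto simp: a_def)
      then show "t \<in> \<Union> (range (\<lambda>n. {a n..real n}))" by blast
    qed
    fix S assume "S \<in> range (\<lambda>n. {a n..real n})"
    then obtain n where S: "S = {a n..real n}" by blast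
    show "S \<inter> space (lebesgue_on I) \<in> sets (lebesgue_on I)"
    proof -
      have "S \<inter> space (lebesgue_on I) = I \<inter> S" using sub[of n] by (auto simp: S)
      then show ?thesis unfolding sets_restrict_space by (simp add: S image_iff) (metis S lborelD sets_completionI_sets atLeastAtMost_borel sets_lborel)
    qed
    have "abs_cont_on (a n) (real n) f" using f sub[of n] by (auto simp: AC_loc_def a_def)
    then have "ddt f absolutely_integrable_on S"
      unfolding S by (rule abs_cont_on_ddt_integrable) (simp add: a_def)
    then have "ddt f \<in> borel_measurable (lebesgue_on S)"
      by (simp add: absolutely_integrable_on_iff_lebesgue_on S)
    moreover have "restrict_space (lebesgue_on I) S = lebesgue_on S"
      using sub[of n] I by (subst restrict_restrict_space) (auto simp: S Int_absorb1)
    ultimately show "ddt f \<in> borel_measurable (restrict_space (lebesgue_on I) S)" by simp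
  qed auto
qed

lemma AC_loc_measurable:
  fixes f :: "real \<Rightarrow> 'a::euclidean_space"
  assumes I: "I = UNIV \<or> I = {0..}" and f: "AC_loc I f"
  shows "f \<in> borel_measurable (lebesgue_on I)"
  using AC_loc_continuous_on[OF assms] I by (intro continuous_imp_measurable_on_sets_lebesgue) auto

section \<open>Complex matrices and vectors\<close>

lemma cdot_add_left: "cdot (u + v) w = cdot u w + cdot v w"
  and cdot_add_right: "cdot w (u + v) = cdot w u + cdot w v"
  and cdot_scale_left: "cdot (c *s u) w = cnj c * cdot u w"
  and cdot_scale_right: "cdot w (c *s u) = c * cdot w u"
  and cdot_scaleR_left: "cdot (r *\<^sub>R u) w = r *\<^sub>R cdot u w"
  and cdot_scaleR_right: "cdot w (r *\<^sub>R u) = r *\<^sub>R cdot w u"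
  and cdot_minus_left: "cdot (- u) w = - cdot u w"
  and cdot_minus_right: "cdot w (- u) = - cdot w u"
  and cdot_diff_left: "cdot (u - v) w = cdot u w - cdot v w"
  and cdot_diff_right: "cdot w (u - v) = cdot w u - cdot w v"
  by (simp_all add: cdot_def algebra_simps sum.distrib sum_subtractf sum_negf sum_distrib_left
      scaleR_conv_of_real[where 'a = complex])

lemma cdot_self: "cdot u u = of_real ((norm u)\<^sup>2)"
proof -
  have "(norm u)\<^sup>2 = (\<Sum>i\<in>UNIV. (cmod (u $ i))\<^sup>2)"
    by (simp add: norm_vec_def L2_set_def sum_nonneg)
  then show ?thesis
    by (simp add: cdot_def mult.commute[of "cnj _"] complex_norm_square flip: of_real_power)
qed

lemma norm_cdot_le: "cmod (cdot u v) \<le> norm u * norm v"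
proof -
  have "cmod (cdot u v) \<le> (\<Sum>i\<in>UNIV. \<bar>cmod (u $ i)\<bar> * \<bar>cmod (v $ i)\<bar>)"
    unfolding cdot_def by (rule order_trans[OF norm_sum]) (simp add: norm_mult)
  also have "\<dots> \<le> norm u * norm v"
    unfolding norm_vec_def by (rule L2_set_mult_ineq)
  finally show ?thesis .
qed

lemma bounded_bilinear_cdot: "bounded_bilinear (cdot :: complex^'k \<Rightarrow> _)"
proof
  show "\<exists>K. \<forall>a b :: complex^'k. cmod (cdot a b) \<le> norm a * norm b * K"
    by (intro exI[of _ 1]) (simp add: norm_cdot_le)
qed (simp_all add: cdot_add_left cdot_add_right cdot_scaleR_left cdot_scaleR_right)

lemma cdot_ext: "(\<And>u. cdot u v = cdot u w) \<Longrightarrow> v = w"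
proof -
  assume "\<And>u. cdot u v = cdot u w"
  then have "cdot (v - w) (v - w) = 0" by (simp add: cdot_diff_right)
  then show "v = w" by (simp add: cdot_self)
qed

lemma cadj_cadj [simp]: "cadj (cadj A) = A"
  and cadj_add: "cadj (A + B) = cadj A + cadj B"
  and cadj_diff: "cadj (A - B) = cadj A - cadj B"
  and cadj_scaleR: "cadj (r *\<^sub>R A) = r *\<^sub>R cadj A"
  and cadj_mat: "cadj (mat c) = mat (cnj c)"
  by (auto simp: cadj_def vec_eq_iff mat_def)

lemma cadj_mult: "cadj (A ** B) = cadj B ** cadj A"
  by (simp add: cadj_def vec_eq_iff matrix_matrix_mult_def mult.commute)

lemma cdot_cadj: "cdot (cadj A *v u) v = cdot u (A *v v)"
proof -
  have "cdot (cadj A *v u) v = (\<Sum>j\<in>UNIV. \<Sum>i\<in>UNIV. A $ i $ j * cnj (u $ i) * v $ j)"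
    by (simp add: cdot_def cadj_def matrix_vector_mult_def sum_distrib_right)
  also have "\<dots> = (\<Sum>i\<in>UNIV. \<Sum>j\<in>UNIV. A $ i $ j * cnj (u $ i) * v $ j)"
    by (rule sum.swap)
  also have "\<dots> = cdot u (A *v v)"
    by (simp add: cdot_def matrix_vector_mult_def sum_distrib_left mult_ac)
  finally show ?thesis .
qed

lemma cdot_cadj': "cdot (A *v u) v = cdot u (cadj A *v v)"
  using cdot_cadj[of "cadj A"] by simp

lemma matrix_vector_mult_scale: "A *v (c *s v) = c *s (A *v (v :: complex^'k))"
  by (simp add: vec_eq_iff matrix_vector_mult_def sum_distrib_left mult_ac)

lemma matrix_vector_mult_scaleR_complex: "A *v (r *\<^sub>R v) = r *\<^sub>R (A *v (v :: complex^'k))"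
  by (simp add: vec_eq_iff matrix_vector_mult_def scaleR_sum_right)

lemma scaleR_matrix_vector_mult: "(r *\<^sub>R A) *v v = r *\<^sub>R (A *v (v :: complex^'k))"
  by (simp add: vec_eq_iff matrix_vector_mult_def scaleR_sum_right)

lemma mat_vector_mult: "mat c *v v = c *s (v :: complex^'k)"
  by (simp add: vec_eq_iff matrix_vector_mult_def mat_def if_distrib if_distribR sum.delta' cong: if_cong)

text \<open>The scalar -\<i> in \<open>gauge_pot\<close> is written as the matrix
  \<open>mat (- \<i>)\<close>, and taking adjoints moves it to the other end of the product.\<close>

lemma mat_matrix_mult_commute: "mat c ** A = A ** mat (c :: complex)"
  by (simp add: vec_eq_iff matrix_matrix_mult_def mat_def if_distrib if_distribR sum.delta sum.delta' mult.commute cong: if_cong)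

lemma matrix_vector_mult_minus: "A *v (- v) = - (A *v (v :: complex^'k))"
  by (simp add: vec_eq_iff matrix_vector_mult_def sum_negf)

lemma scale_minus_complex: "c *s (- v) = - (c *s (v :: complex^'k))"
  and minus_scale_complex: "(- c) *s v = - (c *s (v :: complex^'k))"
  and scale_scale_complex: "c *s (d *s v) = (c * d) *s (v :: complex^'k)"
  and scaleR_scale_complex: "r *\<^sub>R (c *s v) = c *s (r *\<^sub>R (v :: complex^'k))"
  and scale_add_complex: "c *s (v + w) = c *s v + c *s (w :: complex^'k)"
  and scale_diff_complex: "c *s (v - w) = c *s v - c *s (w :: complex^'k)"
  by (simp_all add: vec_eq_iff algebra_simps)

lemma norm_scale_complex: "norm (c *s (v :: complex^'k)) = cmod c * norm v"
  by (simp add: norm_vec_def norm_mult L2_set_right_distrib)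

lemma bounded_bilinear_matrix_vector: "bounded_bilinear ((*v) :: complex^'k^'l \<Rightarrow> complex^'k \<Rightarrow> complex^'l)"
  unfolding bilinear_conv_bounded_bilinear[symmetric] bilinear_def
  by (auto intro!: linearI simp: matrix_vector_right_distrib matrix_vector_mult_add_rdistrib
      matrix_vector_mult_scaleR_complex scaleR_matrix_vector_mult)

lemma bounded_bilinear_matrix_matrix: "bounded_bilinear ((**) :: complex^'k^'k \<Rightarrow> complex^'k^'k \<Rightarrow> complex^'k^'k)"
  unfolding bilinear_conv_bounded_bilinear[symmetric] bilinear_def
  by (auto intro!: linearI simp: vec_eq_iff matrix_matrix_mult_def sum.distrib algebra_simps scaleR_sum_right)

lemma bounded_linear_cadj: "bounded_linear (cadj :: complex^'k^'k \<Rightarrow> _)"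
  unfolding linear_conv_bounded_linear[symmetric]
  by (auto intro!: linearI simp: cadj_add cadj_scaleR)

lemma bounded_linear_scale: "bounded_linear (\<lambda>v :: complex^'k. c *s v)"
  unfolding linear_conv_bounded_linear[symmetric]
  by (auto intro!: linearI simp: scale_add_complex scaleR_scale_complex)

lemma bounded_linear_matrix_vector: "bounded_linear (\<lambda>v :: complex^'k. (A :: complex^'k^'k) *v v)"
  by (rule bounded_bilinear.bounded_linear_right[OF bounded_bilinear_matrix_vector])

section \<open>Square integrable functions\<close>

lemma borel_measurable_bilinear:
  fixes f :: "'x \<Rightarrow> 'a::euclidean_space" and g :: "'x \<Rightarrow> 'b::euclidean_space"
    and pr :: "'a \<Rightarrow> 'b \<Rightarrow> 'c::euclidean_space"
  assumes "bounded_bilinear pr" "f \<in> borel_measurable M" "g \<in> borel_measurable M"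
  shows "(\<lambda>t. pr (f t) (g t)) \<in> borel_measurable M"
  using assms(2,3)
  by (rule borel_measurable_continuous_Pair)
    (intro bounded_bilinear.continuous_on[OF assms(1)] continuous_intros)

lemmas borel_measurable_matrix_vector = borel_measurable_bilinear[OF bounded_bilinear_matrix_vector]
lemmas borel_measurable_matrix_matrix = borel_measurable_bilinear[OF bounded_bilinear_matrix_matrix]
lemmas borel_measurable_cdot = borel_measurable_bilinear[OF bounded_bilinear_cdot]

lemma borel_measurable_bounded_linear:
  fixes f :: "'x \<Rightarrow> 'a::euclidean_space" and L :: "'a \<Rightarrow> 'b::euclidean_space"
  assumes "bounded_linear L" "f \<in> borel_measurable M"
  shows "(\<lambda>t. L (f t)) \<in> borel_measurable M"
  using assms(2) by (rule borel_measurable_continuous_on[OF linear_continuous_on[OF assms(1)]])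

text \<open>Common form of \<open>matrix_L2\<close> and of \<open>L2fun\<close> with unit weight,
  with values in any Euclidean space, so that the same closure properties serve matrices, vectors
  and scalar coefficients.\<close>

definition sq_integrable :: "'x measure \<Rightarrow> ('x \<Rightarrow> 'a::euclidean_space) \<Rightarrow> bool" where
  "sq_integrable M f \<longleftrightarrow> f \<in> borel_measurable M \<and> integrable M (\<lambda>t. (norm (f t))\<^sup>2)"

lemma matrix_L2_iff: "matrix_L2 I P \<longleftrightarrow> sq_integrable (lebesgue_on I) P"
  by (simp add: matrix_L2_def sq_integrable_def)

lemma L2fun_one_weight_iff: "f \<in> L2fun I one_weight \<longleftrightarrow> sq_integrable (lebesgue_on I) f"
proof -
  have "integrable M (\<lambda>t. of_real (h t) :: complex) \<longleftrightarrow> integrable M h" for M and h :: "real \<Rightarrow> real"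
  proof
    assume "integrable M (\<lambda>t. of_real (h t) :: complex)"
    from integrable_Re[OF this] show "integrable M h" by simp
  qed (rule integrable_of_real)
  then show ?thesis by (simp add: L2fun_def sq_integrable_def cdot_self del: of_real_power)
qed

lemma sq_integrable_bound:
  assumes "sq_integrable M g" "f \<in> borel_measurable M" "AE t in M. norm (f t) \<le> C * norm (g t)"
  shows "sq_integrable M f"
proof -
  have "integrable M (\<lambda>t. C\<^sup>2 * (norm (g t))\<^sup>2)" using assms(1) by (simp add: sq_integrable_def)
  then have "integrable M (\<lambda>t. (norm (f t))\<^sup>2)"
  proof (rule Bochner_Integration.integrable_bound)
    show "AE t in M. norm ((norm (f t))\<^sup>2) \<le> norm (C\<^sup>2 * (norm (g t))\<^sup>2)"
      using assms(3)
    proof eventually_elim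
      case (elim t)
      then have "(norm (f t))\<^sup>2 \<le> (C * norm (g t))\<^sup>2" by (intro power_mono) auto
      then show ?case by (simp add: power_mult_distrib)
    qed
  qed (use assms(2) in measurable)
  then show ?thesis using assms(2) by (simp add: sq_integrable_def)
qed

lemma sq_integrable_add:
  assumes "sq_integrable M f" "sq_integrable M g"
  shows "sq_integrable M (\<lambda>t. f t + g t)"
proof -
  have [measurable]: "f \<in> borel_measurable M" "g \<in> borel_measurable M"
    using assms by (auto simp: sq_integrable_def)
  have "integrable M (\<lambda>t. 2 * (norm (f t))\<^sup>2 + 2 * (norm (g t))\<^sup>2)"
    using assms by (simp add: sq_integrable_def)
  then have "integrable M (\<lambda>t. (norm (f t + g t))\<^sup>2)"
  proof (rule Bochner_Integration.integrable_bound)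
    show "AE t in M. norm ((norm (f t + g t))\<^sup>2) \<le> norm (2 * (norm (f t))\<^sup>2 + 2 * (norm (g t))\<^sup>2)"
    proof (rule AE_I2)
      fix t
      have "(norm (f t + g t))\<^sup>2 \<le> (norm (f t) + norm (g t))\<^sup>2"
        by (intro power_mono norm_triangle_ineq) auto
      also have "\<dots> \<le> 2 * (norm (f t))\<^sup>2 + 2 * (norm (g t))\<^sup>2"
        using sum_squares_bound[of "norm (f t)" "norm (g t)"] by (simp add: power2_sum)
      finally show "norm ((norm (f t + g t))\<^sup>2) \<le> norm (2 * (norm (f t))\<^sup>2 + 2 * (norm (g t))\<^sup>2)" by simp
    qed
  qed measurable
  then show ?thesis by (simp add: sq_integrable_def)
qed

lemma sq_integrable_bounded_linear:
  fixes L :: "'a::euclidean_space \<Rightarrow> 'b::euclidean_space"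
  assumes L: "bounded_linear L" and f: "sq_integrable M f"
  shows "sq_integrable M (\<lambda>t. L (f t))"
proof -
  obtain K where K: "\<And>x. norm (L x) \<le> norm x * K" using bounded_linear.bounded[OF L] by auto
  show ?thesis
  proof (rule sq_integrable_bound[OF f])
    show "(\<lambda>t. L (f t)) \<in> borel_measurable M"
      using f by (intro borel_measurable_bounded_linear[OF L]) (simp add: sq_integrable_def)
    show "AE t in M. norm (L (f t)) \<le> K * norm (f t)" using K by (simp add: mult.commute)
  qed
qed

lemma sq_integrable_diff:
  assumes "sq_integrable M f" "sq_integrable M g"
  shows "sq_integrable M (\<lambda>t. f t - g t)"
  using sq_integrable_add[OF assms(1) sq_integrable_bounded_linear[OF bounded_linear_minus[OF bounded_linear_ident] assms(2)]]
  by simp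

lemma sq_integrable_bilinear_bounded:
  fixes pr :: "'a::euclidean_space \<Rightarrow> 'b::euclidean_space \<Rightarrow> 'c::euclidean_space"
  assumes pr: "bounded_bilinear pr" and P: "sq_integrable M P" and f: "f \<in> borel_measurable M"
    and bound: "AE t in M. norm (f t) \<le> C"
  shows "sq_integrable M (\<lambda>t. pr (P t) (f t))"
proof -
  obtain K where K: "0 < K" "\<And>a b. norm (pr a b) \<le> norm a * norm b * K"
    using bounded_bilinear.pos_bounded[OF pr] by metis
  show ?thesis
  proof (rule sq_integrable_bound[OF P])
    show "(\<lambda>t. pr (P t) (f t)) \<in> borel_measurable M"
      using P f by (intro borel_measurable_bilinear[OF pr]) (simp_all add: sq_integrable_def)
    show "AE t in M. norm (pr (P t) (f t)) \<le> (C * K) * norm (P t)"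
      using bound
    proof eventually_elim
      case (elim t)
      have "norm (pr (P t) (f t)) \<le> norm (P t) * norm (f t) * K" by (rule K)
      also have "\<dots> \<le> norm (P t) * C * K" using elim K(1) by (intro mult_right_mono mult_left_mono) auto
      finally show ?case by (simp add: mult_ac)
    qed
  qed
qed

text \<open>Only integrability is at stake, so the pointwise bound ab \<le> a^2 + b^2 replaces the
  Cauchy-Schwarz inequality.\<close>

lemma integrable_bilinear_sq_integrable:
  fixes pr :: "'a::euclidean_space \<Rightarrow> 'b::euclidean_space \<Rightarrow> 'c::euclidean_space"
  assumes pr: "bounded_bilinear pr" and f: "sq_integrable M f" and g: "sq_integrable M g"
  shows "integrable M (\<lambda>t. pr (f t) (g t))"
proof -
  obtain K where K: "0 < K" "\<And>a b. norm (pr a b) \<le> norm a * norm b * K"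
    using bounded_bilinear.pos_bounded[OF pr] by metis
  have "integrable M (\<lambda>t. ((norm (f t))\<^sup>2 + (norm (g t))\<^sup>2) * K)"
    using f g by (simp add: sq_integrable_def)
  then show ?thesis
  proof (rule Bochner_Integration.integrable_bound)
    show "(\<lambda>t. pr (f t) (g t)) \<in> borel_measurable M"
      using f g by (intro borel_measurable_bilinear[OF pr]) (simp_all add: sq_integrable_def)
    show "AE t in M. norm (pr (f t) (g t)) \<le> norm (((norm (f t))\<^sup>2 + (norm (g t))\<^sup>2) * K)"
    proof (rule AE_I2)
      fix t
      have "norm (f t) * norm (g t) \<le> (norm (f t))\<^sup>2 + (norm (g t))\<^sup>2"
        using sum_squares_bound[of "norm (f t)" "norm (g t)"]
          mult_nonneg_nonneg[OF norm_ge_zero norm_ge_zero, of "f t" "g t"]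
        unfolding mult.assoc by linarith
      then have "norm (f t) * norm (g t) * K \<le> ((norm (f t))\<^sup>2 + (norm (g t))\<^sup>2) * K"
        using K(1) by (intro mult_right_mono) auto
      then show "norm (pr (f t) (g t)) \<le> norm (((norm (f t))\<^sup>2 + (norm (g t))\<^sup>2) * K)"
        using K order_trans[OF K(2)] by fastforce
    qed
  qed
qed

lemma dirac_expr_measurable:
  fixes f :: "real \<Rightarrow> complex^'k"
  assumes I: "I = UNIV \<or> I = {0..}" and f: "AC_loc I f" and P: "P \<in> borel_measurable (lebesgue_on I)"
  shows "(\<lambda>t. dirac_expr J B m f t + P t *v f t) \<in> borel_measurable (lebesgue_on I)"
  unfolding dirac_expr_def
  by (intro borel_measurable_add borel_measurable_bounded_linear[OF bounded_linear_scaleR_right]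
      borel_measurable_bounded_linear[OF bounded_linear_scale]
      borel_measurable_bounded_linear[OF bounded_linear_matrix_vector] borel_measurable_matrix_vector P
      AC_loc_measurable[OF I f] AC_loc_ddt_measurable[OF I f])

section \<open>The Dirac operator: regularity, symmetry, adjoint\<close>

lemma integral_lebesgue_on_mono_set:
  fixes h :: "'a::euclidean_space \<Rightarrow> real"
  assumes h: "integrable (lebesgue_on S) h" "\<And>x. x \<in> S \<Longrightarrow> 0 \<le> h x"
    and S: "S \<in> sets lebesgue" "T \<in> sets lebesgue" "T \<subseteq> S"
  shows "integrable (lebesgue_on T) h" and "integral\<^sup>L (lebesgue_on T) h \<le> integral\<^sup>L (lebesgue_on S) h"
proof -
  have hS: "h absolutely_integrable_on S" using h S by (simp add: absolutely_integrable_on_iff_lebesgue_on)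
  then have hT: "h absolutely_integrable_on T" using S set_integrable_subset by blast
  then show i: "integrable (lebesgue_on T) h" using S by (simp add: absolutely_integrable_on_iff_lebesgue_on)
  have "integral T h \<le> integral S h"
    using hS hT S h(2) by (intro integral_subset_le) (auto simp: absolutely_integrable_on_def)
  then show "integral\<^sup>L (lebesgue_on T) h \<le> integral\<^sup>L (lebesgue_on S) h"
    using i h(1) S by (simp add: lebesgue_integral_eq_integral)
qed

lemma abs_cont_on_norm_diff_le:
  fixes f :: "real \<Rightarrow> 'a::euclidean_space"
  assumes f: "abs_cont_on a b f" and uv: "u \<in> {a..b}" "v \<in> {a..b}"
  shows "norm (f u - f v) \<le> (\<integral>t. norm (ddt f t) \<partial>lebesgue_on {a..b})"
  using uv
proof (induction u v rule: linorder_wlog)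
  case (le u v)
  then have ab: "a \<le> b" and uv: "a \<le> u" "u \<le> v" "v \<le> b" by auto
  have d: "ddt f absolutely_integrable_on {a..b}" using abs_cont_on_ddt_integrable[OF f ab] .
  then have n: "(\<lambda>t. norm (ddt f t)) absolutely_integrable_on {a..b}" by (rule absolutely_integrable_norm[unfolded o_def])
  have duv: "ddt f absolutely_integrable_on {u..v}"
    by (rule set_integrable_subset[OF d]) (use uv in auto)
  have "norm (f v - f u) = norm (integral {u..v} (ddt f))"
    using integral_unique[OF abs_cont_on_has_integral_ddt[OF f ab uv]] by simp
  also have "\<dots> \<le> integral {u..v} (\<lambda>t. norm (ddt f t))"
    using duv by (intro integral_norm_bound_integral) (auto simp: absolutely_integrable_on_def)
  also have "\<dots> \<le> integral {a..b} (\<lambda>t. norm (ddt f t))"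
    using duv d uv by (intro integral_subset_le) (auto simp: absolutely_integrable_on_def)
  also have "\<dots> = (\<integral>t. norm (ddt f t) \<partial>lebesgue_on {a..b})"
    using n by (simp add: lebesgue_integral_eq_integral absolutely_integrable_on_iff_lebesgue_on)
  finally show ?case by (simp add: norm_minus_commute)
qed (simp add: norm_minus_commute)

text \<open>On intervals so short that the coefficient \<open>q\<close> has integral at most one half, the maximum of
  \<open>f\<close> can be absorbed.\<close>

lemma AC_loc_bounded:
  fixes f :: "real \<Rightarrow> 'a::euclidean_space" and k q :: "real \<Rightarrow> real"
  assumes I: "I = UNIV \<or> I = {0..}" and ac: "AC_loc I f" and f: "sq_integrable (lebesgue_on I) f"
    and k: "sq_integrable (lebesgue_on I) k" and q: "sq_integrable (lebesgue_on I) q" and q0: "\<And>t. 0 \<le> q t"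
    and d: "AE t in lebesgue_on I. norm (ddt f t) \<le> k t + q t * norm (f t)"
  obtains C where "\<And>t. t \<in> I \<Longrightarrow> norm (f t) \<le> C"
proof -
  have Isets: "I \<in> sets lebesgue" using I by auto
  define Nf where "Nf = (\<integral>t. (norm (f t))\<^sup>2 \<partial>lebesgue_on I)"
  define Nk where "Nk = (\<integral>t. (norm (k t))\<^sup>2 \<partial>lebesgue_on I)"
  define Nq where "Nq = (\<integral>t. (norm (q t))\<^sup>2 \<partial>lebesgue_on I)"
  have nn: "0 \<le> Nf" "0 \<le> Nk" "0 \<le> Nq" by (auto simp: Nf_def Nk_def Nq_def)
  \<comment> \<open>By q \<le> (\<alpha> q^2 + 1/\<alpha>)/2, the integral of \<open>q\<close> over
    an interval of length \<open>h\<close> is at most (\<alpha> Nq + h/\<alpha>)/2. Here \<alpha> Nq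
    \<le> 1/2 and h/\<alpha> = 1/2, so it is at most 1/2, wherever the interval lies.\<close>
  define \<alpha> where "\<alpha> = 1 / (2 * Nq + 1)"
  define h where "h = \<alpha> / 2"
  have pos: "\<alpha> > 0" "h > 0" using nn by (auto simp: \<alpha>_def h_def)
  have "norm (f x) \<le> 2 * sqrt (Nf / h) + (Nk + h)" if x: "x \<in> I" for x
  proof -
    \<comment> \<open>Taken to the right of \<open>x\<close>, so that it stays in \<open>I\<close>
      even at the endpoint of the half-line.\<close>
    let ?J = "{x..x + h}"
    let ?M = "lebesgue_on ?J"
    have sub: "?J \<subseteq> I" using x I by auto
    have acJ: "abs_cont_on x (x + h) f" using ac sub pos unfolding AC_loc_def by auto
    have cont: "continuous_on ?J (\<lambda>t. norm (f t))"
      by (intro continuous_intros abs_cont_on_continuous acJ)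
    have J: "compact ?J" "?J \<noteq> {}" using pos by auto
    obtain s0 where s0: "s0 \<in> ?J" "\<And>t. t \<in> ?J \<Longrightarrow> norm (f t) \<le> norm (f s0)"
      using continuous_attains_sup[OF J cont] by blast
    obtain s1 where s1: "s1 \<in> ?J" "\<And>t. t \<in> ?J \<Longrightarrow> norm (f s1) \<le> norm (f t)"
      using continuous_attains_inf[OF J cont] by blast
    have int: "integrable ?M (\<lambda>t. (norm (g t))\<^sup>2)"
      "(\<integral>t. (norm (g t))\<^sup>2 \<partial>?M) \<le> (\<integral>t. (norm (g t))\<^sup>2 \<partial>lebesgue_on I)"
      if "sq_integrable (lebesgue_on I) g" for g :: "real \<Rightarrow> 'z::euclidean_space"
      using integral_lebesgue_on_mono_set[of I "\<lambda>t. (norm (g t))\<^sup>2" ?J] that sub Isets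
      by (auto simp: sq_integrable_def)
    have cst: "integrable ?M (\<lambda>_. c)" "(\<integral>_. c \<partial>?M) = c * h" for c :: real
      using pos by (simp_all add: measure_restrict_space)
    have amgm: "x \<le> (c * (norm x)\<^sup>2 + 1 / c) / 2" if "c > 0" for c x :: real
    proof -
      have "0 \<le> (sqrt c * x - 1 / sqrt c)\<^sup>2" by simp
      also have "\<dots> = c * (norm x)\<^sup>2 + 1 / c - 2 * x"
        using that by (simp add: power2_diff power_mult_distrib power_divide)
      finally show ?thesis by simp
    qed
    have dJ: "AE t in ?M. norm (ddt f t) \<le> k t + q t * norm (f t)"
    proof -
      have "AE t in lebesgue. t \<in> I \<longrightarrow> norm (ddt f t) \<le> k t + q t * norm (f t)"
        using d Isets by (subst (asm) AE_restrict_space_iff) auto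
      then have "AE t in lebesgue. t \<in> ?J \<longrightarrow> norm (ddt f t) \<le> k t + q t * norm (f t)"
        by eventually_elim (use sub in auto)
      then show ?thesis by (subst AE_restrict_space_iff) auto
    qed
    have "norm (f s0) - norm (f s1) \<le> norm (f s0 - f s1)" by (rule norm_triangle_ineq2)
    also have "\<dots> \<le> (\<integral>t. norm (ddt f t) \<partial>?M)" by (rule abs_cont_on_norm_diff_le[OF acJ s0(1) s1(1)])
    also have "\<dots> \<le> (\<integral>t. ((norm (k t))\<^sup>2 + 1) / 2 + (\<alpha> * (norm (q t))\<^sup>2 + 1 / \<alpha>) / 2 * norm (f s0) \<partial>?M)"
    proof (rule integral_mono_AE)
      show "integrable ?M (\<lambda>t. norm (ddt f t))"
        using abs_cont_on_ddt_integrable[OF acJ] pos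
        by (intro integrable_norm) (simp add: absolutely_integrable_on_iff_lebesgue_on)
      show "integrable ?M (\<lambda>t. ((norm (k t))\<^sup>2 + 1) / 2 + (\<alpha> * (norm (q t))\<^sup>2 + 1 / \<alpha>) / 2 * norm (f s0))"
        using int(1)[OF k] int(1)[OF q] cst(1)
        by (intro Bochner_Integration.integrable_add integrable_mult_left integrable_divide integrable_mult_right)
      show "AE t in ?M. norm (ddt f t) \<le> ((norm (k t))\<^sup>2 + 1) / 2 + (\<alpha> * (norm (q t))\<^sup>2 + 1 / \<alpha>) / 2 * norm (f s0)"
        using dJ AE_space
      proof eventually_elim
        case (elim t)
        have "q t * norm (f t) \<le> (\<alpha> * (norm (q t))\<^sup>2 + 1 / \<alpha>) / 2 * norm (f s0)"
          using s0(2)[of t] elim(2) q0[of t] amgm[OF pos(1), of "q t"] by (intro mult_mono) auto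
        moreover have "k t \<le> ((norm (k t))\<^sup>2 + 1) / 2" using amgm[of 1 "k t"] by simp
        ultimately show ?case by (intro order_trans[OF elim(1)] add_mono)
      qed
    qed
    also have "\<dots> = ((\<integral>t. (norm (k t))\<^sup>2 \<partial>?M) + h) / 2 + (\<alpha> * (\<integral>t. (norm (q t))\<^sup>2 \<partial>?M) + h / \<alpha>) / 2 * norm (f s0)"
      using int(1)[OF k] int(1)[OF q] cst(2)[of 1] by simp
    also have "\<dots> \<le> (Nk + h) / 2 + 1 / 2 * norm (f s0)"
    proof (intro add_mono mult_right_mono)
      have "\<alpha> * (\<integral>t. (norm (q t))\<^sup>2 \<partial>?M) \<le> \<alpha> * Nq"
        using int(2)[OF q] pos by (simp add: Nq_def)
      also have "\<dots> \<le> 1 / 2" using nn by (simp add: \<alpha>_def field_simps)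
      finally show "(\<alpha> * (\<integral>t. (norm (q t))\<^sup>2 \<partial>?M) + h / \<alpha>) / 2 \<le> 1 / 2"
        using pos by (simp add: h_def)
    qed (use int(2)[OF k] in \<open>auto simp: Nk_def\<close>)
    \<comment> \<open>Half of \<open>norm (f s0)\<close> reappears on the right and is absorbed,
      which doubles the other terms.\<close>
    finally have M: "norm (f s0) \<le> 2 * norm (f s1) + (Nk + h)" by (simp add: field_simps)
    \<comment> \<open>The minimum of |f| is at most its quadratic mean over an interval of fixed
      length, hence bounded by the norm of \<open>f\<close> independently of
      \<open>x\<close>.\<close>
    have "(norm (f s1))\<^sup>2 * h = (\<integral>_. (norm (f s1))\<^sup>2 \<partial>?M)" by (rule cst(2)[symmetric])
    also have "\<dots> \<le> (\<integral>t. (norm (f t))\<^sup>2 \<partial>?M)"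
      using s1(2) by (intro integral_mono cst int(1) f power_mono) auto
    also have "\<dots> \<le> Nf" using int(2)[OF f] by (simp add: Nf_def)
    finally have "(norm (f s1))\<^sup>2 \<le> Nf / h" using pos by (simp add: field_simps)
    then have "norm (f s1) \<le> sqrt (Nf / h)" by (rule real_le_rsqrt)
    then show ?thesis using M s0(2)[of x] pos by auto
  qed
  then show thesis by (rule that)
qed

lemma H1_iff: "f \<in> H1 I \<longleftrightarrow>
    AC_loc I f \<and> sq_integrable (lebesgue_on I) f \<and> sq_integrable (lebesgue_on I) (ddt f)"
  by (simp add: H1_def L2fun_one_weight_iff)

text \<open>The case of zero coefficient \<open>q\<close>, with |f'| as the inhomogeneity
  \<open>k\<close>.\<close>

lemma H1_bounded:
  fixes f :: "real \<Rightarrow> complex^'k"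
  assumes I: "I = UNIV \<or> I = {0..}" and f: "f \<in> H1 I"
  obtains C where "\<And>t. t \<in> I \<Longrightarrow> norm (f t) \<le> C"
proof (rule AC_loc_bounded[OF I, of f "\<lambda>t. norm (ddt f t)" "\<lambda>_. 0"])
  show "AC_loc I f" "sq_integrable (lebesgue_on I) f" using f by (auto simp: H1_iff)
  have "sq_integrable (lebesgue_on I) (ddt f)" using f by (simp add: H1_iff)
  then show "sq_integrable (lebesgue_on I) (\<lambda>t. norm (ddt f t))"
    by (auto simp: sq_integrable_def intro: borel_measurable_norm)
qed (auto simp: sq_integrable_def intro: that)

text \<open>\<open>P\<close> is merely square integrable, and P f remains so because
  \<open>f\<close> is bounded.\<close>

lemma dirac_expr_sq_integrable:
  fixes f :: "real \<Rightarrow> complex^'k"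
  assumes I: "I = UNIV \<or> I = {0..}" and f: "f \<in> H1 I" and P: "sq_integrable (lebesgue_on I) P"
  shows "sq_integrable (lebesgue_on I) (\<lambda>t. dirac_expr J B m f t + P t *v f t)"
proof -
  have f': "sq_integrable (lebesgue_on I) f" "sq_integrable (lebesgue_on I) (ddt f)"
    using f by (auto simp: H1_iff)
  obtain C where C: "\<And>t. t \<in> I \<Longrightarrow> norm (f t) \<le> C" using H1_bounded[OF I f] by blast
  have "sq_integrable (lebesgue_on I) (\<lambda>t. P t *v f t)"
  proof (rule sq_integrable_bilinear_bounded[OF bounded_bilinear_matrix_vector P])
    show "AE t in lebesgue_on I. norm (f t) \<le> C" using C by (intro AE_I2) auto
  qed (use f' in \<open>simp add: sq_integrable_def\<close>)
  moreover have "sq_integrable (lebesgue_on I) (\<lambda>t. (- \<i>) *s (J *v ddt f t))"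
    by (intro sq_integrable_bounded_linear[OF bounded_linear_scale]
        sq_integrable_bounded_linear[OF bounded_linear_matrix_vector] f'(2))
  moreover have "sq_integrable (lebesgue_on I) (\<lambda>t. m *\<^sub>R (B *v f t))"
    by (intro sq_integrable_bounded_linear[OF bounded_linear_scaleR_right]
        sq_integrable_bounded_linear[OF bounded_linear_matrix_vector] f'(1))
  ultimately show ?thesis unfolding dirac_expr_def by (intro sq_integrable_add)
qed

lemma ddt_eq_of_dirac_expr:
  assumes "J ** J = mat 1"
  shows "ddt f t = \<i> *s (J *v (dirac_expr J B m f t - m *\<^sub>R (B *v f t)))"
proof -
  have "J *v (J *v ddt f t) = ddt f t"
    using assms by (simp add: matrix_vector_mul_assoc)
  then show ?thesis
    by (simp add: dirac_expr_def matrix_vector_mult_scale scale_scale_complex matrix_vector_mult_minus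
        scale_minus_complex)
qed

text \<open>Converse of \<open>dirac_expr_sq_integrable\<close>. Only the sum is known to be square
  integrable; solving for f' by J^2 = I gives the differential inequality of
  \<open>AC_loc_bounded\<close>, and a bound for \<open>f\<close> then separates P f from the
  rest.\<close>

lemma H1_of_dirac_expr:
  fixes f :: "real \<Rightarrow> complex^'k"
  assumes I: "I = UNIV \<or> I = {0..}" and J: "J ** J = mat 1"
    and ac: "AC_loc I f" and f: "sq_integrable (lebesgue_on I) f" and P: "sq_integrable (lebesgue_on I) P"
    and w: "sq_integrable (lebesgue_on I) (\<lambda>t. dirac_expr J B m f t + P t *v f t)"
  shows "f \<in> H1 I"
proof -
  define w where "w t = dirac_expr J B m f t + P t *v f t" for t
  let ?r = "\<lambda>t. w t - m *\<^sub>R (B *v f t)"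
  have ddt_f: "ddt f t = \<i> *s (J *v (?r t - P t *v f t))" for t
    using ddt_eq_of_dirac_expr[OF J, of f t B m] by (simp add: w_def algebra_simps)
  obtain K where K: "0 < K" "\<And>v. norm (\<i> *s (J *v v)) \<le> norm v * K"
    using bounded_linear.pos_bounded[OF bounded_linear_matrix_vector[of J]]
    by (metis norm_scale_complex norm_ii mult_1)
  obtain K' where K': "0 < K'" "\<And>(A :: complex^'k^'k) (v :: complex^'k). norm (A *v v) \<le> norm A * norm v * K'"
    using bounded_bilinear.pos_bounded[OF bounded_bilinear_matrix_vector] by metis
  have r: "sq_integrable (lebesgue_on I) ?r"
    using w f unfolding w_def[symmetric]
    by (intro sq_integrable_diff sq_integrable_bounded_linear[OF bounded_linear_scaleR_right]
        sq_integrable_bounded_linear[OF bounded_linear_matrix_vector])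
  \<comment> \<open>Up to constants, \<open>norm (?r t)\<close> becomes the inhomogeneity and
    \<open>norm (P t)\<close> the coefficient in \<open>AC_loc_bounded\<close>; both are square
    integrable.\<close>
  have bound: "norm (ddt f t) \<le> K * norm (?r t) + (K * K' * norm (P t)) * norm (f t)" for t
  proof -
    have "norm (ddt f t) \<le> norm (?r t - P t *v f t) * K" unfolding ddt_f by (rule K)
    also have "\<dots> \<le> (norm (?r t) + norm (P t) * norm (f t) * K') * K"
      using K(1) K'(2)[of "P t" "f t"] norm_triangle_ineq4[of "?r t" "P t *v f t"]
      by (intro mult_right_mono) auto
    finally show ?thesis by (simp add: algebra_simps)
  qed
  have sqn: "sq_integrable (lebesgue_on I) (\<lambda>t. c * norm (g t))"
    if "sq_integrable (lebesgue_on I) g" for c and g :: "real \<Rightarrow> 'z::euclidean_space"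
  proof -
    have "sq_integrable (lebesgue_on I) (\<lambda>t. norm (g t))"
      using that by (auto simp: sq_integrable_def intro: borel_measurable_norm)
    then show ?thesis by (rule sq_integrable_bounded_linear[OF bounded_linear_mult_right])
  qed
  obtain C where C: "\<And>t. t \<in> I \<Longrightarrow> norm (f t) \<le> C"
  proof (rule AC_loc_bounded[OF I ac f sqn[OF r] sqn[OF P]])
    show "AE t in lebesgue_on I. norm (ddt f t) \<le> K * norm (?r t) + (K * K' * norm (P t)) * norm (f t)"
      using bound by simp
    show "0 \<le> K * K' * norm (P t)" for t using K K' by simp
  qed (rule that)
  have "sq_integrable (lebesgue_on I) (\<lambda>t. P t *v f t)"
  proof (rule sq_integrable_bilinear_bounded[OF bounded_bilinear_matrix_vector P])
    show "AE t in lebesgue_on I. norm (f t) \<le> C" using C by (intro AE_I2) auto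
  qed (use f in \<open>simp add: sq_integrable_def\<close>)
  then have "sq_integrable (lebesgue_on I) (\<lambda>t. \<i> *s (J *v (?r t - P t *v f t)))"
    by (intro sq_integrable_bounded_linear[OF bounded_linear_scale]
        sq_integrable_bounded_linear[OF bounded_linear_matrix_vector] sq_integrable_diff r)
  then have "sq_integrable (lebesgue_on I) (ddt f)"
    unfolding ddt_f[symmetric, THEN ext[of "\<lambda>t. \<i> *s (J *v (?r t - P t *v f t))" "ddt f"]] .
  then show ?thesis using ac f by (simp add: H1_iff)
qed

section \<open>Ramp functions, integration by parts and symmetry\<close>

lemma lebesgue_on_UNIV [simp]: "lebesgue_on UNIV = (lebesgue :: 'a::euclidean_space measure)"
  by (rule measure_eqI) (auto simp: sets_restrict_space emeasure_restrict_space)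

lemma AC_loc_lipschitz:
  fixes f :: "real \<Rightarrow> 'a::metric_space"
  assumes "\<And>u v. dist (f u) (f v) \<le> L * \<bar>u - v\<bar>"
  shows "AC_loc I f"
proof -
  have "abs_cont_on a b (\<lambda>t::real. t)" for a b
    unfolding abs_cont_on_iff
  proof (intro allI impI exI conjI)
    fix e :: real and P assume "interval_family a b P" and len: "(\<Sum>(u, v)\<in>P. v - u) < e"
    then have "(\<Sum>(u, v)\<in>P. dist u v) = (\<Sum>(u, v)\<in>P. v - u)"
      by (intro sum.cong) (fastforce simp: interval_family_def dist_real_def)+
    then show "(\<Sum>(u, v)\<in>P. dist u v) < e" using len by simp
  qed simp
  then show ?thesis
    unfolding AC_loc_def
    using assms by (intro allI impI abs_cont_on_dominated[of _ _ "\<lambda>t::real. t" f L]) (simp_all only: dist_real_def)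
qed

text \<open>A climb from 0 at \<open>c\<close> to 1 at \<open>c + 1 / r\<close>. Differences of two
  ramps are the cutoffs and the trapezoidal test functions, and integrating against the derivative
  of a ramp averages over an interval of length \<open>1 / r\<close>.\<close>

definition ramp :: "real \<Rightarrow> real \<Rightarrow> real \<Rightarrow> real" where
  "ramp r c t = max 0 (min 1 (r * (t - c)))"

lemma ramp_lipschitz: "0 \<le> r \<Longrightarrow> \<bar>ramp r c s - ramp r c t\<bar> \<le> r * \<bar>s - t\<bar>"
proof -
  assume "0 \<le> r"
  have "\<bar>ramp r c s - ramp r c t\<bar> \<le> \<bar>r * (s - c) - r * (t - c)\<bar>"
    by (auto simp: ramp_def max_def min_def)
  also have "\<dots> = r * \<bar>s - t\<bar>" using \<open>0 \<le> r\<close> by (simp add: abs_mult flip: right_diff_distrib)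
  finally show ?thesis .
qed

lemma ramp_diff_lipschitz:
  "0 \<le> r \<Longrightarrow> \<bar>(ramp r a s - ramp r b s) - (ramp r a t - ramp r b t)\<bar> \<le> 2 * r * \<bar>s - t\<bar>"
  using ramp_lipschitz[of r a s t] ramp_lipschitz[of r b s t] by linarith

lemma ramp_below: "0 \<le> r \<Longrightarrow> t \<le> c \<Longrightarrow> ramp r c t = 0"
  using mult_nonneg_nonpos[of r "t - c"] by (simp add: ramp_def)

lemma ramp_above: "0 < r \<Longrightarrow> c + 1 / r \<le> t \<Longrightarrow> ramp r c t = 1"
  by (simp add: ramp_def field_simps)

lemma ramp_derivative:
  assumes r: "0 < r" and t: "t \<notin> {c, c + 1 / r}"
  shows "(ramp r c has_vector_derivative r * indicator {c<..<c + 1 / r} t) (at t)"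
proof -
  consider "t < c" | "t \<in> {c<..<c + 1 / r}" | "c + 1 / r < t" using t by fastforce
  then show ?thesis
  proof cases
    case 1
    have "((\<lambda>_. 0) has_vector_derivative (0::real)) (at t)" by (rule has_vector_derivative_const)
    then have "(ramp r c has_vector_derivative 0) (at t)"
      by (rule has_vector_derivative_transform_within_open[of _ _ _ "{..<c}"]) (use 1 r in \<open>auto simp: ramp_below\<close>)
    then show ?thesis using 1 by simp
  next
    case 2
    have "((\<lambda>t. r * (t - c)) has_vector_derivative r) (at t)"
      by (auto intro!: derivative_eq_intros simp flip: has_real_derivative_iff_has_vector_derivative)
    then have "(ramp r c has_vector_derivative r) (at t)"
      by (rule has_vector_derivative_transform_within_open[of _ _ _ "{c<..<c + 1 / r}"])
        (use 2 r in \<open>auto simp: ramp_def field_simps max_def min_def\<close>)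
    then show ?thesis using 2 by simp
  next
    case 3
    have "((\<lambda>_. 1) has_vector_derivative (0::real)) (at t)" by (rule has_vector_derivative_const)
    then have "(ramp r c has_vector_derivative 0) (at t)"
      by (rule has_vector_derivative_transform_within_open[of _ _ _ "{c + 1 / r<..}"]) (use 3 r in \<open>auto simp: ramp_above\<close>)
    then show ?thesis using 3 by simp
  qed
qed

lemma ramp_measurable: "ramp r c \<in> borel_measurable lebesgue"
proof (rule measurable_completion)
  show "ramp r c \<in> borel_measurable lborel" unfolding ramp_def[abs_def] by measurable
qed

text \<open>At \<open>t = c\<close> the limit is 0, so the difference of the ramps at
  \<open>a\<close> and at \<open>b\<close> tends to the indicator of the half-open interval
  \<open>{a<..b}\<close>.\<close>

lemma ramp_limit: "(\<lambda>k. ramp (real (Suc k)) c t) \<longlonglongrightarrow> indicator {c<..} t"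
proof (cases "c < t")
  case True
  then obtain k0 :: nat where k0: "1 / (t - c) \<le> real k0" using real_arch_simple by blast
  have "\<forall>\<^sub>F k in sequentially. ramp (real (Suc k)) c t = indicator {c<..} t"
  proof (rule eventually_sequentiallyI[of k0])
    fix k assume "k0 \<le> k"
    then have "1 / (t - c) \<le> real (Suc k)" using k0 by linarith
    then have "1 \<le> real (Suc k) * (t - c)" using True by (simp add: field_simps)
    then show "ramp (real (Suc k)) c t = indicator {c<..} t" using True by (simp add: ramp_def)
  qed
  then show ?thesis by (rule tendsto_eventually)
next
  case False
  then show ?thesis by (simp add: ramp_below)
qed

text \<open>The cut-off function \<kappa> q has compact support, so its derivative integrates to 0.
  In the limit only q' remains: the derivative of the cutoff is bounded and moves off to infinity,
  while \<open>q\<close> is integrable. This spares a proof that \<open>q\<close> itself tends to 0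
  at infinity.\<close>

lemma integral_ddt_eq_0:
  fixes q :: "real \<Rightarrow> 'a::euclidean_space"
  assumes ac: "AC_loc UNIV q" and q: "integrable lebesgue q" and dq: "integrable lebesgue (ddt q)"
  shows "(\<integral>t. ddt q t \<partial>lebesgue) = 0"
proof -
  define \<kappa> where "\<kappa> n t = ramp 1 (- real n - 1) t - ramp 1 (real n) t" for n :: nat and t
  define \<kappa>' :: "nat \<Rightarrow> real \<Rightarrow> real"
    where "\<kappa>' n t = indicator {- real n - 1<..<- real n} t - indicator {real n<..<real n + 1} t" for n t
  define p where "p n t = \<kappa> n t *\<^sub>R q t" for n t
  have \<kappa>1: "\<kappa> n t = 1" if "\<bar>t\<bar> \<le> real n" for n t
    using that by (auto simp: \<kappa>_def ramp_def)
  have \<kappa>0: "\<kappa> n t = 0" if "real n + 1 \<le> \<bar>t\<bar>" for n t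
    using that by (auto simp: \<kappa>_def ramp_def)
  have \<kappa>b: "\<bar>\<kappa> n t\<bar> \<le> 1" "\<bar>\<kappa>' n t\<bar> \<le> 1" for n t
    by (auto simp: \<kappa>_def \<kappa>'_def ramp_def indicator_def)
  have p_ac: "AC_loc UNIV (p n)" for n
  proof -
    have "\<bar>\<kappa> n u - \<kappa> n v\<bar> \<le> 2 * \<bar>u - v\<bar>" for u v
      using ramp_diff_lipschitz[of 1 "- real n - 1" u "real n" v] by (simp add: \<kappa>_def)
    then have "AC_loc UNIV (\<kappa> n)" by (intro AC_loc_lipschitz[of _ 2]) (simp add: dist_real_def)
    then show ?thesis unfolding p_def by (rule AC_loc_bilinear[OF bounded_bilinear_scaleR _ ac])
  qed
  have zero: "(\<integral>t. ddt (p n) t \<partial>lebesgue) = 0" for n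
  proof -
    \<comment> \<open>\<open>p n\<close> vanishes as soon as |t| is at least \<open>n + 1\<close>;
      one more unit makes it vanish near each point outside \<open>{- c..c}\<close>, so its
      derivative vanishes there too.\<close>
    define c where "c = real n + 2"
    have acc: "abs_cont_on (- c) c (p n)" "- c \<le> c" using p_ac[of n] by (auto simp: AC_loc_def c_def)
    have hi: "(ddt (p n) has_integral (p n c - p n (- c))) {- c..c}"
      using acc(2) by (intro abs_cont_on_has_integral_ddt[OF acc]) auto
    have "p n c = 0" "p n (- c) = 0" by (auto simp: p_def c_def \<kappa>0)
    then have "(\<integral>t. indicator {- c..c} t *\<^sub>R ddt (p n) t \<partial>lebesgue) = 0"
      using integral_indicator_interval(2)[OF abs_cont_on_ddt_integrable[OF acc] hi, of "{- c..c}"]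
      by (simp add: greaterThanLessThan_subseteq_atLeastAtMost_iff)
    moreover have "indicator {- c..c} t *\<^sub>R ddt (p n) t = ddt (p n) t" for t
    proof (cases "t \<in> {- c..c}")
      case False
      have "((\<lambda>_. 0) has_vector_derivative (0 :: 'a)) (at t)" by (rule has_vector_derivative_const)
      then have "(p n has_vector_derivative 0) (at t)"
        by (rule has_vector_derivative_transform_within_open[of _ _ _ "- {- (c - 1)..c - 1}"])
          (use False in \<open>auto simp: p_def c_def \<kappa>0\<close>)
      then show ?thesis using False by (simp add: vector_derivative_at)
    qed simp
    ultimately show ?thesis by simp
  qed
  \<comment> \<open>The kinks of all the cutoffs are integers, so one null set serves every
    \<open>n\<close>.\<close>
  have "AE t in lebesgue. t \<notin> (\<int> :: real set)"
    by (intro AE_not_in null_sets_completionI countable_imp_null_set_lborel) (simp add: Ints_def)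
  then have ae: "AE t in lebesgue. \<forall>n. ddt (p n) t = \<kappa> n t *\<^sub>R ddt q t + \<kappa>' n t *\<^sub>R q t"
    using AC_loc_AE_derivative[of UNIV q, OF disjI1[OF refl] ac, unfolded lebesgue_on_UNIV]
  proof eventually_elim
    case (elim t)
    show ?case
    proof
      fix n
      have "t \<notin> {- real n - 1, - real n - 1 + 1 / 1, real n, real n + 1 / 1}" using elim(1) by auto
      then have "(\<kappa> n has_vector_derivative 1 * indicator {- real n - 1<..<- real n - 1 + 1 / 1} t
          - 1 * indicator {real n<..<real n + 1 / 1} t) (at t)"
        unfolding \<kappa>_def by (intro has_vector_derivative_diff ramp_derivative) auto
      then have "(\<kappa> n has_vector_derivative \<kappa>' n t) (at t)" by (simp add: \<kappa>'_def)
      from bounded_bilinear.has_vector_derivative[OF bounded_bilinear_scaleR this elim(2)]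
      show "ddt (p n) t = \<kappa> n t *\<^sub>R ddt q t + \<kappa>' n t *\<^sub>R q t"
        unfolding p_def by (rule vector_derivative_at)
    qed
  qed
  have "(\<lambda>n. \<integral>t. ddt (p n) t \<partial>lebesgue) \<longlonglongrightarrow> (\<integral>t. ddt q t \<partial>lebesgue)"
  proof (rule integral_dominated_convergence[where w = "\<lambda>t. norm (ddt q t) + norm (q t)"])
    show "AE t in lebesgue. (\<lambda>n. ddt (p n) t) \<longlonglongrightarrow> ddt q t"
      using ae
    proof eventually_elim
      case (elim t)
      obtain k :: nat where "\<bar>t\<bar> \<le> real k" using real_arch_simple by blast
      then have "\<forall>\<^sub>F n in sequentially. ddt (p n) t = ddt q t"
        by (intro eventually_sequentiallyI[of k]) (auto simp: elim \<kappa>1 \<kappa>'_def indicator_def)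
      then show ?case by (rule tendsto_eventually)
    qed
    show "AE t in lebesgue. norm (ddt (p n) t) \<le> norm (ddt q t) + norm (q t)" for n
      using ae
    proof eventually_elim
      case (elim t)
      have "norm (ddt (p n) t) \<le> \<bar>\<kappa> n t\<bar> * norm (ddt q t) + \<bar>\<kappa>' n t\<bar> * norm (q t)"
        unfolding elim[rule_format] by (rule order_trans[OF norm_triangle_ineq]) simp
      also have "\<dots> \<le> 1 * norm (ddt q t) + 1 * norm (q t)"
        by (intro add_mono mult_right_mono \<kappa>b) auto
      finally show ?case by simp
    qed
    show "ddt (p n) \<in> borel_measurable lebesgue" for n
      using AC_loc_ddt_measurable[OF disjI1[OF refl] p_ac] by simp
  qed (use q dq in auto)
  then show ?thesis unfolding zero by (simp add: LIMSEQ_const_iff)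
qed

text \<open>The terms with \<open>B\<close> and \<open>P\<close> cancel because these matrices are
  Hermitian, and the two derivative terms combine to \<i> Q' with Q = f^* J g. Both Q and Q' are
  integrable, so there is no boundary contribution.\<close>

lemma dirac_symmetric:
  fixes f g :: "real \<Rightarrow> complex^'k"
  assumes J: "cadj J = J" and B: "cadj B = B"
    and f: "f \<in> H1 UNIV" and g: "g \<in> H1 UNIV"
    and P: "sq_integrable lebesgue P" and herm: "AE t in lebesgue. cadj (P t) = P t"
  shows "(\<integral>t. cdot (dirac_expr J B m f t + P t *v f t) (g t) \<partial>lebesgue) =
         (\<integral>t. cdot (f t) (dirac_expr J B m g t + P t *v g t) \<partial>lebesgue)"
proof -
  define w where "w h t = dirac_expr J B m h t + P t *v h t" for h t
  define Q where "Q t = cdot (f t) (J *v g t)" for t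
  have f': "AC_loc UNIV f" "sq_integrable lebesgue f" "sq_integrable lebesgue (ddt f)"
    and g': "AC_loc UNIV g" "sq_integrable lebesgue g" "sq_integrable lebesgue (ddt g)"
    using f g by (auto simp: H1_iff)
  have w: "sq_integrable lebesgue (w f)" "sq_integrable lebesgue (w g)"
    using dirac_expr_sq_integrable[of UNIV _ P J B m] f g P by (auto simp: w_def[abs_def])
  have Jint: "integrable lebesgue (\<lambda>t. cdot (u t) (J *v v t))"
    if "sq_integrable lebesgue u" "sq_integrable lebesgue v" for u v :: "real \<Rightarrow> complex^'k"
    using that by (intro integrable_bilinear_sq_integrable[OF bounded_bilinear_cdot]
        sq_integrable_bounded_linear[OF bounded_linear_matrix_vector])
  have Qac: "AC_loc UNIV Q"
    unfolding Q_def by (intro AC_loc_bilinear[OF bounded_bilinear_cdot]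
        AC_loc_bounded_linear[OF bounded_linear_matrix_vector] f' g')
  have dQ: "AE t in lebesgue. ddt Q t = cdot (f t) (J *v ddt g t) + cdot (ddt f t) (J *v g t)"
  proof -
    have "AE t in lebesgue. (f has_vector_derivative ddt f t) (at t)"
      "AE t in lebesgue. (g has_vector_derivative ddt g t) (at t)"
      using AC_loc_AE_derivative[of UNIV f] AC_loc_AE_derivative[of UNIV g] f' g'
      unfolding lebesgue_on_UNIV by blast+
    then show ?thesis
    proof eventually_elim
      case (elim t)
      have "(Q has_vector_derivative cdot (f t) (J *v ddt g t) + cdot (ddt f t) (J *v g t)) (at t)"
        unfolding Q_def
        by (intro bounded_bilinear.has_vector_derivative[OF bounded_bilinear_cdot]
            bounded_linear.has_vector_derivative[OF bounded_linear_matrix_vector] elim)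
      then show ?case by (rule vector_derivative_at)
    qed
  qed
  have Qint: "integrable lebesgue Q" unfolding Q_def by (intro Jint f' g')
  have dQm: "ddt Q \<in> borel_measurable lebesgue" using AC_loc_ddt_measurable[of UNIV Q] Qac by simp
  have dQi: "integrable lebesgue (ddt Q)"
  proof (rule integrable_cong_AE_imp)
    show "integrable lebesgue (\<lambda>t. cdot (f t) (J *v ddt g t) + cdot (ddt f t) (J *v g t))"
      by (intro Bochner_Integration.integrable_add Jint f' g')
  qed (use dQ dQm in \<open>auto simp: eq_commute\<close>)
  have eq: "AE t in lebesgue. cdot (w f t) (g t) - cdot (f t) (w g t) = \<i> * ddt Q t"
    using herm dQ
  proof eventually_elim
    case (elim t)
    have Jsym: "cdot (J *v u) v = cdot u (J *v v)" and Bsym: "cdot (B *v u) v = cdot u (B *v v)"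
      and Psym: "cdot (P t *v u) v = cdot u (P t *v v)" for u v
      using cdot_cadj[of J u v] cdot_cadj[of B u v] cdot_cadj[of "P t" u v] J B elim(1) by simp_all
    show ?case
      by (simp add: w_def dirac_expr_def elim(2) cdot_add_left cdot_add_right cdot_scale_left
          cdot_scale_right cdot_scaleR_left cdot_scaleR_right Jsym Bsym Psym algebra_simps
          cdot_minus_left cdot_minus_right cdot_diff_left cdot_diff_right)
  qed
  have wi: "integrable lebesgue (\<lambda>t. cdot (w f t) (g t))" "integrable lebesgue (\<lambda>t. cdot (f t) (w g t))"
    by (intro integrable_bilinear_sq_integrable[OF bounded_bilinear_cdot] w f' g')+
  have "(\<integral>t. cdot (w f t) (g t) \<partial>lebesgue) - (\<integral>t. cdot (f t) (w g t) \<partial>lebesgue) =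
      (\<integral>t. cdot (w f t) (g t) - cdot (f t) (w g t) \<partial>lebesgue)"
    using wi by simp
  also have "\<dots> = (\<integral>t. \<i> * ddt Q t \<partial>lebesgue)"
  proof (rule integral_cong_AE)
    show "(\<lambda>t. cdot (w f t) (g t) - cdot (f t) (w g t)) \<in> borel_measurable lebesgue"
      using wi by (intro borel_measurable_diff) auto
    show "(\<lambda>t. \<i> * ddt Q t) \<in> borel_measurable lebesgue"
      using dQm by (intro borel_measurable_times) auto
  qed (rule eq)
  also have "\<dots> = \<i> * (\<integral>t. ddt Q t \<partial>lebesgue)" by simp
  also have "\<dots> = 0" using integral_ddt_eq_0[OF Qac Qint dQi] by simp
  finally show ?thesis by (simp add: w_def)
qed

section \<open>Lipschitz test functions and density of H^1\<close>

lemma norm_ddt_le_lipschitz: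
  fixes f :: "real \<Rightarrow> 'a::real_normed_vector"
  assumes L: "\<And>u v. dist (f u) (f v) \<le> L * \<bar>u - v\<bar>" and f: "(f has_vector_derivative d) (at t)"
  shows "norm d \<le> L"
proof (rule field_le_epsilon)
  fix e :: real assume "e > 0"
  from f have "\<exists>\<delta>>0. \<forall>y. norm (y - t) < \<delta> \<longrightarrow> norm (f y - f t - (y - t) *\<^sub>R d) \<le> e * norm (y - t)"
    using \<open>e > 0\<close> unfolding has_vector_derivative_def has_derivative_at_alt by blast
  then obtain \<delta> where "\<delta> > 0" and \<delta>: "\<And>y. norm (y - t) < \<delta> \<Longrightarrow>
      norm (f y - f t - (y - t) *\<^sub>R d) \<le> e * norm (y - t)" by blast
  define h where "h = \<delta> / 2"
  have h: "h > 0" "h < \<delta>" using \<open>\<delta> > 0\<close> by (auto simp: h_def)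
  have "norm (h *\<^sub>R d) \<le> norm (f (t + h) - f t) + norm (f (t + h) - f t - h *\<^sub>R d)"
    using norm_triangle_ineq4[of "f (t + h) - f t" "f (t + h) - f t - h *\<^sub>R d"] by simp
  also have "\<dots> \<le> L * h + e * h"
    using L[of "t + h" t] \<delta>[of "t + h"] h by (simp add: dist_norm)
  finally have "h * norm d \<le> h * (L + e)" using h by (simp add: algebra_simps)
  then show "norm d \<le> L + e" using h by simp
qed

lemma sq_integrable_bounded_support:
  fixes f :: "real \<Rightarrow> 'a::euclidean_space"
  assumes "f \<in> borel_measurable lebesgue" "AE t in lebesgue. norm (f t) \<le> C * indicator {a..b} t"
  shows "sq_integrable lebesgue f"
proof (rule sq_integrable_bound)
  have "integrable lebesgue (\<lambda>t. indicator {a..b} t :: real)"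
    by (intro integrable_real_indicator) (auto simp: emeasure_lborel_Icc_eq)
  then show "sq_integrable lebesgue (\<lambda>t. indicator {a..b} t :: real)"
    by (simp add: sq_integrable_def power2_eq_square flip: indicator_inter_arith)
  show "AE t in lebesgue. norm (f t) \<le> C * norm (indicator {a..b} t :: real)"
    using assms(2) by simp
qed (rule assms(1))

lemma H1_lipschitz_bounded_support:
  fixes f :: "real \<Rightarrow> complex^'k"
  assumes L: "\<And>u v. dist (f u) (f v) \<le> L * \<bar>u - v\<bar>" and supp: "\<And>t. t \<notin> {a..b} \<Longrightarrow> f t = 0"
  shows "f \<in> H1 UNIV"
proof -
  have ac: "AC_loc UNIV f" using L by (rule AC_loc_lipschitz)
  then have fm: "f \<in> borel_measurable lebesgue" "ddt f \<in> borel_measurable lebesgue"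
    using AC_loc_measurable[of UNIV f] AC_loc_ddt_measurable[of UNIV f] by simp_all
  have "norm (f t) \<le> (L * (b - a + 1)) * indicator {a..b} t" for t
  proof (cases "t \<in> {a..b}")
    case True
    have "0 \<le> L" using L[of 0 1] order_trans[OF zero_le_dist] by simp
    \<comment> \<open>\<open>f\<close> vanishes at \<open>b + 1\<close>, which is at distance at
      most \<open>b - a + 1\<close> from \<open>t\<close>.\<close>
    have "norm (f t) \<le> L * \<bar>t - (b + 1)\<bar>" using L[of t "b + 1"] supp[of "b + 1"] by (simp add: dist_norm)
    also have "\<dots> \<le> L * (b - a + 1)" using True \<open>0 \<le> L\<close> by (intro mult_left_mono) auto
    finally show ?thesis using True by simp
  qed (use supp in simp)
  then have 1: "sq_integrable lebesgue f"
    by (intro sq_integrable_bounded_support[OF fm(1), of _ a b]) auto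
  have "AE t in lebesgue. norm (ddt f t) \<le> L * indicator {a..b} t"
    using AC_loc_AE_derivative[of UNIV f, OF disjI1[OF refl] ac, unfolded lebesgue_on_UNIV]
  proof eventually_elim
    case (elim t)
    show ?case
    proof (cases "t \<in> {a..b}")
      case True
      then show ?thesis using norm_ddt_le_lipschitz[OF L elim] by simp
    next
      case False
      have "((\<lambda>_. 0) has_vector_derivative 0) (at t)" by (rule has_vector_derivative_const)
      then have "(f has_vector_derivative 0) (at t)"
        by (rule has_vector_derivative_transform_within_open[of _ _ _ "- {a..b}"]) (use False supp in auto)
      then show ?thesis using False by (simp add: vector_derivative_at)
    qed
  qed
  then have "sq_integrable lebesgue (ddt f)"
    by (rule sq_integrable_bounded_support[OF fm(2)])
  with ac 1 show ?thesis by (simp add: H1_iff)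
qed

text \<open>Derivatives as limits of sequences, for use with dominated convergence and with the
  edges of trapezoids, whose widths are \<open>1 / real (Suc k)\<close>.\<close>

lemma has_vector_derivative_difference_quotient:
  fixes F :: "real \<Rightarrow> 'a::real_normed_vector"
  assumes F: "(F has_vector_derivative d) (at t)"
  shows "(\<lambda>k. real (Suc k) *\<^sub>R (F (t + 1 / real (Suc k)) - F t)) \<longlonglongrightarrow> d"
proof -
  have "((\<lambda>h. norm (F (t + h) - F t - h *\<^sub>R d) / norm h) \<longlongrightarrow> 0) (at 0)"
    using F by (simp add: has_vector_derivative_def has_derivative_at)
  moreover have "filterlim (\<lambda>k. 1 / real (Suc k)) (at 0) sequentially"
    unfolding filterlim_at using LIMSEQ_Suc[OF lim_1_over_n] by auto
  ultimately have "(\<lambda>k. norm (F (t + 1 / real (Suc k)) - F t - (1 / real (Suc k)) *\<^sub>R d) / norm (1 / real (Suc k))) \<longlonglongrightarrow> 0"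
    by (rule filterlim_compose)
  moreover have "norm (F (t + 1 / real (Suc k)) - F t - (1 / real (Suc k)) *\<^sub>R d) / norm (1 / real (Suc k))
      = norm (real (Suc k) *\<^sub>R (F (t + 1 / real (Suc k)) - F t) - d)" for k
  proof -
    have "real (Suc k) *\<^sub>R (F (t + 1 / real (Suc k)) - F t) - d
        = real (Suc k) *\<^sub>R (F (t + 1 / real (Suc k)) - F t - (1 / real (Suc k)) *\<^sub>R d)"
      by (simp add: scaleR_diff_right)
    then show ?thesis by simp
  qed
  ultimately have "(\<lambda>k. norm (real (Suc k) *\<^sub>R (F (t + 1 / real (Suc k)) - F t) - d)) \<longlonglongrightarrow> 0"
    by simp
  then show ?thesis by (rule LIM_zero_cancel[OF tendsto_norm_zero_cancel])
qed

text \<open>Used twice: to truncate a function, and to average a bounded one.\<close>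

lemma L2_dominated_approximation:
  fixes f :: "'a \<Rightarrow> 'b::euclidean_space"
  assumes meas: "f \<in> borel_measurable M" "\<And>n :: nat. s n \<in> borel_measurable M" and w: "integrable M w"
    and lim: "AE t in M. (\<lambda>n. s n t) \<longlonglongrightarrow> f t" and bound: "\<And>n t. (norm (f t - s n t))\<^sup>2 \<le> w t" and "0 < e"
  obtains n where "integrable M (\<lambda>t. (norm (f t - s n t))\<^sup>2)" "(\<integral>t. (norm (f t - s n t))\<^sup>2 \<partial>M) < e"
proof -
  note [measurable] = meas
  have sm: "(\<lambda>t. (norm (f t - s n t))\<^sup>2) \<in> borel_measurable M" for n by measurable
  have "(\<lambda>n. \<integral>t. (norm (f t - s n t))\<^sup>2 \<partial>M) \<longlonglongrightarrow> integral\<^sup>L M (\<lambda>t. 0)"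
  proof (rule integral_dominated_convergence[OF _ sm w])
    show "AE t in M. (\<lambda>n. (norm (f t - s n t))\<^sup>2) \<longlonglongrightarrow> 0"
      using lim
    proof eventually_elim
      case (elim t)
      have "(\<lambda>n. (norm (f t - s n t))\<^sup>2) \<longlonglongrightarrow> (norm (f t - f t))\<^sup>2"
        by (intro tendsto_intros elim)
      then show ?case by simp
    qed
  qed (use bound in auto)
  then have "(\<lambda>n. \<integral>t. (norm (f t - s n t))\<^sup>2 \<partial>M) \<longlonglongrightarrow> 0" by simp
  then have "\<forall>\<^sub>F n in sequentially. (\<integral>t. (norm (f t - s n t))\<^sup>2 \<partial>M) < e"
    using \<open>0 < e\<close> by (rule order_tendstoD(2))
  then obtain n where "(\<integral>t. (norm (f t - s n t))\<^sup>2 \<partial>M) < e" by (auto simp: eventually_sequentially)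
  moreover have "integrable M (\<lambda>t. (norm (f t - s n t))\<^sup>2)"
    by (rule Bochner_Integration.integrable_bound[OF w sm]) (use bound in \<open>auto intro: order_trans[OF _ abs_ge_self]\<close>)
  ultimately show thesis by (rule that[rotated])
qed

text \<open>The approximants are the Steklov averages of the function, which converge almost everywhere
  by Lebesgue's differentiation theorem.\<close>

lemma H1_approximates_bounded:
  fixes g :: "real \<Rightarrow> complex^'k"
  assumes gm: "g \<in> borel_measurable lebesgue" and gb: "\<And>t. norm (g t) \<le> N"
    and supp: "\<And>t. t \<notin> {- N..N} \<Longrightarrow> g t = 0" and "0 \<le> N" and "e > 0"
  obtains u where "u \<in> H1 UNIV" "integrable lebesgue (\<lambda>t. (norm (g t - u t))\<^sup>2)"
    "(\<integral>t. (norm (g t - u t))\<^sup>2 \<partial>lebesgue) < e"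
proof -
  have ind: "integrable lebesgue (\<lambda>t. c * indicator {a..b} t)" for a b c :: real
    by (intro integrable_mult_right integrable_real_indicator) (auto simp: emeasure_lborel_Icc_eq)
  have gi: "integrable lebesgue g"
    by (rule Bochner_Integration.integrable_bound[OF ind[of N "- N" N] gm])
      (use gb supp \<open>0 \<le> N\<close> in \<open>auto simp: indicator_def\<close>)
  have "g absolutely_integrable_on {a..b}" for a b
    unfolding set_integrable_def by (rule integrable_mult_indicator[OF _ gi]) simp
  from locally_integrable_primitive[OF this] obtain F where
    F: "\<And>a b. a \<le> b \<Longrightarrow> (g has_integral (F b - F a)) {a..b}"
    and F': "AE t in lebesgue. (F has_vector_derivative g t) (at t)" by metis
  \<comment> \<open>A bound for \<open>g\<close> is a Lipschitz constant of its primitive. Hence the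
    averages are bounded by the same \<open>N\<close> and are themselves Lipschitz.\<close>
  have lip1: "norm (F b - F a) \<le> N * (b - a)" if "a \<le> b" for a b
    using has_integral_bound_real[OF \<open>0 \<le> N\<close> finite.emptyI F[OF that]] gb that by simp
  have lip: "norm (F a - F b) \<le> N * \<bar>a - b\<bar>" for a b
    using lip1[of a b] lip1[of b a] by (cases "a \<le> b") (auto simp: norm_minus_commute)
  define u where "u k t = real (Suc k) *\<^sub>R (F (t + 1 / real (Suc k)) - F t)" for k t
  have ub: "norm (u k t) \<le> N" for k t
  proof -
    have "norm (u k t) = real (Suc k) * norm (F (t + 1 / real (Suc k)) - F t)"
      unfolding u_def norm_scaleR by simp
    also have "\<dots> \<le> real (Suc k) * (N * \<bar>t + 1 / real (Suc k) - t\<bar>)"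
      by (intro mult_left_mono lip) simp
    finally show ?thesis by simp
  qed
  \<comment> \<open>The average at \<open>t\<close> looks ahead by at most 1, so the support can
    grow only to the left, by at most 1.\<close>
  have u0: "u k t = 0" if t: "t \<notin> {- N - 1..N}" for k t
  proof -
    have "1 / real (Suc k) \<le> 1" by simp
    then have "\<And>x. x \<in> {t..t + 1 / real (Suc k)} \<Longrightarrow> t \<le> x \<and> x \<le> t + 1"
      unfolding atLeastAtMost_iff by linarith
    then have "\<And>x. x \<in> {t..t + 1 / real (Suc k)} \<Longrightarrow> g x = 0"
      using t by (intro supp) fastforce
    then have "(g has_integral 0) {t..t + 1 / real (Suc k)}" by (rule has_integral_is_0)
    then show ?thesis
      using has_integral_unique[OF F[of t "t + 1 / real (Suc k)"]] by (simp add: u_def)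
  qed
  have uH1: "u k \<in> H1 UNIV" for k
  proof (rule H1_lipschitz_bounded_support[OF _ u0])
    fix s t
    have "u k s - u k t = real (Suc k) *\<^sub>R ((F (s + 1 / real (Suc k)) - F (t + 1 / real (Suc k))) - (F s - F t))"
      by (simp add: u_def algebra_simps)
    also have "norm \<dots> \<le> real (Suc k) * (norm (F (s + 1 / real (Suc k)) - F (t + 1 / real (Suc k))) + norm (F s - F t))"
      unfolding norm_scaleR by (intro mult_mono norm_triangle_ineq4) auto
    also have "\<dots> \<le> real (Suc k) * (N * \<bar>s - t\<bar> + N * \<bar>s - t\<bar>)"
      using lip[of "s + 1 / real (Suc k)" "t + 1 / real (Suc k)"] lip[of s t]
      by (intro mult_left_mono add_mono) auto
    finally show "dist (u k s) (u k t) \<le> (real (Suc k) * (2 * N)) * \<bar>s - t\<bar>"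
      by (simp add: dist_norm algebra_simps)
  qed
  have um: "u k \<in> borel_measurable lebesgue" for k
    using AC_loc_measurable[of UNIV "u k"] uH1[of k] by (simp add: H1_iff)
  have bound: "(norm (g t - u k t))\<^sup>2 \<le> (2 * N)\<^sup>2 * indicator {- N - 1..N} t" for k t
  proof (cases "t \<in> {- N - 1..N}")
    case True
    have "norm (g t - u k t) \<le> 2 * N"
      using norm_triangle_ineq4[of "g t" "u k t"] gb[of t] ub[of k t] by simp
    then have "(norm (g t - u k t))\<^sup>2 \<le> (2 * N)\<^sup>2" by (intro power_mono) auto
    then show ?thesis using True by simp
  next
    case False
    then have "g t = 0" by (intro supp) auto
    then show ?thesis using u0[OF False] False by simp
  qed
  have "AE t in lebesgue. (\<lambda>k. u k t) \<longlonglongrightarrow> g t"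
    using F' unfolding u_def by eventually_elim (rule has_vector_derivative_difference_quotient)
  then obtain k where "integrable lebesgue (\<lambda>t. (norm (g t - u k t))\<^sup>2)"
    "(\<integral>t. (norm (g t - u k t))\<^sup>2 \<partial>lebesgue) < e"
    by (rule L2_dominated_approximation[OF gm um ind _ bound \<open>e > 0\<close>])
  then show thesis by (rule that[OF uH1])
qed

lemma H1_dense:
  fixes v :: "real \<Rightarrow> complex^'k"
  assumes v: "sq_integrable lebesgue v" and "e > 0"
  obtains u where "u \<in> H1 UNIV" "(\<integral>t. (norm (v t - u t))\<^sup>2 \<partial>lebesgue) < e"
proof -
  have vm: "v \<in> borel_measurable lebesgue" and vi: "integrable lebesgue (\<lambda>t. (norm (v t))\<^sup>2)"
    using v by (auto simp: sq_integrable_def)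
  \<comment> \<open>Truncation both in the argument and in the size of the values, so that one
    number \<open>n\<close> meets both bounds in \<open>H1_approximates_bounded\<close>.\<close>
  define g where "g n t = (if t \<in> {- real n..real n} \<and> norm (v t) \<le> real n then v t else 0)" for n t
  have gm: "g n \<in> borel_measurable lebesgue" for n
  proof -
    have "{t \<in> space lebesgue. norm (v t) \<le> real n} \<in> sets lebesgue"
      using vm by (intro borel_measurable_le borel_measurable_norm) auto
    then have "{t \<in> space lebesgue. norm (v t) \<le> real n} \<inter> {- real n..real n} \<in> sets lebesgue"
      by (rule sets.Int) simp
    moreover have "g n = (\<lambda>t. indicator ({t \<in> space lebesgue. norm (v t) \<le> real n} \<inter> {- real n..real n}) t *\<^sub>R v t)"
      by (auto simp: g_def indicator_def fun_eq_iff)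
    ultimately show ?thesis using vm by (simp add: borel_measurable_scaleR borel_measurable_indicator)
  qed
  have bound: "(norm (v t - g n t))\<^sup>2 \<le> (norm (v t))\<^sup>2" for n t
    by (simp add: g_def)
  have "(\<lambda>n. g n t) \<longlonglongrightarrow> v t" for t
  proof -
    obtain k :: nat where "max \<bar>t\<bar> (norm (v t)) \<le> real k" using real_arch_simple by blast
    then have "\<forall>\<^sub>F n in sequentially. g n t = v t"
      by (intro eventually_sequentiallyI[of k]) (auto simp: g_def)
    then show ?thesis by (rule tendsto_eventually)
  qed
  then have lim: "AE t in lebesgue. (\<lambda>n. g n t) \<longlonglongrightarrow> v t" by simp
  \<comment> \<open>The square of a sum is at most twice the sum of the squares, and there are two
    errors.\<close>
  have e4: "e / 4 > 0" using \<open>e > 0\<close> by simp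
  obtain n where ni: "integrable lebesgue (\<lambda>t. (norm (v t - g n t))\<^sup>2)"
    and n: "(\<integral>t. (norm (v t - g n t))\<^sup>2 \<partial>lebesgue) < e / 4"
    by (rule L2_dominated_approximation[OF vm gm vi lim bound e4])
  obtain u where u: "u \<in> H1 UNIV" "integrable lebesgue (\<lambda>t. (norm (g n t - u t))\<^sup>2)"
    "(\<integral>t. (norm (g n t - u t))\<^sup>2 \<partial>lebesgue) < e / 4"
    by (rule H1_approximates_bounded[OF gm _ _ _ e4, of n "real n"]) (auto simp: g_def)
  have "(\<integral>t. (norm (v t - u t))\<^sup>2 \<partial>lebesgue)
      \<le> (\<integral>t. 2 * (norm (v t - g n t))\<^sup>2 + 2 * (norm (g n t - u t))\<^sup>2 \<partial>lebesgue)"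
  proof (rule integral_mono)
    have "sq_integrable lebesgue u" using u(1) by (simp add: H1_iff)
    from sq_integrable_diff[OF v this] show "integrable lebesgue (\<lambda>t. (norm (v t - u t))\<^sup>2)"
      by (simp add: sq_integrable_def)
    show "integrable lebesgue (\<lambda>t. 2 * (norm (v t - g n t))\<^sup>2 + 2 * (norm (g n t - u t))\<^sup>2)"
      using ni u(2) by (intro Bochner_Integration.integrable_add integrable_mult_right)
    fix t
    have "(norm (v t - u t))\<^sup>2 \<le> (norm (v t - g n t) + norm (g n t - u t))\<^sup>2"
      using norm_triangle_ineq[of "v t - g n t" "g n t - u t"] by (intro power_mono) auto
    also have "\<dots> \<le> 2 * (norm (v t - g n t))\<^sup>2 + 2 * (norm (g n t - u t))\<^sup>2"
      using sum_squares_bound[of "norm (v t - g n t)" "norm (g n t - u t)"] by (simp add: power2_sum)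
    finally show "(norm (v t - u t))\<^sup>2 \<le> 2 * (norm (v t - g n t))\<^sup>2 + 2 * (norm (g n t - u t))\<^sup>2" .
  qed
  also have "\<dots> = 2 * (\<integral>t. (norm (v t - g n t))\<^sup>2 \<partial>lebesgue) + 2 * (\<integral>t. (norm (g n t - u t))\<^sup>2 \<partial>lebesgue)"
    using ni u(2) by simp
  also have "\<dots> < e" using n u(3) by simp
  finally show thesis using that u(1) by blast
qed

section \<open>Regularity of the adjoint domain\<close>

lemma sq_integrable_imp_locally_integrable:
  fixes f :: "real \<Rightarrow> 'a::euclidean_space"
  assumes f: "sq_integrable lebesgue f"
  shows "f absolutely_integrable_on {a..b}"
proof -
  have "integrable lebesgue (\<lambda>t. indicator {a..b} t :: real)"
    by (intro integrable_real_indicator) (auto simp: emeasure_lborel_Icc_eq)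
  then have "sq_integrable lebesgue (\<lambda>t. indicator {a..b} t :: real)"
    by (simp add: sq_integrable_def power2_eq_square flip: indicator_inter_arith)
  from integrable_bilinear_sq_integrable[OF bounded_bilinear_scaleR this f]
  show ?thesis by (simp add: set_integrable_def)
qed

text \<open>This is -\<i> J v' = G in integrated form, for a \<open>v\<close> not yet known to be
  differentiable. The test functions are a scalar trapezoid times a fixed vector \<open>e\<close>:
  as the edges steepen they average \<open>v\<close> near \<open>a\<close> and \<open>b\<close>,
  while the plateau integrates \<open>G\<close> between them. A class has no values at single
  points, so v(a) and v(b) enter as derivatives of the primitive \<open>V\<close>.\<close>

lemma dirac_adjoint_increment:
  fixes v w :: "real \<Rightarrow> complex^'k"
  assumes J: "cadj J = J" and B: "cadj B = B"
    and P: "sq_integrable lebesgue P" and herm: "AE t in lebesgue. cadj (P t) = P t"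
    and v: "sq_integrable lebesgue v" and w: "sq_integrable lebesgue w"
    and tested: "\<And>u. u \<in> H1 UNIV \<Longrightarrow>
      (\<integral>t. cdot (dirac_expr J B m u t + P t *v u t) (v t) \<partial>lebesgue) = (\<integral>t. cdot (u t) (w t) \<partial>lebesgue)"
    and V: "\<And>a b. a \<le> b \<Longrightarrow> (v has_integral (V b - V a)) {a..b}"
    and G_def: "G = (\<lambda>t. w t - m *\<^sub>R (B *v v t) - P t *v v t)" and G: "\<And>a b. G absolutely_integrable_on {a..b}"
    and \<Gamma>: "\<And>a b. a \<le> b \<Longrightarrow> (G has_integral (\<Gamma> b - \<Gamma> a)) {a..b}"
    and Va: "(V has_vector_derivative v a) (at a)" and Vb: "(V has_vector_derivative v b) (at b)"
    and ab: "a < b"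
  shows "\<Gamma> b - \<Gamma> a = \<i> *s (J *v (v a - v b))"
proof (rule cdot_ext)
  fix e :: "complex^'k"
  define L where "L x = cdot e (J *v x)" for x
  have L: "bounded_linear L"
    unfolding L_def by (rule bounded_linear_compose[OF
      bounded_bilinear.bounded_linear_right[OF bounded_bilinear_cdot] bounded_linear_matrix_vector])
  have E: "bounded_linear (cdot e)"
    by (rule bounded_bilinear.bounded_linear_right[OF bounded_bilinear_cdot])
  have vloc: "v absolutely_integrable_on {c..d}" for c d
    by (rule sq_integrable_imp_locally_integrable[OF v])
  have int_v: "integrable lebesgue (\<lambda>t. indicator {c<..<d} t *\<^sub>R v t)"
    "(\<integral>t. indicator {c<..<d} t *\<^sub>R v t \<partial>lebesgue) = V d - V c" if "c \<le> d" for c d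
    by (rule integral_indicator_interval[OF vloc V[OF that]]; auto)+
  have G_int: "integrable lebesgue (\<lambda>t. indicator {a<..b} t *\<^sub>R G t)"
    "(\<integral>t. indicator {a<..b} t *\<^sub>R G t \<partial>lebesgue) = \<Gamma> b - \<Gamma> a"
    by (rule integral_indicator_interval[OF G \<Gamma>[OF less_imp_le[OF ab]]]; auto)+
  have Gm: "G \<in> borel_measurable lebesgue"
    unfolding G_def using v w P
    by (intro borel_measurable_diff borel_measurable_bounded_linear[OF bounded_linear_scaleR_right]
        borel_measurable_bounded_linear[OF bounded_linear_matrix_vector] borel_measurable_matrix_vector)
      (auto simp: sq_integrable_def)
  \<comment> \<open>A trapezoid that rises just to the right of \<open>a\<close> and falls just to
    the right of \<open>b\<close>, with edges of width 1/(k + 1).\<close>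
  define \<phi> where "\<phi> k t = ramp (real (Suc k)) a t - ramp (real (Suc k)) b t" for k t
  \<comment> \<open>The tested identity with everything undifferentiated collected in
    \<open>G\<close>: integrating \<open>v\<close> against the slopes of the edges gives difference
    quotients of \<open>V\<close>.\<close>
  have key: "\<i> * (L (real (Suc k) *\<^sub>R (V (a + 1 / real (Suc k)) - V a)) - L (real (Suc k) *\<^sub>R (V (b + 1 / real (Suc k)) - V b)))
      = (\<integral>t. \<phi> k t *\<^sub>R cdot e (G t) \<partial>lebesgue)" for k
  proof -
    define r where "r = real (Suc k)"
    have r: "r > 0" "1 / r \<le> 1" by (auto simp: r_def)
    define u where "u t = \<phi> k t *\<^sub>R e" for t
    \<comment> \<open>The derivative of the trapezoid away from its four kinks.\<close>
    define \<psi> where "\<psi> t = r * indicator {a<..<a + 1 / r} t - r * indicator {b<..<b + 1 / r} t" for t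
    have u: "u \<in> H1 UNIV"
    proof (rule H1_lipschitz_bounded_support)
      fix s t
      have "\<bar>\<phi> k s - \<phi> k t\<bar> \<le> 2 * r * \<bar>s - t\<bar>"
        using ramp_diff_lipschitz[OF less_imp_le[OF r(1)], of a s b t] by (simp only: \<phi>_def r_def)
      then have "\<bar>\<phi> k s - \<phi> k t\<bar> * norm e \<le> 2 * r * \<bar>s - t\<bar> * norm e" by (rule mult_right_mono) simp
      then show "dist (u s) (u t) \<le> (2 * r * norm e) * \<bar>s - t\<bar>"
        by (simp add: u_def dist_norm mult_ac flip: scaleR_diff_left)
    next
      fix t assume "t \<notin> {a..b + 1}"
      then have "ramp r a t = ramp r b t"
        using ramp_below[of r t a] ramp_below[of r t b] ramp_above[of r a t] ramp_above[of r b t] r ab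
        by (cases "t < a") auto
      then show "u t = 0" by (simp add: u_def \<phi>_def r_def)
    qed
    have "AE t in lebesgue. t \<notin> {a, a + 1 / r, b, b + 1 / r}"
      by (rule AE_not_in_negligible) simp
    then have du: "AE t in lebesgue. ddt u t = \<psi> t *\<^sub>R e"
    proof eventually_elim
      case (elim t)
      then have "((\<lambda>t. ramp r a t - ramp r b t) has_vector_derivative \<psi> t) (at t)"
        unfolding \<psi>_def using r by (intro has_vector_derivative_diff ramp_derivative) auto
      then have "(u has_vector_derivative \<psi> t *\<^sub>R e) (at t)"
        unfolding u_def \<phi>_def r_def[symmetric]
        by (rule bounded_linear.has_vector_derivative[OF bounded_linear_scaleR_left])
      then show ?case by (rule vector_derivative_at)
    qed
    have u': "sq_integrable lebesgue u" using u by (simp add: H1_iff)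
    have i1: "integrable lebesgue (\<lambda>t. cdot (dirac_expr J B m u t + P t *v u t) (v t))"
      using dirac_expr_sq_integrable[of UNIV u P J B m] u P v
      by (intro integrable_bilinear_sq_integrable[OF bounded_bilinear_cdot]) auto
    have i2: "integrable lebesgue (\<lambda>t. cdot (u t) (w t))"
      by (intro integrable_bilinear_sq_integrable[OF bounded_bilinear_cdot] u' w)
    have le: "a \<le> a + 1 / r" "b \<le> b + 1 / r" using r by auto
    have i\<psi>: "integrable lebesgue (\<lambda>t. \<psi> t *\<^sub>R v t)"
      "(\<integral>t. \<psi> t *\<^sub>R v t \<partial>lebesgue) = r *\<^sub>R (V (a + 1 / r) - V a) - r *\<^sub>R (V (b + 1 / r) - V b)"
    proof -
      have eq: "(\<lambda>t. \<psi> t *\<^sub>R v t) = (\<lambda>t. r *\<^sub>R (indicator {a<..<a + 1 / r} t *\<^sub>R v t)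
          - r *\<^sub>R (indicator {b<..<b + 1 / r} t *\<^sub>R v t))"
        by (simp add: \<psi>_def scaleR_diff_left)
      show "integrable lebesgue (\<lambda>t. \<psi> t *\<^sub>R v t)"
        unfolding eq by (intro Bochner_Integration.integrable_diff integrable_scaleR_right int_v le)
      show "(\<integral>t. \<psi> t *\<^sub>R v t \<partial>lebesgue) = r *\<^sub>R (V (a + 1 / r) - V a) - r *\<^sub>R (V (b + 1 / r) - V b)"
        unfolding eq
        by (simp only: Bochner_Integration.integral_diff integral_scaleR_right integrable_scaleR_right
            int_v(1)[OF le(1)] int_v(1)[OF le(2)] int_v(2)[OF le(1)] int_v(2)[OF le(2)])
    qed
    have ae: "AE t in lebesgue. cdot (u t) (w t) - cdot (dirac_expr J B m u t + P t *v u t) (v t)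
        = \<phi> k t *\<^sub>R cdot e (G t) - \<i> * L (\<psi> t *\<^sub>R v t)"
      using herm du
    proof eventually_elim
      case (elim t)
      have Jsym: "cdot (J *v x) y = cdot x (J *v y)" and Bsym: "cdot (B *v x) y = cdot x (B *v y)"
        and Psym: "cdot (P t *v x) y = cdot x (P t *v y)" for x y
        using cdot_cadj[of J x y] cdot_cadj[of B x y] cdot_cadj[of "P t" x y] J B elim(1) by simp_all
      show ?case
        unfolding dirac_expr_def elim(2) L_def G_def
        by (simp add: u_def cdot_add_left cdot_add_right cdot_scale_left
          cdot_scale_right cdot_scaleR_left cdot_scaleR_right Jsym Bsym Psym
          cdot_minus_left cdot_minus_right cdot_diff_left cdot_diff_right
          matrix_vector_mult_scaleR_complex algebra_simps scaleR_conv_of_real[where 'a = complex])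
    qed
    have Li: "integrable lebesgue (\<lambda>t. \<i> * L (\<psi> t *\<^sub>R v t))"
      by (intro integrable_mult_right integrable_bounded_linear[OF L] i\<psi>)
    \<comment> \<open>Integrability of the pairing with \<open>G\<close> is read off from the
      identity \<open>ae\<close>, whose left side consists of two integrable pairings.\<close>
    have "integrable lebesgue (\<lambda>t. \<phi> k t *\<^sub>R cdot e (G t) - \<i> * L (\<psi> t *\<^sub>R v t))"
    proof (rule integrable_cong_AE_imp)
      show "integrable lebesgue (\<lambda>t. cdot (u t) (w t) - cdot (dirac_expr J B m u t + P t *v u t) (v t))"
        by (intro Bochner_Integration.integrable_diff i1 i2)
      have "ramp r c \<in> borel_measurable lebesgue" for c
        by (rule ramp_measurable)
      then show "(\<lambda>t. \<phi> k t *\<^sub>R cdot e (G t) - \<i> * L (\<psi> t *\<^sub>R v t)) \<in> borel_measurable lebesgue"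
        using Li unfolding \<phi>_def r_def[symmetric]
        by (intro borel_measurable_diff borel_measurable_scaleR borel_measurable_bounded_linear[OF E Gm])
          (auto simp: borel_measurable_integrable)
    qed (use ae in \<open>auto simp: eq_commute\<close>)
    from Bochner_Integration.integrable_add[OF this Li]
    have Gi: "integrable lebesgue (\<lambda>t. \<phi> k t *\<^sub>R cdot e (G t))" by simp
    have "(\<integral>t. \<phi> k t *\<^sub>R cdot e (G t) \<partial>lebesgue) - (\<integral>t. \<i> * L (\<psi> t *\<^sub>R v t) \<partial>lebesgue)
        = (\<integral>t. \<phi> k t *\<^sub>R cdot e (G t) - \<i> * L (\<psi> t *\<^sub>R v t) \<partial>lebesgue)"
      using Gi Li by simp
    also have "\<dots> = (\<integral>t. cdot (u t) (w t) - cdot (dirac_expr J B m u t + P t *v u t) (v t) \<partial>lebesgue)"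
    proof (rule integral_cong_AE)
      show "(\<lambda>t. \<phi> k t *\<^sub>R cdot e (G t) - \<i> * L (\<psi> t *\<^sub>R v t)) \<in> borel_measurable lebesgue"
        using Bochner_Integration.integrable_diff[OF Gi Li] by (rule borel_measurable_integrable)
      show "(\<lambda>t. cdot (u t) (w t) - cdot (dirac_expr J B m u t + P t *v u t) (v t)) \<in> borel_measurable lebesgue"
        using Bochner_Integration.integrable_diff[OF i2 i1] by (rule borel_measurable_integrable)
    qed (use ae in \<open>auto simp: eq_commute\<close>)
    also have "\<dots> = 0" using i1 i2 tested[OF u] by simp
    finally have "(\<integral>t. \<phi> k t *\<^sub>R cdot e (G t) \<partial>lebesgue) = (\<integral>t. \<i> * L (\<psi> t *\<^sub>R v t) \<partial>lebesgue)" by simp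
    also have "\<dots> = \<i> * L (\<integral>t. \<psi> t *\<^sub>R v t \<partial>lebesgue)"
      using integral_bounded_linear[OF L i\<psi>(1)] by simp
    also have "\<dots> = \<i> * (L (r *\<^sub>R (V (a + 1 / r) - V a)) - L (r *\<^sub>R (V (b + 1 / r) - V b)))"
      by (simp only: i\<psi>(2) linear_diff[OF bounded_linear.linear[OF L]])
    finally show ?thesis by (simp only: r_def)
  qed
  have "(\<lambda>k. \<integral>t. \<phi> k t *\<^sub>R cdot e (G t) \<partial>lebesgue) \<longlonglongrightarrow> (\<integral>t. indicator {a<..b} t *\<^sub>R cdot e (G t) \<partial>lebesgue)"
  \<comment> \<open>The falling edge reaches at most 1 beyond \<open>b\<close>, so
    \<open>{a..b + 1}\<close> contains the trapezoids for all \<open>k\<close>.\<close>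
  proof (rule integral_dominated_convergence[where w = "\<lambda>t. norm (cdot e (indicator {a..b + 1} t *\<^sub>R G t))"])
    show "AE t in lebesgue. (\<lambda>k. \<phi> k t *\<^sub>R cdot e (G t)) \<longlonglongrightarrow> indicator {a<..b} t *\<^sub>R cdot e (G t)"
    proof (rule AE_I2)
      fix t
      have "(\<lambda>k. \<phi> k t *\<^sub>R cdot e (G t)) \<longlonglongrightarrow> (indicator {a<..} t - indicator {b<..} t) *\<^sub>R cdot e (G t)"
        unfolding \<phi>_def by (intro tendsto_intros ramp_limit)
      also have "indicator {a<..} t - indicator {b<..} t = (indicator {a<..b} t :: real)"
        using ab by (auto simp: indicator_def)
      finally show "(\<lambda>k. \<phi> k t *\<^sub>R cdot e (G t)) \<longlonglongrightarrow> indicator {a<..b} t *\<^sub>R cdot e (G t)" .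
    qed
    show "AE t in lebesgue. norm (\<phi> k t *\<^sub>R cdot e (G t)) \<le> norm (cdot e (indicator {a..b + 1} t *\<^sub>R G t))" for k
    proof (rule AE_I2)
      fix t
      have b01: "0 \<le> ramp (real (Suc k)) c t" "ramp (real (Suc k)) c t \<le> 1" for c by (auto simp: ramp_def)
      have "\<bar>\<phi> k t\<bar> \<le> indicator {a..b + 1} t"
      proof (cases "t \<in> {a..b + 1}")
        case True
        then show ?thesis using b01[of a] b01[of b] by (simp add: \<phi>_def)
      next
        case False
        have le1: "1 / real (Suc k) \<le> 1" by simp
        have "ramp (real (Suc k)) a t = ramp (real (Suc k)) b t"
        proof (cases "t < a")
          case True
          then show ?thesis using ab ramp_below[of "real (Suc k)" t a] ramp_below[of "real (Suc k)" t b] by simp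
        next
          case nless: False
          then have "b + 1 < t" using False by auto
          then have "a + 1 / real (Suc k) \<le> t" "b + 1 / real (Suc k) \<le> t" using le1 ab by linarith+
          then show ?thesis
            using ramp_above[of "real (Suc k)" a t] ramp_above[of "real (Suc k)" b t] by simp
        qed
        then show ?thesis by (simp add: \<phi>_def)
      qed
      then have "\<bar>\<phi> k t\<bar> * norm (cdot e (G t)) \<le> indicator {a..b + 1} t * norm (cdot e (G t))"
        by (rule mult_right_mono) simp
      then show "norm (\<phi> k t *\<^sub>R cdot e (G t)) \<le> norm (cdot e (indicator {a..b + 1} t *\<^sub>R G t))"
        by (simp add: cdot_scaleR_right)
    qed
    have "integrable lebesgue (\<lambda>t. indicator {a..b + 1} t *\<^sub>R G t)"
      using G[of a "b + 1"] by (simp add: set_integrable_def)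
    then show "integrable lebesgue (\<lambda>t. norm (cdot e (indicator {a..b + 1} t *\<^sub>R G t)))"
      by (intro integrable_norm integrable_bounded_linear[OF E])
    have cG: "(\<lambda>t. cdot e (G t)) \<in> borel_measurable lebesgue" by (rule borel_measurable_bounded_linear[OF E Gm])
    show "(\<lambda>t. indicator {a<..b} t *\<^sub>R cdot e (G t)) \<in> borel_measurable lebesgue"
      by (intro borel_measurable_scaleR borel_measurable_indicator cG) simp
    have "ramp r c \<in> borel_measurable lebesgue" for r c
      by (rule ramp_measurable)
    then show "(\<lambda>t. \<phi> k t *\<^sub>R cdot e (G t)) \<in> borel_measurable lebesgue" for k
      unfolding \<phi>_def by (intro borel_measurable_scaleR borel_measurable_diff cG)
  qed
  moreover have "(\<integral>t. indicator {a<..b} t *\<^sub>R cdot e (G t) \<partial>lebesgue) = cdot e (\<Gamma> b - \<Gamma> a)"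
    using integral_bounded_linear[OF E G_int(1)] G_int(2) by (simp add: cdot_scaleR_right)
  ultimately have "(\<lambda>k. \<integral>t. \<phi> k t *\<^sub>R cdot e (G t) \<partial>lebesgue) \<longlonglongrightarrow> cdot e (\<Gamma> b - \<Gamma> a)" by simp
  moreover have "(\<lambda>k. \<integral>t. \<phi> k t *\<^sub>R cdot e (G t) \<partial>lebesgue) \<longlonglongrightarrow> \<i> * (L (v a) - L (v b))"
    unfolding key[symmetric]
    by (intro tendsto_intros bounded_linear.tendsto[OF L] has_vector_derivative_difference_quotient Va Vb)
  ultimately have "cdot e (\<Gamma> b - \<Gamma> a) = \<i> * (L (v a) - L (v b))"
    by (rule LIMSEQ_unique)
  then show "cdot e (\<Gamma> b - \<Gamma> a) = cdot e (\<i> *s (J *v (v a - v b)))"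
    by (simp add: L_def cdot_scale_right matrix_vector_mult_diff_distrib cdot_diff_right right_diff_distrib)
qed

text \<open>The increment formula holds between any two points outside one null set. Starting at
  such a point \<open>a0\<close> and integrating \<i> J G therefore yields a locally absolutely
  continuous \<open>y\<close> equal to \<open>v\<close> off the null set, and
  \<open>H1_of_dirac_expr\<close> puts it into H^1.\<close>

lemma dirac_adjoint_regular:
  fixes v w :: "real \<Rightarrow> complex^'k"
  assumes J: "cadj J = J" "J ** J = mat 1" and B: "cadj B = B"
    and P: "sq_integrable lebesgue P" and herm: "AE t in lebesgue. cadj (P t) = P t"
    and v: "sq_integrable lebesgue v" and w: "sq_integrable lebesgue w"
    and tested: "\<And>u. u \<in> H1 UNIV \<Longrightarrow>
      (\<integral>t. cdot (dirac_expr J B m u t + P t *v u t) (v t) \<partial>lebesgue) = (\<integral>t. cdot (u t) (w t) \<partial>lebesgue)"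
  obtains y where "y \<in> H1 UNIV" "AE t in lebesgue. y t = v t"
    "AE t in lebesgue. dirac_expr J B m y t + P t *v y t = w t"
proof -
  define G where "G t = w t - m *\<^sub>R (B *v v t) - P t *v v t" for t
  have G_eq: "G = (\<lambda>t. w t - m *\<^sub>R (B *v v t) - P t *v v t)" by (simp add: G_def fun_eq_iff)
  have Gloc: "G absolutely_integrable_on {a..b}" for a b
  proof -
    have "integrable lebesgue (\<lambda>t. P t *v v t)"
      by (rule integrable_bilinear_sq_integrable[OF bounded_bilinear_matrix_vector P v])
    then have "(\<lambda>t. P t *v v t) absolutely_integrable_on {a..b}"
      unfolding set_integrable_def by (intro integrable_mult_indicator) auto
    moreover have "sq_integrable lebesgue (\<lambda>t. w t - m *\<^sub>R (B *v v t))"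
      using w v by (intro sq_integrable_diff sq_integrable_bounded_linear[OF bounded_linear_scaleR_right]
        sq_integrable_bounded_linear[OF bounded_linear_matrix_vector])
    ultimately show ?thesis
      unfolding G_def using sq_integrable_imp_locally_integrable set_integral_diff(1) by blast
  qed
  have vloc: "v absolutely_integrable_on {a..b}" for a b
    by (rule sq_integrable_imp_locally_integrable[OF v])
  obtain V where V: "\<And>a b. a \<le> b \<Longrightarrow> (v has_integral (V b - V a)) {a..b}"
    and V': "AE t in lebesgue. (V has_vector_derivative v t) (at t)"
    using locally_integrable_primitive[OF vloc] by metis
  obtain \<Gamma> where \<Gamma>: "\<And>a b. a \<le> b \<Longrightarrow> (G has_integral (\<Gamma> b - \<Gamma> a)) {a..b}"
    and \<Gamma>ac: "AC_loc UNIV \<Gamma>" and \<Gamma>': "AE t in lebesgue. (\<Gamma> has_vector_derivative G t) (at t)"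
    using locally_integrable_primitive[OF Gloc] by metis
  obtain N where N: "N \<in> null_sets lebesgue" and VN: "\<And>t. t \<notin> N \<Longrightarrow> (V has_vector_derivative v t) (at t)"
    using V' by (auto elim!: AE_E3)
  have "N \<noteq> UNIV" using N by (auto simp: null_sets_def)
  then obtain a0 where a0: "a0 \<notin> N" by blast
  have inc: "\<Gamma> b - \<Gamma> a = \<i> *s (J *v (v a - v b))" if "a < b" "a \<notin> N" "b \<notin> N" for a b
    by (rule dirac_adjoint_increment[OF J(1) B P herm v w tested V G_eq Gloc \<Gamma> VN[OF that(2)] VN[OF that(3)] that(1)])
  have JJ: "J *v (J *v x) = x" for x using J(2) by (simp add: matrix_vector_mul_assoc)
  \<comment> \<open>The increment formula solved for v(t) by J^2 = I, with \<open>a0\<close> as base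
    point; unlike \<open>v\<close>, the right-hand side is regular for every
    \<open>t\<close>.\<close>
  define y where "y t = v a0 + \<i> *s (J *v (\<Gamma> t - \<Gamma> a0))" for t
  have yv: "y t = v t" if t: "t \<notin> N" for t
  proof -
    have "\<Gamma> t - \<Gamma> a0 = \<i> *s (J *v (v a0 - v t))"
    proof (cases t a0 rule: linorder_cases)
      case less
      have "\<Gamma> t - \<Gamma> a0 = - (\<i> *s (J *v (v t - v a0)))" using inc[OF less t a0] by (metis minus_diff_eq)
      also have "\<dots> = \<i> *s (J *v (v a0 - v t))"
        by (simp add: matrix_vector_mult_diff_distrib scale_diff_complex)
      finally show ?thesis .
    next
      case equal
      then show ?thesis by simp
    next
      case greater
      then show ?thesis using inc t a0 by blast
    qed
    then show ?thesis
      by (simp add: y_def matrix_vector_mult_scale scale_scale_complex JJ)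
  qed
  have "AE t in lebesgue. t \<notin> N" using N by (rule AE_not_in)
  then have ae1: "AE t in lebesgue. y t = v t" by eventually_elim (rule yv)
  have yac: "AC_loc UNIV y"
  proof -
    have "AC_loc UNIV (\<lambda>t. (v a0 - \<i> *s (J *v \<Gamma> a0)) + \<i> *s (J *v \<Gamma> t))"
      by (intro AC_loc_add AC_loc_const AC_loc_bounded_linear[OF bounded_linear_scale]
          AC_loc_bounded_linear[OF bounded_linear_matrix_vector] \<Gamma>ac)
    then show ?thesis
      by (rule AC_loc_cong) (simp add: y_def matrix_vector_mult_diff_distrib scale_diff_complex)
  qed
  have ae2: "AE t in lebesgue. dirac_expr J B m y t + P t *v y t = w t"
    using ae1 \<Gamma>'
  proof eventually_elim
    case (elim t)
    have "(y has_vector_derivative 0 + \<i> *s (J *v (G t - 0))) (at t)"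
      unfolding y_def
      by (intro has_vector_derivative_add has_vector_derivative_const
          bounded_linear.has_vector_derivative[OF bounded_linear_scale]
          bounded_linear.has_vector_derivative[OF bounded_linear_matrix_vector] has_vector_derivative_diff elim(2))
    then have "ddt y t = \<i> *s (J *v G t)" by (simp add: vector_derivative_at)
    then show ?case
      unfolding dirac_expr_def elim(1)
      by (simp add: matrix_vector_mult_scale scale_scale_complex JJ) (simp add: G_def)
  qed
  have ym: "y \<in> borel_measurable lebesgue"
    using AC_loc_measurable[of UNIV y] yac by simp
  have ysq: "sq_integrable lebesgue y"
  proof (rule sq_integrable_bound[OF v ym, of 1])
    show "AE t in lebesgue. norm (y t) \<le> 1 * norm (v t)" using ae1 by eventually_elim simp
  qed
  have "sq_integrable lebesgue (\<lambda>t. dirac_expr J B m y t + P t *v y t)"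
  proof (rule sq_integrable_bound[OF w, of _ 1])
    show "AE t in lebesgue. norm (dirac_expr J B m y t + P t *v y t) \<le> 1 * norm (w t)"
      using ae2 by eventually_elim simp
    show "(\<lambda>t. dirac_expr J B m y t + P t *v y t) \<in> borel_measurable lebesgue"
      using dirac_expr_measurable[of UNIV y P J B m] yac P by (simp add: sq_integrable_def)
  qed
  then have "y \<in> H1 UNIV"
    using H1_of_dirac_expr[of UNIV J y P B m] J(2) yac ysq P by simp
  then show thesis using ae1 ae2 that by blast
qed

section \<open>Classes of functions\<close>

text \<open>A difference that is nonzero at \<open>t\<close> is nonzero on some
  \<open>{t<..<t + \<delta>}\<close>, which is not null. Only the right side of \<open>t\<close> is
  used, so the endpoint 0 is covered and a class determines the endpoint value of its regular
  representative.\<close>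

lemma AC_loc_eq_of_AE_eq:
  fixes f g :: "real \<Rightarrow> 'a::euclidean_space"
  assumes I: "I = UNIV \<or> I = {0..}" and f: "AC_loc I f" and g: "AC_loc I g"
    and ae: "AE t in lebesgue_on I. f t = g t" and t: "t \<in> I"
  shows "f t = g t"
proof (rule ccontr)
  assume ne: "f t \<noteq> g t"
  have "continuous_on I (\<lambda>s. f s - g s)"
    by (intro continuous_intros AC_loc_continuous_on[OF I] f g)
  moreover have "0 < norm (f t - g t)" using ne by simp
  ultimately obtain \<delta> where "\<delta> > 0" and \<delta>: "\<And>s. s \<in> I \<Longrightarrow> dist s t < \<delta> \<Longrightarrow>
      dist (f s - g s) (f t - g t) < norm (f t - g t)"
    using t unfolding continuous_on_iff by metis
  have "AE s in lebesgue. s \<in> I \<longrightarrow> f s = g s"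
    using ae I by (subst (asm) AE_restrict_space_iff) auto
  then obtain N where N: "N \<in> null_sets lebesgue" "\<And>s. s \<notin> N \<Longrightarrow> s \<in> I \<Longrightarrow> f s = g s"
    by (auto elim!: AE_E3)
  have "{t<..<t + \<delta>} \<subseteq> N"
  proof
    fix s assume s: "s \<in> {t<..<t + \<delta>}"
    then have "s \<in> I" using t I by auto
    then have "f s - g s \<noteq> 0" using \<delta>[of s] s by (auto simp: dist_norm norm_minus_commute)
    then show "s \<in> N" using N(2) \<open>s \<in> I\<close> by auto
  qed
  then have "{t<..<t + \<delta>} \<in> null_sets lebesgue"
    by (metis N(1) null_sets_completion_subset)
  then show False using \<open>\<delta> > 0\<close> by (simp add: null_sets_def emeasure_lborel_Ioo)
qed

lemma mem_cls:
  "g \<in> cls I f \<longleftrightarrow> f \<in> borel_measurable (lebesgue_on I) \<and> g \<in> borel_measurable (lebesgue_on I) \<and>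
     (AE t in lebesgue_on I. f t = g t)"
  by (simp add: cls_def ae_rel_def)

lemma self_mem_cls: "f \<in> borel_measurable (lebesgue_on I) \<Longrightarrow> f \<in> cls I f"
  by (simp add: mem_cls)

lemma cls_eq_iff:
  assumes "f \<in> borel_measurable (lebesgue_on I)" "g \<in> borel_measurable (lebesgue_on I)"
  shows "cls I f = cls I g \<longleftrightarrow> (AE t in lebesgue_on I. f t = g t)"
proof
  assume "cls I f = cls I g"
  then show "AE t in lebesgue_on I. f t = g t"
    using self_mem_cls[OF assms(2)] mem_cls by metis
next
  assume ae: "AE t in lebesgue_on I. f t = g t"
  show "cls I f = cls I g"
  proof (rule set_eqI)
    fix h
    have "(AE t in lebesgue_on I. f t = h t) \<longleftrightarrow> (AE t in lebesgue_on I. g t = h t)"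
    proof
      assume "AE t in lebesgue_on I. f t = h t"
      with ae show "AE t in lebesgue_on I. g t = h t" by eventually_elim simp
    next
      assume "AE t in lebesgue_on I. g t = h t"
      with ae show "AE t in lebesgue_on I. f t = h t" by eventually_elim simp
    qed
    then show "h \<in> cls I f \<longleftrightarrow> h \<in> cls I g" using assms by (simp add: mem_cls)
  qed
qed

lemma L2_eq: "L2 I W = cls I ` L2fun I W"
  by (auto simp: L2_def quotient_def cls_def)

lemma L2fun_measurable: "y \<in> L2fun I W \<Longrightarrow> y \<in> borel_measurable (lebesgue_on I)"
  by (simp add: L2fun_def)

lemma some_mem_cls:
  assumes "f \<in> borel_measurable (lebesgue_on I)"
  shows "(SOME y. y \<in> cls I f) \<in> borel_measurable (lebesgue_on I)"
    and "AE t in lebesgue_on I. f t = (SOME y. y \<in> cls I f) t"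
proof -
  have "(SOME y. y \<in> cls I f) \<in> cls I f" by (rule someI[of "\<lambda>y. y \<in> cls I f", OF self_mem_cls[OF assms]])
  then show "(SOME y. y \<in> cls I f) \<in> borel_measurable (lebesgue_on I)"
    "AE t in lebesgue_on I. f t = (SOME y. y \<in> cls I f) t" using mem_cls by blast+
qed

text \<open>\<open>L2_inner\<close> chooses representatives by \<open>SOME\<close>; they agree
  almost everywhere with the given functions, so the integral is the same.\<close>

lemma L2_inner_cls:
  assumes y: "y \<in> borel_measurable (lebesgue_on I)" and z: "z \<in> borel_measurable (lebesgue_on I)"
    and W: "W \<in> borel_measurable (lebesgue_on I)"
  shows "L2_inner I W (cls I y) (cls I z) = (\<integral>t. cdot (y t) (W t *v z t) \<partial>lebesgue_on I)"
  unfolding L2_inner_def Let_def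
proof (rule integral_cong_AE)
  let ?y = "SOME f. f \<in> cls I y" and ?z = "SOME f. f \<in> cls I z"
  show "(\<lambda>t. cdot (?y t) (W t *v ?z t)) \<in> borel_measurable (lebesgue_on I)"
    by (intro borel_measurable_cdot borel_measurable_matrix_vector some_mem_cls y z W)
  show "(\<lambda>t. cdot (y t) (W t *v z t)) \<in> borel_measurable (lebesgue_on I)"
    by (intro borel_measurable_cdot borel_measurable_matrix_vector y z W)
  show "AE t in lebesgue_on I. cdot (?y t) (W t *v ?z t) = cdot (y t) (W t *v z t)"
    using some_mem_cls(2)[OF y] some_mem_cls(2)[OF z] by eventually_elim simp
qed

lemma cls_add_cls:
  assumes f: "f \<in> borel_measurable (lebesgue_on I)" and g: "g \<in> borel_measurable (lebesgue_on I)"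
  shows "cls_add I (cls I f) (cls I g) = cls I (\<lambda>t. f t + g t)"
proof (rule set_eqI)
  fix h
  have fg: "(\<lambda>t. f t + g t) \<in> borel_measurable (lebesgue_on I)" using f g by (rule borel_measurable_add)
  show "h \<in> cls_add I (cls I f) (cls I g) \<longleftrightarrow> h \<in> cls I (\<lambda>t. f t + g t)"
  proof
    assume "h \<in> cls_add I (cls I f) (cls I g)"
    then obtain f' g' where *: "f' \<in> cls I f" "g' \<in> cls I g" "((\<lambda>t. f' t + g' t), h) \<in> ae_rel I"
      by (auto simp: cls_add_def)
    then have "AE t in lebesgue_on I. f t = f' t" "AE t in lebesgue_on I. g t = g' t"
      "AE t in lebesgue_on I. f' t + g' t = h t"
      by (auto simp: mem_cls ae_rel_def)
    then have "AE t in lebesgue_on I. f t + g t = h t" by eventually_elim simp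
    then show "h \<in> cls I (\<lambda>t. f t + g t)" using * fg by (simp add: mem_cls ae_rel_def)
  next
    assume "h \<in> cls I (\<lambda>t. f t + g t)"
    then show "h \<in> cls_add I (cls I f) (cls I g)"
      using self_mem_cls[OF f] self_mem_cls[OF g] unfolding cls_add_def cls_def by blast
  qed
qed

text \<open>One argument for pointwise operations on classes; multiplication by a scalar and by a
  gauge are the two instances.\<close>

lemma ae_rel_image_cls:
  assumes f: "f \<in> borel_measurable (lebesgue_on I)" and \<phi>f: "(\<lambda>t. \<phi> t (f t)) \<in> borel_measurable (lebesgue_on I)"
  shows "ae_rel I `` ((\<lambda>g t. \<phi> t (g t)) ` cls I f) = cls I (\<lambda>t. \<phi> t (f t))"
proof (intro set_eqI iffI)
  fix h assume "h \<in> ae_rel I `` ((\<lambda>g t. \<phi> t (g t)) ` cls I f)"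
  then obtain g where *: "g \<in> cls I f" "((\<lambda>t. \<phi> t (g t)), h) \<in> ae_rel I" by auto
  then have "AE t in lebesgue_on I. f t = g t" "AE t in lebesgue_on I. \<phi> t (g t) = h t"
    by (auto simp: mem_cls ae_rel_def)
  then have "AE t in lebesgue_on I. \<phi> t (f t) = h t" by eventually_elim simp
  then show "h \<in> cls I (\<lambda>t. \<phi> t (f t))" using * \<phi>f by (simp add: mem_cls ae_rel_def)
qed (use self_mem_cls[OF f] in \<open>auto simp: cls_def\<close>)

lemma cls_scale_cls:
  assumes f: "f \<in> borel_measurable (lebesgue_on I)"
  shows "cls_scale I c (cls I f) = cls I (\<lambda>t. c *s f t)"
proof -
  have "cls_scale I c (cls I f) = ae_rel I `` ((\<lambda>g t. c *s g t) ` cls I f)"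
    unfolding cls_scale_def by (rule arg_cong[of _ _ "Image (ae_rel I)"]) auto
  then show ?thesis
    by (simp only: ae_rel_image_cls[OF f, of "\<lambda>_ x. c *s x", OF borel_measurable_bounded_linear[OF bounded_linear_scale f]])
qed

lemma U_gauge_cls:
  assumes \<Theta>: "\<Theta> \<in> borel_measurable (lebesgue_on I)" and f: "f \<in> borel_measurable (lebesgue_on I)"
  shows "U_gauge I \<Theta> (cls I f) = cls I (U_fun \<Theta> f)"
  unfolding U_gauge_def U_fun_def[abs_def]
  by (rule ae_rel_image_cls[OF f, of "\<lambda>t x. \<Theta> t *v x", OF borel_measurable_matrix_vector[OF \<Theta> f]])

lemma L2_one_weight_closed:
  assumes "F \<in> L2 I one_weight" "G \<in> L2 I one_weight"
  shows "cls_add I F G \<in> L2 I one_weight" and "cls_scale I c F \<in> L2 I one_weight"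
proof -
  obtain f g where fg: "f \<in> L2fun I one_weight" "g \<in> L2fun I one_weight" "F = cls I f" "G = cls I g"
    using assms by (auto simp: L2_eq)
  note m = L2fun_measurable[OF fg(1)] L2fun_measurable[OF fg(2)]
  have sq: "sq_integrable (lebesgue_on I) f" "sq_integrable (lebesgue_on I) g"
    using fg by (simp_all add: L2fun_one_weight_iff)
  show "cls_add I F G \<in> L2 I one_weight"
    unfolding L2_eq fg(3,4) cls_add_cls[OF m]
    by (intro imageI) (simp add: L2fun_one_weight_iff sq_integrable_add[OF sq])
  show "cls_scale I c F \<in> L2 I one_weight"
    unfolding L2_eq fg(3) cls_scale_cls[OF m(1)]
    by (intro imageI) (simp add: L2fun_one_weight_iff sq_integrable_bounded_linear[OF bounded_linear_scale sq(1)])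
qed

section \<open>Self-adjointness and its transport by unitaries\<close>

lemma L2_dist_cls:
  assumes f: "sq_integrable (lebesgue_on I) f" and g: "sq_integrable (lebesgue_on I) g"
  shows "L2_dist I one_weight (cls I f) (cls I g) = sqrt (\<integral>t. (norm (f t - g t))\<^sup>2 \<partial>lebesgue_on I)"
proof -
  have m: "f \<in> borel_measurable (lebesgue_on I)" "g \<in> borel_measurable (lebesgue_on I)"
    using f g by (auto simp: sq_integrable_def)
  have "cls_add I (cls I f) (cls_scale I (-1) (cls I g)) = cls I (\<lambda>t. f t + (-1) *s g t)"
    by (simp only: cls_scale_cls[OF m(2)] cls_add_cls[OF m(1) borel_measurable_bounded_linear[OF bounded_linear_scale m(2)]])
  also have "(\<lambda>t. f t + (-1) *s g t) = (\<lambda>t. f t - g t)"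
    by (simp add: minus_scale_complex)
  finally have D: "cls_add I (cls I f) (cls_scale I (-1) (cls I g)) = cls I (\<lambda>t. f t - g t)" .
  have dm: "(\<lambda>t. f t - g t) \<in> borel_measurable (lebesgue_on I)" using m by (rule borel_measurable_diff)
  show ?thesis
    unfolding L2_dist_def Let_def D L2_inner_cls[OF dm dm borel_measurable_const]
    by (simp add: cdot_self del: of_real_power)
qed

lemma self_adjoint_in_transport:
  fixes T :: "(real \<Rightarrow> complex^'k) set \<Rightarrow> (real \<Rightarrow> complex^'k) set"
  assumes T: "L2_unitary I one_weight W T" and A: "self_adjoint_in I one_weight A"
  shows "self_adjoint_in I W (map_prod T T ` A)"
proof -
  let ?V = "L2 I one_weight"
  have bij: "bij_betw T ?V (L2 I W)"
    and add: "\<And>F G. F \<in> ?V \<Longrightarrow> G \<in> ?V \<Longrightarrow> T (cls_add I F G) = cls_add I (T F) (T G)"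
    and scale: "\<And>c F. F \<in> ?V \<Longrightarrow> T (cls_scale I c F) = cls_scale I c (T F)"
    and inner: "\<And>F G. F \<in> ?V \<Longrightarrow> G \<in> ?V \<Longrightarrow> L2_inner I W (T F) (T G) = L2_inner I one_weight F G"
    using T by (auto simp: L2_unitary_def)
  have sub: "A \<subseteq> ?V \<times> ?V" and sv: "single_valued A"
    and dense: "\<And>v e. v \<in> ?V \<Longrightarrow> e > 0 \<Longrightarrow> \<exists>u\<in>Domain A. L2_dist I one_weight v u < e"
    and adj: "A = adjoint_graph I one_weight A"
    using A by (auto simp: self_adjoint_in_def)
  have inj: "inj_on T ?V" and img: "T ` ?V = L2 I W" using bij by (auto simp: bij_betw_def)
  have dist: "L2_dist I W (T F) (T G) = L2_dist I one_weight F G" if "F \<in> ?V" "G \<in> ?V" for F G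
  proof -
    have c: "cls_scale I (-1) G \<in> ?V" using that by (intro L2_one_weight_closed)
    have d: "cls_add I F (cls_scale I (-1) G) \<in> ?V" using that c by (intro L2_one_weight_closed)
    show ?thesis
      unfolding L2_dist_def Let_def by (simp only: scale[OF that(2), symmetric] add[OF that(1) c, symmetric] inner[OF d d])
  qed
  show ?thesis
    unfolding self_adjoint_in_def
  proof (intro conjI ballI allI impI)
    show "map_prod T T ` A \<subseteq> L2 I W \<times> L2 I W" using sub img by auto
    show "single_valued (map_prod T T ` A)"
    proof (rule single_valuedI)
      fix x y z assume "(x, y) \<in> map_prod T T ` A" "(x, z) \<in> map_prod T T ` A"
      then obtain x1 y1 x2 z2 where *: "(x1, y1) \<in> A" "(x2, z2) \<in> A" "T x1 = T x2" "y = T y1" "z = T z2"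
        by auto
      then have "x1 = x2" using sub inj by (auto dest: inj_onD)
      then show "y = z" using * sv by (auto dest: single_valuedD)
    qed
  next
    fix v and e :: real assume "v \<in> L2 I W" "e > 0"
    then obtain v0 where v0: "v0 \<in> ?V" "v = T v0" using img by auto
    obtain u where "u \<in> Domain A" and d: "L2_dist I one_weight v0 u < e"
      using dense[OF v0(1) \<open>e > 0\<close>] by blast
    then have "u \<in> ?V" "T u \<in> Domain (map_prod T T ` A)" using sub by force+
    then show "\<exists>u\<in>Domain (map_prod T T ` A). L2_dist I W v u < e"
      using dist[OF v0(1)] d v0(2) by metis
  next
    \<comment> \<open>Since \<open>T\<close> is onto, every pair that competes for the adjoint graph
      is a pair of images, and preservation of inner products pulls the defining identity back to
      \<open>A\<close>.\<close>
    have iff: "(T v, T w) \<in> adjoint_graph I W (map_prod T T ` A) \<longleftrightarrow> (v, w) \<in> A"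
      if "v \<in> ?V" "w \<in> ?V" for v w
    proof -
      have "(\<forall>(u, z)\<in>map_prod T T ` A. L2_inner I W z (T v) = L2_inner I W u (T w))
          \<longleftrightarrow> (\<forall>(u, z)\<in>A. L2_inner I one_weight z v = L2_inner I one_weight u w)"
        using sub inner that by (fastforce simp: case_prod_unfold)
      then show ?thesis
        using that img by (subst (2) adj) (auto simp: adjoint_graph_def)
    qed
    show "map_prod T T ` A = adjoint_graph I W (map_prod T T ` A)"
    proof (intro set_eqI iffI)
      fix p assume "p \<in> map_prod T T ` A"
      then show "p \<in> adjoint_graph I W (map_prod T T ` A)" using iff sub by auto
    next
      fix p assume p: "p \<in> adjoint_graph I W (map_prod T T ` A)"
      then have "fst p \<in> T ` ?V" "snd p \<in> T ` ?V" unfolding img by (auto simp: adjoint_graph_def)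
      then obtain v w where "v \<in> ?V" "w \<in> ?V" "fst p = T v" "snd p = T w" by blast
      then have "p = (T v, T w)" by (simp add: prod_eq_iff)
      moreover have "(v, w) \<in> A" using iff[OF \<open>v \<in> ?V\<close> \<open>w \<in> ?V\<close>] p \<open>p = (T v, T w)\<close> by simp
      ultimately show "p \<in> map_prod T T ` A" by force
    qed
  qed
qed

lemma dirac_op_self_adjoint:
  fixes J B :: "complex^'k^'k"
  assumes J: "cadj J = J" "J ** J = mat 1" and B: "cadj B = B"
    and P: "sq_integrable lebesgue P" and herm: "AE t in lebesgue. cadj (P t) = P t"
  shows "self_adjoint_in UNIV one_weight (dirac_op UNIV J B m P (H1 UNIV))"
proof -
  define w where "w f t = dirac_expr J B m f t + P t *v f t" for f t
  let ?A = "dirac_op UNIV J B m P (H1 UNIV)"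
  have A: "?A = (\<lambda>f. (cls UNIV f, cls UNIV (w f))) ` H1 UNIV"
    by (simp add: dirac_op_def w_def[abs_def])
  have sqf: "sq_integrable lebesgue f" and sqw: "sq_integrable lebesgue (w f)" if "f \<in> H1 UNIV" for f
    using that dirac_expr_sq_integrable[of UNIV f P J B m] P by (auto simp: H1_iff w_def[abs_def])
  have L2: "L2 UNIV one_weight = cls UNIV ` {f :: real \<Rightarrow> complex^'k. sq_integrable lebesgue f}"
    unfolding L2_eq by (auto simp: L2fun_one_weight_iff)
  have inner: "L2_inner UNIV one_weight (cls UNIV f) (cls UNIV g) = (\<integral>t. cdot (f t) (g t) \<partial>lebesgue)"
    if "sq_integrable lebesgue f" "sq_integrable lebesgue g" for f g :: "real \<Rightarrow> complex^'k"
    using that by (subst L2_inner_cls) (auto simp: sq_integrable_def)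
  have eqI: "cls UNIV f = cls UNIV g"
    if "sq_integrable lebesgue f" "sq_integrable lebesgue g" "AE t in lebesgue. f t = g t" for f g :: "real \<Rightarrow> complex^'k"
    using that cls_eq_iff[of f UNIV g, unfolded lebesgue_on_UNIV] by (simp add: sq_integrable_def)
  show ?thesis
    unfolding self_adjoint_in_def
  proof (intro conjI ballI allI impI)
    show "?A \<subseteq> L2 UNIV one_weight \<times> L2 UNIV one_weight"
      unfolding A L2 using sqf sqw by auto
    show "single_valued ?A"
    proof (rule single_valuedI)
      fix x y z assume "(x, y) \<in> ?A" "(x, z) \<in> ?A"
      then obtain f g where fg: "f \<in> H1 UNIV" "g \<in> H1 UNIV" "cls UNIV f = cls UNIV g"
        "y = cls UNIV (w f)" "z = cls UNIV (w g)"
        unfolding A by auto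
      then have "AE t in lebesgue. f t = g t"
        using cls_eq_iff[of f UNIV g, unfolded lebesgue_on_UNIV] sqf by (simp add: sq_integrable_def)
      \<comment> \<open>Both representatives are locally absolutely continuous, so equality of
        classes is equality of functions, and in particular of derivatives.\<close>
      then have "f = g"
        using AC_loc_eq_of_AE_eq[of UNIV f g, unfolded lebesgue_on_UNIV] fg(1,2) by (auto simp: H1_iff)
      then show "y = z" using fg by simp
    qed
  next
    fix v :: "(real \<Rightarrow> complex^'k) set" and e :: real assume "v \<in> L2 UNIV one_weight" "e > 0"
    then obtain f where f: "sq_integrable lebesgue f" "v = cls UNIV f" unfolding L2 by auto
    obtain u where u: "u \<in> H1 UNIV" "(\<integral>t. (norm (f t - u t))\<^sup>2 \<partial>lebesgue) < e\<^sup>2"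
      using H1_dense[OF f(1), of "e\<^sup>2"] \<open>e > 0\<close> by auto
    have "L2_dist UNIV one_weight v (cls UNIV u) < e"
      using L2_dist_cls[of UNIV f u, unfolded lebesgue_on_UNIV] f sqf[OF u(1)] u(2) \<open>e > 0\<close>
      by (simp add: real_sqrt_less_iff real_less_lsqrt)
    moreover have "cls UNIV u \<in> Domain ?A" unfolding A using u(1) by auto
    ultimately show "\<exists>u\<in>Domain ?A. L2_dist UNIV one_weight v u < e" by blast
  next
    show "?A = adjoint_graph UNIV one_weight ?A"
    proof (intro set_eqI iffI)
      fix p assume "p \<in> ?A"
      then obtain g where g: "g \<in> H1 UNIV" and p: "p = (cls UNIV g, cls UNIV (w g))" unfolding A by auto
      have "L2_inner UNIV one_weight (cls UNIV (w f)) (cls UNIV g)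
          = L2_inner UNIV one_weight (cls UNIV f) (cls UNIV (w g))" if f: "f \<in> H1 UNIV" for f
        using dirac_symmetric[OF J(1) B f g P herm, of m] sqf[OF f] sqf[OF g] sqw[OF f] sqw[OF g]
        by (simp add: inner w_def)
      then show "p \<in> adjoint_graph UNIV one_weight ?A"
        unfolding adjoint_graph_def p L2 using sqf[OF g] sqw[OF g] by (auto simp: A)
    next
      fix p assume "p \<in> adjoint_graph UNIV one_weight ?A"
      then obtain v z where vz: "sq_integrable lebesgue v" "sq_integrable lebesgue z"
        and p: "p = (cls UNIV v, cls UNIV z)"
        and adj: "\<And>f. f \<in> H1 UNIV \<Longrightarrow> L2_inner UNIV one_weight (cls UNIV (w f)) (cls UNIV v)
          = L2_inner UNIV one_weight (cls UNIV f) (cls UNIV z)"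
        unfolding adjoint_graph_def L2 A by auto
      have "(\<integral>t. cdot (dirac_expr J B m f t + P t *v f t) (v t) \<partial>lebesgue) = (\<integral>t. cdot (f t) (z t) \<partial>lebesgue)"
        if f: "f \<in> H1 UNIV" for f
        using adj[OF f] inner[OF sqw[OF f] vz(1)] inner[OF sqf[OF f] vz(2)] by (simp add: w_def)
      from dirac_adjoint_regular[OF J B P herm vz this] obtain y where y: "y \<in> H1 UNIV"
        "AE t in lebesgue. y t = v t" "AE t in lebesgue. w y t = z t"
        unfolding w_def by blast
      have "p = (cls UNIV y, cls UNIV (w y))"
        unfolding p using eqI[OF sqf[OF y(1)] vz(1) y(2)] eqI[OF sqw[OF y(1)] vz(2) y(3)] by simp
      then show "p \<in> ?A" unfolding A using y(1) by auto
    qed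
  qed
qed

section \<open>Gauges\<close>

lemma matrix_inv_unique:
  fixes A X :: "complex^'k^'k"
  assumes "X ** A = mat 1" shows "matrix_inv A = X"
proof -
  have AX: "A ** X = mat 1" using assms by (simp add: matrix_left_right_inverse)
  then have "invertible A" using assms by (auto simp: invertible_def)
  then have "matrix_inv A ** A = mat 1" unfolding invertible_def matrix_inv_def by (rule someI2_ex) simp
  then have "matrix_inv A ** (A ** X) = X" by (simp add: matrix_mul_assoc)
  then show ?thesis using AX by simp
qed

text \<open>The maximal operator of H^{-1}(-\<i> J y' + m B y), restricted by a condition
  \<open>C\<close> on the value at 0: trivial on the line, membership in \<Lambda> on the half-line.
  The image is a separate function \<open>z\<close> because \<open>ddt\<close> has its classical
  meaning only almost everywhere.\<close>

definition canonical_op :: "real set \<Rightarrow> complex^'k^'k \<Rightarrow> complex^'k^'k \<Rightarrow> real \<Rightarrow> (real \<Rightarrow> complex^'k^'k)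
    \<Rightarrow> (complex^'k \<Rightarrow> bool) \<Rightarrow> ((real \<Rightarrow> complex^'k) set \<times> (real \<Rightarrow> complex^'k) set) set" where
  "canonical_op I J B m H C = {(cls I y, cls I z) | y z. AC_loc I y \<and> y \<in> L2fun I H \<and> z \<in> L2fun I H \<and>
     (AE t in lebesgue_on I. z t = matrix_inv (H t) *v dirac_expr J B m y t) \<and> C (y 0)}"

context
  fixes J B :: "complex^'k^'k" and m :: real and I :: "real set" and H \<Theta> :: "real \<Rightarrow> complex^'k^'k"
  assumes J: "cadj J = J" "J ** J = mat 1" and I: "I = UNIV \<or> I = {0..}"
    and gauge: "\<Theta> \<in> gauges J H I"
begin

text \<open>The inverse of \<Theta> on \<open>I\<close>: multiply \<Theta>^* J \<Theta> = J by
  \<open>J\<close> from the left and use J^2 = I. Being real-linear in \<Theta>, the formula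
  inherits local absolute continuity at once.\<close>

definition gauge_inv :: "real \<Rightarrow> complex^'k^'k" where
  "gauge_inv t = J ** cadj (\<Theta> t) ** J"

lemma gauge_AC: "AC_loc I \<Theta>"
  using gauge by (simp add: gauges_def)

lemma gauge_inv_AC: "AC_loc I gauge_inv"
  unfolding gauge_inv_def
  by (intro AC_loc_bilinear[OF bounded_bilinear_matrix_matrix] AC_loc_const
      AC_loc_bounded_linear[OF bounded_linear_cadj] gauge_AC)

lemma gauge_J_unitary:
  assumes "t \<in> I" shows "cadj (\<Theta> t) ** J ** \<Theta> t = J"
  using gauge assms by (auto simp: gauges_def J_unitary_def)

lemma gauge_inv_left: "t \<in> I \<Longrightarrow> gauge_inv t ** \<Theta> t = mat 1"
  using gauge_J_unitary[of t] J(2) by (simp add: gauge_inv_def flip: matrix_mul_assoc)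

lemma gauge_inv_right: "t \<in> I \<Longrightarrow> \<Theta> t ** gauge_inv t = mat 1"
  using gauge_inv_left by (simp add: matrix_left_right_inverse)

lemma matrix_inv_gauge: "t \<in> I \<Longrightarrow> matrix_inv (\<Theta> t) = gauge_inv t"
  by (intro matrix_inv_unique gauge_inv_left)

lemma weight_eq: "t \<in> I \<Longrightarrow> H t = cadj (gauge_inv t) ** gauge_inv t"
  using gauge matrix_inv_gauge by (auto simp: gauges_def)

lemma cadj_gauge_inv: "t \<in> I \<Longrightarrow> cadj (\<Theta> t) ** cadj (gauge_inv t) = mat 1"
  using gauge_inv_left[of t] by (metis cadj_mat cadj_mult complex_cnj_one)

lemma matrix_inv_weight: "t \<in> I \<Longrightarrow> matrix_inv (H t) = \<Theta> t ** cadj (\<Theta> t)"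
proof (rule matrix_inv_unique)
  assume t: "t \<in> I"
  have "\<Theta> t ** cadj (\<Theta> t) ** H t = \<Theta> t ** (cadj (\<Theta> t) ** cadj (gauge_inv t)) ** gauge_inv t"
    by (simp add: weight_eq[OF t] matrix_mul_assoc)
  also have "\<dots> = mat 1" using t by (simp add: cadj_gauge_inv gauge_inv_right)
  finally show "\<Theta> t ** cadj (\<Theta> t) ** H t = mat 1" .
qed

lemma gauge_inv_vector: "t \<in> I \<Longrightarrow> gauge_inv t *v (\<Theta> t *v x) = x"
  and gauge_vector_inv: "t \<in> I \<Longrightarrow> \<Theta> t *v (gauge_inv t *v x) = x"
  by (simp_all add: matrix_vector_mul_assoc gauge_inv_left gauge_inv_right)

lemma cdot_weight:
  assumes "t \<in> I"
  shows "cdot x (H t *v y) = cdot (gauge_inv t *v x) (gauge_inv t *v y)"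
  by (simp add: weight_eq[OF assms] cdot_cadj' flip: matrix_vector_mul_assoc)

lemma gauge_measurable:
  shows "\<Theta> \<in> borel_measurable (lebesgue_on I)" and "gauge_inv \<in> borel_measurable (lebesgue_on I)"
  by (intro AC_loc_measurable[OF I] gauge_AC gauge_inv_AC)+

lemma weight_measurable: "H \<in> borel_measurable (lebesgue_on I)"
proof -
  have "(\<lambda>t. cadj (gauge_inv t) ** gauge_inv t) \<in> borel_measurable (lebesgue_on I)"
    by (intro borel_measurable_matrix_matrix borel_measurable_bounded_linear[OF bounded_linear_cadj] gauge_measurable)
  then show ?thesis by (rule measurable_cong[THEN iffD1, rotated]) (simp add: weight_eq)
qed

text \<open>The weighted density y^* H y is the squared norm of \<Theta>^{-1} y, which reduces
  weighted square integrability to the unweighted one.\<close>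

lemma L2fun_weight_iff:
  assumes "y \<in> borel_measurable (lebesgue_on I)"
  shows "y \<in> L2fun I H \<longleftrightarrow> sq_integrable (lebesgue_on I) (\<lambda>t. gauge_inv t *v y t)"
proof -
  have m: "(\<lambda>t. gauge_inv t *v y t) \<in> borel_measurable (lebesgue_on I)"
    by (rule borel_measurable_matrix_vector[OF gauge_measurable(2) assms])
  have "y \<in> L2fun I H \<longleftrightarrow> integrable (lebesgue_on I) (\<lambda>t. cdot (gauge_inv t *v y t) (mat 1 *v (gauge_inv t *v y t)))"
  proof -
    have "integrable (lebesgue_on I) (\<lambda>t. cdot (y t) (H t *v y t))
        \<longleftrightarrow> integrable (lebesgue_on I) (\<lambda>t. cdot (gauge_inv t *v y t) (gauge_inv t *v y t))"
      by (rule Bochner_Integration.integrable_cong[OF refl]) (simp add: cdot_weight)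
    then show ?thesis using assms by (simp add: L2fun_def)
  qed
  then show ?thesis using m by (simp add: L2fun_one_weight_iff[symmetric] L2fun_def)
qed

lemma U_fun_measurable:
  "f \<in> borel_measurable (lebesgue_on I) \<Longrightarrow> U_fun \<Theta> f \<in> borel_measurable (lebesgue_on I)"
  unfolding U_fun_def[abs_def] by (rule borel_measurable_matrix_vector[OF gauge_measurable(1)])

lemma U_fun_L2fun:
  assumes "sq_integrable (lebesgue_on I) f" shows "U_fun \<Theta> f \<in> L2fun I H"
proof -
  have "f \<in> borel_measurable (lebesgue_on I)" using assms by (simp add: sq_integrable_def)
  note m = U_fun_measurable[OF this]
  have "sq_integrable (lebesgue_on I) (\<lambda>t. gauge_inv t *v U_fun \<Theta> f t)"
  proof (rule sq_integrable_bound[OF assms, of _ 1])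
    show "AE t in lebesgue_on I. norm (gauge_inv t *v U_fun \<Theta> f t) \<le> 1 * norm (f t)"
      by (intro AE_I2) (simp add: U_fun_def gauge_inv_vector)
  qed (rule borel_measurable_matrix_vector[OF gauge_measurable(2) m])
  then show ?thesis using m by (simp add: L2fun_weight_iff)
qed

text \<open>By \<open>cdot_weight\<close> the two inner products already agree pointwise under the
  integral, and multiplication by \<open>gauge_inv\<close> supplies preimages.\<close>

lemma U_gauge_unitary: "L2_unitary I one_weight H (U_gauge I \<Theta>)"
proof -
  have cls: "\<exists>f. sq_integrable (lebesgue_on I) f \<and> F = cls I f" if "F \<in> L2 I one_weight" for F
    using that by (auto simp: L2_eq L2fun_one_weight_iff)
  have U: "U_gauge I \<Theta> (cls I f) = cls I (U_fun \<Theta> f)" "f \<in> borel_measurable (lebesgue_on I)"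
    "U_fun \<Theta> f \<in> borel_measurable (lebesgue_on I)" if "sq_integrable (lebesgue_on I) f" for f
  proof -
    show fm: "f \<in> borel_measurable (lebesgue_on I)" using that by (simp add: sq_integrable_def)
    show "U_gauge I \<Theta> (cls I f) = cls I (U_fun \<Theta> f)" by (rule U_gauge_cls[OF gauge_measurable(1) fm])
    show "U_fun \<Theta> f \<in> borel_measurable (lebesgue_on I)" by (rule U_fun_measurable[OF fm])
  qed
  show ?thesis
    unfolding L2_unitary_def
  proof (intro conjI ballI allI)
    show "bij_betw (U_gauge I \<Theta>) (L2 I one_weight) (L2 I H)"
      unfolding bij_betw_def
    proof
      show "inj_on (U_gauge I \<Theta>) (L2 I one_weight)"
      proof (rule inj_onI)
        fix F G assume "F \<in> L2 I one_weight" "G \<in> L2 I one_weight" and eq: "U_gauge I \<Theta> F = U_gauge I \<Theta> G"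
        then obtain f g where fg: "sq_integrable (lebesgue_on I) f" "F = cls I f"
          "sq_integrable (lebesgue_on I) g" "G = cls I g" using cls[of F] cls[of G] by blast
        then have "AE t in lebesgue_on I. U_fun \<Theta> f t = U_fun \<Theta> g t"
          using eq fg(2,4) cls_eq_iff[OF U(3)[OF fg(1)] U(3)[OF fg(3)]] by (simp add: U(1)[OF fg(1)] U(1)[OF fg(3)])
        then have "AE t in lebesgue_on I. f t = g t"
          using AE_space
        proof eventually_elim
          case (elim t)
          have t: "t \<in> I" using elim(2) by simp
          have "gauge_inv t *v U_fun \<Theta> f t = gauge_inv t *v U_fun \<Theta> g t" by (simp only: elim(1))
          then show ?case unfolding U_fun_def gauge_inv_vector[OF t] .
        qed
        then show "F = G" using fg(2,4) cls_eq_iff[OF U(2)[OF fg(1)] U(2)[OF fg(3)]] by simp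
      qed
      show "U_gauge I \<Theta> ` L2 I one_weight = L2 I H"
      proof (intro set_eqI iffI)
        fix Y assume "Y \<in> U_gauge I \<Theta> ` L2 I one_weight"
        then obtain f where f: "sq_integrable (lebesgue_on I) f" "Y = U_gauge I \<Theta> (cls I f)" using cls by blast
        then show "Y \<in> L2 I H" using U[OF f(1)] U_fun_L2fun[OF f(1)] by (simp add: L2_eq)
      next
        fix Y assume "Y \<in> L2 I H"
        then obtain y where y: "y \<in> L2fun I H" "Y = cls I y" by (auto simp: L2_eq)
        then have ym: "y \<in> borel_measurable (lebesgue_on I)" by (simp add: L2fun_measurable)
        define f where "f t = gauge_inv t *v y t" for t
        have f: "sq_integrable (lebesgue_on I) f" using y L2fun_weight_iff[OF ym] by (simp add: f_def[abs_def])
        have "AE t in lebesgue_on I. U_fun \<Theta> f t = y t"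
          by (intro AE_I2) (simp add: U_fun_def f_def gauge_vector_inv)
        then have "U_gauge I \<Theta> (cls I f) = Y"
          using cls_eq_iff[OF U(3)[OF f] ym] y(2) by (simp add: U(1)[OF f])
        moreover have "cls I f \<in> L2 I one_weight" using f by (auto simp: L2_eq L2fun_one_weight_iff)
        ultimately show "Y \<in> U_gauge I \<Theta> ` L2 I one_weight" by blast
      qed
    qed
  next
    fix F G :: "(real \<Rightarrow> complex^'k) set" assume "F \<in> L2 I one_weight" "G \<in> L2 I one_weight"
    then obtain f g where fg: "sq_integrable (lebesgue_on I) f" "F = cls I f"
      "sq_integrable (lebesgue_on I) g" "G = cls I g" using cls[of F] cls[of G] by blast
    have "U_fun \<Theta> (\<lambda>t. f t + g t) = (\<lambda>t. U_fun \<Theta> f t + U_fun \<Theta> g t)"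
      by (simp add: U_fun_def fun_eq_iff matrix_vector_right_distrib)
    then show "U_gauge I \<Theta> (cls_add I F G) = cls_add I (U_gauge I \<Theta> F) (U_gauge I \<Theta> G)"
      using fg U[OF fg(1)] U[OF fg(3)] U(1)[OF sq_integrable_add[OF fg(1,3)]] by (simp add: cls_add_cls)
    have "L2_inner I H (U_gauge I \<Theta> F) (U_gauge I \<Theta> G)
        = (\<integral>t. cdot (U_fun \<Theta> f t) (H t *v U_fun \<Theta> g t) \<partial>lebesgue_on I)"
      using fg U[OF fg(1)] U[OF fg(3)] by (simp add: L2_inner_cls weight_measurable)
    also have "\<dots> = (\<integral>t. cdot (f t) (mat 1 *v g t) \<partial>lebesgue_on I)"
      by (intro Bochner_Integration.integral_cong) (auto simp: cdot_weight U_fun_def gauge_inv_vector)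
    also have "\<dots> = L2_inner I one_weight F G"
      using fg U[OF fg(1)] U[OF fg(3)] by (simp add: L2_inner_cls)
    finally show "L2_inner I H (U_gauge I \<Theta> F) (U_gauge I \<Theta> G) = L2_inner I one_weight F G" .
  next
    fix c and F :: "(real \<Rightarrow> complex^'k) set" assume "F \<in> L2 I one_weight"
    then obtain f where f: "sq_integrable (lebesgue_on I) f" "F = cls I f" using cls[of F] by blast
    have "U_fun \<Theta> (\<lambda>t. c *s f t) = (\<lambda>t. c *s U_fun \<Theta> f t)"
      by (simp add: U_fun_def fun_eq_iff matrix_vector_mult_scale)
    then show "U_gauge I \<Theta> (cls_scale I c F) = cls_scale I c (U_gauge I \<Theta> F)"
      using f U[OF f(1)] U(1)[OF sq_integrable_bounded_linear[OF bounded_linear_scale f(1), of c]]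
      by (simp add: cls_scale_cls)
  qed
qed

lemma AE_gauge_derivative: "AE t in lebesgue_on I. (\<Theta> has_vector_derivative ddt \<Theta> t) (at t)"
  by (rule AC_loc_AE_derivative[OF I gauge_AC])

text \<open>\<open>ddt\<close> is two-sided, while y = \<Theta> f is known only on \<open>I\<close>.
  Derivatives can therefore be compared at interior points, which excludes just the endpoint 0 of
  the half-line.\<close>

lemma AE_interior: "AE t in lebesgue_on I. t \<in> interior I"
proof -
  have "AE t in lebesgue. t \<notin> {0 :: real}"
    by (rule AE_not_in_negligible) simp
  then have "AE t in lebesgue. t \<in> I \<longrightarrow> t \<in> interior I"
    by eventually_elim (use I in \<open>auto simp: interior_real_atLeast\<close>)
  then show ?thesis using I by (subst AE_restrict_space_iff) auto
qed

text \<open>With y = \<Theta> f the product rule gives \<Theta>^* (-\<i> J y' + m B y) = -\<i> J f'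
  - \<i> \<Theta>^* J \<Theta>' f + m \<Theta>^* B \<Theta> f. Adding and subtracting m B f turns
  this into D_m f + P f, which explains the formula for \<open>gauge_pot\<close>; a further factor
  \<Theta> on the left completes \<Theta>^* to H^{-1}.\<close>

lemma gauge_dirac_expr:
  fixes f y :: "real \<Rightarrow> complex^'k"
  assumes f: "AC_loc I f" and y: "\<And>t. t \<in> I \<Longrightarrow> y t = \<Theta> t *v f t"
  shows "AE t in lebesgue_on I. \<Theta> t *v (dirac_expr J B m f t + gauge_pot J B m \<Theta> t *v f t)
      = matrix_inv (H t) *v dirac_expr J B m y t"
  using AE_gauge_derivative AC_loc_AE_derivative[OF I f] AE_interior
proof eventually_elim
  case (elim t)
  have t: "t \<in> I" using elim(3) interior_subset by blast
  have "((\<lambda>s. \<Theta> s *v f s) has_vector_derivative \<Theta> t *v ddt f t + ddt \<Theta> t *v f t) (at t)"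
    by (intro bounded_bilinear.has_vector_derivative[OF bounded_bilinear_matrix_vector] elim)
  then have "(y has_vector_derivative \<Theta> t *v ddt f t + ddt \<Theta> t *v f t) (at t)"
    by (rule has_vector_derivative_transform_within_open[of _ _ _ "interior I"])
      (use elim(3) y subsetD[OF interior_subset[of I]] in auto)
  then have dy: "ddt y t = \<Theta> t *v ddt f t + ddt \<Theta> t *v f t" by (rule vector_derivative_at)
  have JT: "cadj (\<Theta> t) *v (J *v (\<Theta> t *v x)) = J *v x" for x
    using gauge_J_unitary[OF t] by (simp add: matrix_vector_mul_assoc matrix_mul_assoc)
  have "cadj (\<Theta> t) *v dirac_expr J B m y t = dirac_expr J B m f t + gauge_pot J B m \<Theta> t *v f t"
    unfolding dirac_expr_def dy y[OF t] gauge_pot_def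
    by (simp add: matrix_vector_right_distrib matrix_vector_mult_diff_distrib matrix_vector_mult_add_rdistrib
        matrix_vector_mult_diff_rdistrib matrix_vector_mult_scale matrix_vector_mult_scaleR_complex
        scaleR_matrix_vector_mult JT mat_vector_mult matrix_vector_mult_minus scale_add_complex
        scale_diff_complex minus_scale_complex scaleR_diff_right algebra_simps flip: matrix_vector_mul_assoc)
  then show ?case
    by (simp add: matrix_inv_weight[OF t] flip: matrix_vector_mul_assoc)
qed

text \<open>Differentiating \<Theta>^* J \<Theta> = J shows that \<Theta>^* J \<Theta>' is
  skew-Hermitian wherever \<Theta> is differentiable, so -\<i> times it is Hermitian. The mass part
  is Hermitian because \<open>B\<close> is.\<close>

lemma gauge_pot_hermitian:
  assumes "I = UNIV" and B: "cadj B = B"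
  shows "AE t in lebesgue. cadj (gauge_pot J B m \<Theta> t) = gauge_pot J B m \<Theta> t"
  using AE_gauge_derivative[unfolded assms(1) lebesgue_on_UNIV]
proof eventually_elim
  case (elim t)
  define X where "X = ddt \<Theta> t"
  have "((\<lambda>s. cadj (\<Theta> s) ** J ** \<Theta> s) has_vector_derivative
      (cadj (\<Theta> t) ** J) ** X + (cadj (\<Theta> t) ** 0 + cadj X ** J) ** \<Theta> t) (at t)"
    unfolding X_def
    by (intro bounded_bilinear.has_vector_derivative[OF bounded_bilinear_matrix_matrix]
        bounded_linear.has_vector_derivative[OF bounded_linear_cadj] has_vector_derivative_const elim)
  moreover have "(\<lambda>s. cadj (\<Theta> s) ** J ** \<Theta> s) = (\<lambda>_. J)"
    using gauge_J_unitary assms(1) by auto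
  ultimately have "((\<lambda>_. J) has_vector_derivative cadj (\<Theta> t) ** J ** X + cadj X ** J ** \<Theta> t) (at t)"
    by simp
  from vector_derivative_unique_at[OF this has_vector_derivative_const]
  have K: "cadj X ** J ** \<Theta> t = - (cadj (\<Theta> t) ** J ** X)" by (simp add: add_eq_0_iff)
  have "cadj (mat (- \<i>) ** cadj (\<Theta> t) ** J ** X) = (cadj X ** J ** \<Theta> t) ** mat \<i>"
    by (simp add: cadj_mult cadj_mat J(1) matrix_mul_assoc)
  also have "\<dots> = mat (- \<i>) ** cadj (\<Theta> t) ** J ** X"
    unfolding K mat_matrix_mult_commute[symmetric]
    by (simp add: vec_eq_iff matrix_matrix_mult_def mat_def if_distrib if_distribR sum.delta sum_negf
        sum_distrib_left sum_distrib_right mult.assoc cong: if_cong)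
  finally have 1: "cadj (mat (- \<i>) ** cadj (\<Theta> t) ** J ** X) = mat (- \<i>) ** cadj (\<Theta> t) ** J ** X" .
  have "cadj (cadj (\<Theta> t) ** B ** \<Theta> t) = cadj (\<Theta> t) ** B ** \<Theta> t"
    by (simp add: cadj_mult B matrix_mul_assoc)
  with 1 show ?case
    by (simp add: gauge_pot_def cadj_add cadj_diff cadj_scaleR B X_def)
qed

section \<open>Transported operators, their domains and gauge independence\<close>

context
  assumes P: "matrix_L2 I (gauge_pot J B m \<Theta>)"
begin

lemma gauge_pot_sq_integrable: "sq_integrable (lebesgue_on I) (gauge_pot J B m \<Theta>)"
  using P by (simp add: matrix_L2_iff)

lemma H1_sq_integrable:
  assumes "f \<in> H1 I"
  shows "sq_integrable (lebesgue_on I) f"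
    and "sq_integrable (lebesgue_on I) (\<lambda>t. dirac_expr J B m f t + gauge_pot J B m \<Theta> t *v f t)"
  using assms dirac_expr_sq_integrable[OF I assms gauge_pot_sq_integrable] by (auto simp: H1_iff)

lemma U_gauge_cls_gauge:
  fixes f :: "real \<Rightarrow> complex^'k"
  assumes "sq_integrable (lebesgue_on I) f"
  shows "U_gauge I \<Theta> (cls I f) = cls I (U_fun \<Theta> f)"
  using assms by (intro U_gauge_cls gauge_measurable(1)) (simp add: sq_integrable_def)

lemma transported_op_eq:
  assumes "D \<subseteq> H1 I"
  shows "transported_op I J B m \<Theta> D = (\<lambda>f. (cls I (U_fun \<Theta> f),
      cls I (U_fun \<Theta> (\<lambda>t. dirac_expr J B m f t + gauge_pot J B m \<Theta> t *v f t)))) ` D"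
  unfolding transported_op_def dirac_op_def image_image
proof (rule image_cong[OF refl])
  fix f assume "f \<in> D"
  then have f: "f \<in> H1 I" using assms by blast
  show "map_prod (U_gauge I \<Theta>) (U_gauge I \<Theta>)
      (cls I f, cls I (\<lambda>t. dirac_expr J B m f t + gauge_pot J B m \<Theta> t *v f t)) = (cls I (U_fun \<Theta> f),
      cls I (U_fun \<Theta> (\<lambda>t. dirac_expr J B m f t + gauge_pot J B m \<Theta> t *v f t)))"
    by (simp add: U_gauge_cls_gauge H1_sq_integrable[OF f])
qed

lemma Domain_transported_op:
  assumes "D \<subseteq> H1 I"
  shows "Domain (transported_op I J B m \<Theta> D) = U_gauge I \<Theta> ` cls I ` D"
proof -
  have "Domain (transported_op I J B m \<Theta> D) = (\<lambda>f. cls I (U_fun \<Theta> f)) ` D"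
    unfolding transported_op_eq[OF assms] by force
  also have "\<dots> = (\<lambda>f. U_gauge I \<Theta> (cls I f)) ` D"
    using assms by (intro image_cong[OF refl]) (auto simp: U_gauge_cls_gauge H1_sq_integrable(1))
  finally show ?thesis by (simp add: image_image)
qed

lemma U_fun_AC_loc: "AC_loc I f \<Longrightarrow> AC_loc I (U_fun \<Theta> f)"
  unfolding U_fun_def[abs_def]
  by (intro AC_loc_bilinear[OF bounded_bilinear_matrix_vector] gauge_AC)

text \<open>The right-hand side does not mention the gauge, which is the reason for gauge independence.\<close>

lemma transported_op_eq_canonical_op:
  "transported_op I J B m \<Theta> {f \<in> H1 I. C (\<Theta> 0 *v f 0)} = canonical_op I J B m H C"
proof -
  define w where "w f t = dirac_expr J B m f t + gauge_pot J B m \<Theta> t *v f t" for f t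
  have "transported_op I J B m \<Theta> {f \<in> H1 I. C (\<Theta> 0 *v f 0)}
      = (\<lambda>f. (cls I (U_fun \<Theta> f), cls I (U_fun \<Theta> (w f)))) ` {f \<in> H1 I. C (\<Theta> 0 *v f 0)}"
    by (subst transported_op_eq) (auto simp: w_def[abs_def])
  also have "\<dots> = canonical_op I J B m H C"
  proof (intro set_eqI iffI)
    fix p assume "p \<in> (\<lambda>f. (cls I (U_fun \<Theta> f), cls I (U_fun \<Theta> (w f)))) ` {f \<in> H1 I. C (\<Theta> 0 *v f 0)}"
    then obtain f where f: "f \<in> H1 I" "C (\<Theta> 0 *v f 0)" and p: "p = (cls I (U_fun \<Theta> f), cls I (U_fun \<Theta> (w f)))"
      by blast
    have fac: "AC_loc I f" using f(1) by (simp add: H1_iff)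
    have "AE t in lebesgue_on I. U_fun \<Theta> (w f) t = matrix_inv (H t) *v dirac_expr J B m (U_fun \<Theta> f) t"
      using gauge_dirac_expr[OF fac, of "U_fun \<Theta> f"] by (simp add: U_fun_def w_def)
    moreover have "U_fun \<Theta> f \<in> L2fun I H" "U_fun \<Theta> (w f) \<in> L2fun I H"
      using H1_sq_integrable[OF f(1)] by (auto simp: w_def[abs_def] intro: U_fun_L2fun)
    ultimately show "p \<in> canonical_op I J B m H C"
      unfolding canonical_op_def p mem_Collect_eq
      using U_fun_AC_loc[OF fac] f(2) by (intro exI[of _ "U_fun \<Theta> f"] exI[of _ "U_fun \<Theta> (w f)"]) (simp add: U_fun_def)
  next
    fix p assume "p \<in> canonical_op I J B m H C"
    then obtain y z where p: "p = (cls I y, cls I z)" and y: "AC_loc I y" "y \<in> L2fun I H" and z: "z \<in> L2fun I H"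
      and eq: "AE t in lebesgue_on I. z t = matrix_inv (H t) *v dirac_expr J B m y t" and C: "C (y 0)"
      unfolding canonical_op_def by blast
    \<comment> \<open>The only possible preimage of \<open>y\<close>; it is locally absolutely
      continuous because the inverse gauge is.\<close>
    define f where "f t = gauge_inv t *v y t" for t
    have yf: "y t = \<Theta> t *v f t" if "t \<in> I" for t
      using gauge_vector_inv[OF that] by (simp add: f_def)
    have m: "y \<in> borel_measurable (lebesgue_on I)" "z \<in> borel_measurable (lebesgue_on I)"
      using y z by (auto simp: L2fun_measurable)
    have f: "sq_integrable (lebesgue_on I) f" "AC_loc I f"
      unfolding f_def[abs_def] using y L2fun_weight_iff[OF m(1)]
      by (auto intro!: AC_loc_bilinear[OF bounded_bilinear_matrix_vector] gauge_inv_AC)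
    have gz: "sq_integrable (lebesgue_on I) (\<lambda>t. gauge_inv t *v z t)"
      using z L2fun_weight_iff[OF m(2)] by simp
    have "AE t in lebesgue_on I. \<Theta> t *v w f t = matrix_inv (H t) *v dirac_expr J B m y t"
      unfolding w_def by (rule gauge_dirac_expr[OF f(2) yf])
    then have \<Theta>w: "AE t in lebesgue_on I. \<Theta> t *v w f t = z t"
      using eq by eventually_elim simp
    have w: "AE t in lebesgue_on I. w f t = gauge_inv t *v z t"
      using \<Theta>w AE_space
    proof eventually_elim
      case (elim t)
      have "t \<in> I" using elim(2) by simp
      from gauge_inv_vector[OF this] show ?case unfolding elim(1)[symmetric] by simp
    qed
    \<comment> \<open>The bound comes from \<open>z\<close> alone, without separate knowledge of f'
      or P f; this is the hypothesis of \<open>H1_of_dirac_expr\<close>, which now returns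
      \<open>f\<close> to H^1.\<close>
    have "sq_integrable (lebesgue_on I) (w f)"
    proof (rule sq_integrable_bound[OF gz, of _ 1])
      show "w f \<in> borel_measurable (lebesgue_on I)"
        unfolding w_def[abs_def] using gauge_pot_sq_integrable
        by (intro dirac_expr_measurable[OF I f(2)]) (simp add: sq_integrable_def)
      show "AE t in lebesgue_on I. norm (w f t) \<le> 1 * norm (gauge_inv t *v z t)" using w by eventually_elim simp
    qed
    then have fH1: "f \<in> H1 I"
      using H1_of_dirac_expr[OF I J(2) f(2,1) gauge_pot_sq_integrable] by (simp add: w_def[abs_def])
    have um: "U_fun \<Theta> f \<in> borel_measurable (lebesgue_on I)" "U_fun \<Theta> (w f) \<in> borel_measurable (lebesgue_on I)"
      using H1_sq_integrable[OF fH1]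
      by (auto simp: w_def[abs_def] sq_integrable_def intro: U_fun_measurable)
    have "AE t in lebesgue_on I. U_fun \<Theta> f t = y t"
      by (intro AE_I2) (simp add: U_fun_def yf)
    then have "cls I (U_fun \<Theta> f) = cls I y" using cls_eq_iff[OF um(1) m(1)] by simp
    moreover have "cls I (U_fun \<Theta> (w f)) = cls I z" using cls_eq_iff[OF um(2) m(2)] \<Theta>w by (simp add: U_fun_def)
    moreover have "C (\<Theta> 0 *v f 0)" using C yf[of 0] I by auto
    ultimately show "p \<in> (\<lambda>f. (cls I (U_fun \<Theta> f), cls I (U_fun \<Theta> (w f)))) ` {f \<in> H1 I. C (\<Theta> 0 *v f 0)}"
      using fH1 unfolding p by (intro image_eqI[of _ _ f]) auto
  qed
  finally show ?thesis .
qed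

lemma L_gauge_iff: "u \<in> L_gauge \<Theta> \<Lambda> \<longleftrightarrow> \<Theta> 0 *v u \<in> \<Lambda>"
proof -
  have 0: "0 \<in> I" using I by auto
  show ?thesis
  proof
    assume "u \<in> L_gauge \<Theta> \<Lambda>"
    then obtain x where "x \<in> \<Lambda>" "u = gauge_inv 0 *v x"
      by (auto simp: L_gauge_def matrix_inv_gauge[OF 0])
    then show "\<Theta> 0 *v u \<in> \<Lambda>" by (simp add: gauge_vector_inv[OF 0])
  next
    assume "\<Theta> 0 *v u \<in> \<Lambda>"
    then show "u \<in> L_gauge \<Theta> \<Lambda>"
      unfolding L_gauge_def matrix_inv_gauge[OF 0]
      by (rule image_eqI[rotated]) (simp add: gauge_inv_vector[OF 0])
  qed
qed

lemma full_line_op_eq: "I = UNIV \<Longrightarrow> full_line_op J B m \<Theta> = canonical_op UNIV J B m H (\<lambda>_. True)"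
  using transported_op_eq_canonical_op[of "\<lambda>_. True"] by (simp add: full_line_op_def)

lemma half_line_op_eq: "I = {0..} \<Longrightarrow> half_line_op J B m \<Theta> \<Lambda> = canonical_op {0..} J B m H (\<lambda>x. x \<in> \<Lambda>)"
  using transported_op_eq_canonical_op[of "\<lambda>x. x \<in> \<Lambda>"] by (simp add: half_line_op_def L_gauge_iff)

text \<open>A locally absolutely continuous member of \<open>Y\<close> must be the function used in
  \<open>canonical_op\<close>, and members of \<open>Z\<close> differ only on null sets, so the
  formula does not depend on the representatives.\<close>

lemma full_line_op_acts:
  assumes "I = UNIV" and YZ: "(Y, Z) \<in> full_line_op J B m \<Theta>"
  shows "\<exists>y\<in>Y. AC_loc UNIV y"
    and "\<And>y z. y \<in> Y \<Longrightarrow> AC_loc UNIV y \<Longrightarrow> z \<in> Z \<Longrightarrow>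
      AE t in lebesgue. z t = matrix_inv (H t) *v dirac_expr J B m y t"
proof -
  obtain y0 z0 where y0: "AC_loc UNIV y0" "y0 \<in> L2fun UNIV H" "z0 \<in> L2fun UNIV H" "Y = cls UNIV y0" "Z = cls UNIV z0"
    and eq: "AE t in lebesgue. z0 t = matrix_inv (H t) *v dirac_expr J B m y0 t"
    using YZ unfolding full_line_op_eq[OF assms(1)] canonical_op_def lebesgue_on_UNIV by blast
  show "\<exists>y\<in>Y. AC_loc UNIV y" using y0 self_mem_cls L2fun_measurable by blast
  fix y z assume y: "y \<in> Y" "AC_loc UNIV y" and z: "z \<in> Z"
  have "y0 t = y t" for t
    using AC_loc_eq_of_AE_eq[of UNIV y0 y t] y y0 by (simp add: mem_cls)
  then have "y0 = y" by (rule ext)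
  have "AE t in lebesgue. z0 t = z t" using z unfolding y0(5) mem_cls lebesgue_on_UNIV by blast
  with eq show "AE t in lebesgue. z t = matrix_inv (H t) *v dirac_expr J B m y t"
    unfolding \<open>y0 = y\<close> by eventually_elim simp
qed

text \<open>The boundary condition on a class is tested on a locally absolutely continuous member.
  All such members have the same value at 0, namely \<Theta>(0) f(0), so the condition is one on
  f(0).\<close>

lemma half_line_domain_eq:
  assumes "I = {0..}"
  shows "{Y \<in> U_gauge {0..} \<Theta> ` cls {0..} ` H1 {0..}. \<exists>y\<in>Y. AC_loc {0..} y \<and> y 0 \<in> \<Lambda>} =
    U_gauge {0..} \<Theta> ` cls {0..} ` {f \<in> H1 {0..}. f 0 \<in> L_gauge \<Theta> \<Lambda>}"
proof -
  have "(\<exists>y\<in>U_gauge I \<Theta> (cls I f). AC_loc I y \<and> y 0 \<in> \<Lambda>) \<longleftrightarrow> f 0 \<in> L_gauge \<Theta> \<Lambda>" if f: "f \<in> H1 I" for f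
  proof -
    have U: "U_gauge I \<Theta> (cls I f) = cls I (U_fun \<Theta> f)" "AC_loc I (U_fun \<Theta> f)"
      "U_fun \<Theta> f \<in> borel_measurable (lebesgue_on I)"
      using H1_sq_integrable(1)[OF f] f
      by (auto simp: U_gauge_cls_gauge H1_iff sq_integrable_def intro: U_fun_AC_loc U_fun_measurable)
    have "y 0 = \<Theta> 0 *v f 0" if "y \<in> cls I (U_fun \<Theta> f)" "AC_loc I y" for y
      using AC_loc_eq_of_AE_eq[OF I U(2) that(2), of 0] that(1) I by (auto simp: mem_cls U_fun_def)
    moreover have "U_fun \<Theta> f 0 = \<Theta> 0 *v f 0" by (simp add: U_fun_def)
    ultimately show ?thesis
      unfolding U(1) L_gauge_iff using U(2) self_mem_cls[OF U(3)] by metis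
  qed
  then show ?thesis unfolding assms[symmetric] by blast
qed

end

end

theorem lemma3p2:
  fixes n :: nat and J B :: "complex^'k^'k" and m :: real and I :: "real set"
    and H \<Theta> :: "real \<Rightarrow> complex^'k^'k"
  assumes "n \<ge> 1" and "CARD('k) = 2 * n"
    and "cadj J = J" and "cadj B = B" and "J ** J = mat 1" and "B ** B = mat 1"
    and "J ** B = - (B ** J)"
    and "m > 0"
    and "I = UNIV \<or> I = {0..}"
    and "AC_loc I H" and "\<And>t. t \<in> I \<Longrightarrow> pos_def (H t)"
    and "\<And>t. t \<in> I \<Longrightarrow> H t ** J ** H t = J"
    and "\<Theta> \<in> gauges J H I" and "matrix_L2 I (gauge_pot J B m \<Theta>)"
  shows
    "L2_unitary I one_weight H (U_gauge I \<Theta>)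
    \<and>
    (I = UNIV \<longrightarrow>
      Domain (full_line_op J B m \<Theta>) = U_gauge UNIV \<Theta> ` cls UNIV ` H1 UNIV \<and>
      self_adjoint_in UNIV H (full_line_op J B m \<Theta>) \<and>
      (\<forall>(Y, Z)\<in>full_line_op J B m \<Theta>.
         (\<exists>y\<in>Y. AC_loc UNIV y) \<and>
         (\<forall>y\<in>Y. AC_loc UNIV y \<longrightarrow>
            (\<forall>z\<in>Z. AE t in lebesgue. z t = matrix_inv (H t) *v dirac_expr J B m y t))))
    \<and>
    (I = {0..} \<longrightarrow> (\<forall>\<Lambda>. max_J_isotropic J n \<Lambda> \<longrightarrow>
      (\<forall>f\<in>H1 {0..}. U_fun \<Theta> f 0 \<in> \<Lambda> \<longleftrightarrow> f 0 \<in> L_gauge \<Theta> \<Lambda>) \<and>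
      {Y \<in> U_gauge {0..} \<Theta> ` cls {0..} ` H1 {0..}. \<exists>y\<in>Y. AC_loc {0..} y \<and> y 0 \<in> \<Lambda>} =
        U_gauge {0..} \<Theta> ` cls {0..} ` {f \<in> H1 {0..}. f 0 \<in> L_gauge \<Theta> \<Lambda>} \<and>
      Domain (half_line_op J B m \<Theta> \<Lambda>) =
        U_gauge {0..} \<Theta> ` cls {0..} ` {f \<in> H1 {0..}. f 0 \<in> L_gauge \<Theta> \<Lambda>}))
    \<and>
    (\<forall>\<Theta>\<^sub>0 \<Theta>\<^sub>1. \<Theta>\<^sub>0 \<in> gauges J H I \<longrightarrow> matrix_L2 I (gauge_pot J B m \<Theta>\<^sub>0) \<longrightarrow>
      \<Theta>\<^sub>1 \<in> gauges J H I \<longrightarrow> matrix_L2 I (gauge_pot J B m \<Theta>\<^sub>1) \<longrightarrow>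
      (I = UNIV \<longrightarrow>
         full_line_op J B m \<Theta>\<^sub>0 = full_line_op J B m \<Theta>\<^sub>1 \<and>
         Domain (full_line_op J B m \<Theta>\<^sub>0) = Domain (full_line_op J B m \<Theta>\<^sub>1)) \<and>
      (I = {0..} \<longrightarrow> (\<forall>\<Lambda>. max_J_isotropic J n \<Lambda> \<longrightarrow>
         half_line_op J B m \<Theta>\<^sub>0 \<Lambda> = half_line_op J B m \<Theta>\<^sub>1 \<Lambda> \<and>
         Domain (half_line_op J B m \<Theta>\<^sub>0 \<Lambda>) = Domain (half_line_op J B m \<Theta>\<^sub>1 \<Lambda>))))"
proof -
  note J = \<open>cadj J = J\<close> \<open>J ** J = mat 1\<close> and B = \<open>cadj B = B\<close>
    and I = \<open>I = UNIV \<or> I = {0..}\<close> and \<Theta> = \<open>\<Theta> \<in> gauges J H I\<close> \<open>matrix_L2 I (gauge_pot J B m \<Theta>)\<close>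
  show ?thesis
  proof (intro conjI impI allI ballI)
    show unitary: "L2_unitary I one_weight H (U_gauge I \<Theta>)" by (rule U_gauge_unitary[OF J I \<Theta>(1)])
    {
      assume U: "I = UNIV"
      show "Domain (full_line_op J B m \<Theta>) = U_gauge UNIV \<Theta> ` cls UNIV ` H1 UNIV"
        using Domain_transported_op[OF J I \<Theta>, of "H1 UNIV"] by (simp add: U full_line_op_def)
      \<comment> \<open>Self-adjointness is settled in the unweighted space, where the potential is
        Hermitian, and then carried over by the unitary of part (a).\<close>
      have "self_adjoint_in UNIV one_weight (dirac_op UNIV J B m (gauge_pot J B m \<Theta>) (H1 UNIV))"
        using dirac_op_self_adjoint[OF J B _ gauge_pot_hermitian[OF J I \<Theta>(1) U B]] \<Theta>(2)
        by (simp add: matrix_L2_iff U)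
      then show "self_adjoint_in UNIV H (full_line_op J B m \<Theta>)"
        unfolding full_line_op_def transported_op_def
        using self_adjoint_in_transport unitary U by blast
      fix YZ assume "YZ \<in> full_line_op J B m \<Theta>"
      then show "case YZ of (Y, Z) \<Rightarrow> (\<exists>y\<in>Y. AC_loc UNIV y) \<and>
         (\<forall>y\<in>Y. AC_loc UNIV y \<longrightarrow>
            (\<forall>z\<in>Z. AE t in lebesgue. z t = matrix_inv (H t) *v dirac_expr J B m y t))"
        using full_line_op_acts[OF J I \<Theta> U] by (cases YZ) blast
    }
    {
      fix \<Lambda> assume h: "I = {0..}"
      show "U_fun \<Theta> f 0 \<in> \<Lambda> \<longleftrightarrow> f 0 \<in> L_gauge \<Theta> \<Lambda>" for f
        by (simp add: U_fun_def L_gauge_iff[OF J I \<Theta>])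
      show "{Y \<in> U_gauge {0..} \<Theta> ` cls {0..} ` H1 {0..}. \<exists>y\<in>Y. AC_loc {0..} y \<and> y 0 \<in> \<Lambda>} =
        U_gauge {0..} \<Theta> ` cls {0..} ` {f \<in> H1 {0..}. f 0 \<in> L_gauge \<Theta> \<Lambda>}"
        by (rule half_line_domain_eq[OF J I \<Theta> h])
      show "Domain (half_line_op J B m \<Theta> \<Lambda>) =
        U_gauge {0..} \<Theta> ` cls {0..} ` {f \<in> H1 {0..}. f 0 \<in> L_gauge \<Theta> \<Lambda>}"
        using Domain_transported_op[OF J I \<Theta>, of "{f \<in> H1 {0..}. f 0 \<in> L_gauge \<Theta> \<Lambda>}"]
        by (auto simp: h half_line_op_def)
    }
    fix \<Theta>\<^sub>0 \<Theta>\<^sub>1 :: "real \<Rightarrow> complex^'k^'k"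
    assume \<Theta>01: "\<Theta>\<^sub>0 \<in> gauges J H I" "matrix_L2 I (gauge_pot J B m \<Theta>\<^sub>0)"
      "\<Theta>\<^sub>1 \<in> gauges J H I" "matrix_L2 I (gauge_pot J B m \<Theta>\<^sub>1)"
    show full: "full_line_op J B m \<Theta>\<^sub>0 = full_line_op J B m \<Theta>\<^sub>1" if "I = UNIV"
      using full_line_op_eq[OF J I \<Theta>01(1,2) that] full_line_op_eq[OF J I \<Theta>01(3,4) that] by simp
    then show "Domain (full_line_op J B m \<Theta>\<^sub>0) = Domain (full_line_op J B m \<Theta>\<^sub>1)" if "I = UNIV"
      using that by simp
    fix \<Lambda>
    show half: "half_line_op J B m \<Theta>\<^sub>0 \<Lambda> = half_line_op J B m \<Theta>\<^sub>1 \<Lambda>" if "I = {0..}"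
      using half_line_op_eq[OF J I \<Theta>01(1,2) that] half_line_op_eq[OF J I \<Theta>01(3,4) that] by simp
    then show "Domain (half_line_op J B m \<Theta>\<^sub>0 \<Lambda>) = Domain (half_line_op J B m \<Theta>\<^sub>1 \<Lambda>)" if "I = {0..}"
      using that by simp
  qed
qed

end
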